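(* Let $\Omega=(0,1)$, let $p,q>1$ and let $\alpha,\beta\ge1$ be real numbers satisfying $\frac{\alpha}{p}+\frac{\beta}{q}=1$. Then the principal eigenvalue $\lambda(p,q)$ of the system $$-\Delta_p u=\lambda|u|^{\alpha-1}|v|^{\beta-1}v,\qquad -\Delta_q v=\lambda|u|^{\alpha-1}|v|^{\beta-1}u\quad\text{in }\Omega,\qquad u=v=0\ \text{ on }\partial\Omega,$$ satisfies $$\lambda(p,q)\le\frac1C\left(\frac{\alpha}{p}\lambda(p)+\frac{\beta}{q}\lambda(q)\right),$$ where $$C=(1+p)^{\alpha/p}(1+q)^{\beta/q}\,\mathcal{B}(1+\alpha,1+\beta)$$ and $\mathcal{B}(r,s)=\int_0^1x^{r-1}(1-x)^{s-1}\,dx$ is the beta function.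
   Context: For $r>1$, $\Delta_r w=\operatorname{div}(|\nabla w|^{r-2}\nabla w)$ is the $r$-Laplacian (in dimension one, $(|w'|^{r-2}w')'$), and its first eigenvalue in $W^{1,r}_0(\Omega)$ is $$\lambda(r)=\min_{u\in W^{1,r}_0(\Omega),\,u\neq0}\frac{\int_\Omega|\nabla u|^r\,dx}{\int_\Omega|u|^r\,dx}.$$ The principal eigenvalue $\lambda(p,q)$ of the system is the least positive parameter $\lambda$ for which the system has a weak solution $(u,v)\in W^{1,p}_0(\Omega)\times W^{1,q}_0(\Omega)$ with $u\ne0$ and $v\ne0$; it is known that it is given by $$\lambda(p,q)=\min_{(u,v)\in\mathcal{A}}\frac{\frac{\alpha}{p}\int_\Omega|\nabla u|^p\,dx+\frac{\beta}{q}\int_\Omega|\nabla v|^q\,dx}{\int_\Omega|u|^{\alpha-1}|v|^{\beta-1}uv\,dx},$$ where $$\mathcal{A}=\left\{(u,v)\in W^{1,p}_0(\Omega)\times W^{1,q}_0(\Omega):\int_\Omega|u|^{\alpha-1}|v|^{\beta-1}uv\,dx>0\right\}.$$ *)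

theory Defs
  imports "HOL-Analysis.Analysis"
begin

text \<open>
  Sobolev spaces on an open set of reals. Their elements are functions defined everywhere, not
  equivalence classes, so \<open>u \<noteq> 0\<close> has to be read as: \<open>u\<close> is not almost everywhere zero.
\<close>

definition test_function :: "real set \<Rightarrow> (real \<Rightarrow> real) \<Rightarrow> bool" where
  "test_function \<Omega> \<phi> \<longleftrightarrow>
     (\<forall>k x. (deriv ^^ k) \<phi> field_differentiable at x) \<and>
     compact (closure {x. \<phi> x \<noteq> 0}) \<and> closure {x. \<phi> x \<noteq> 0} \<subseteq> \<Omega>"

definition locally_integrable :: "real set \<Rightarrow> (real \<Rightarrow> real) \<Rightarrow> bool" where
  "locally_integrable \<Omega> f \<longleftrightarrow> (\<forall>K. compact K \<and> K \<subseteq> \<Omega> \<longrightarrow> integrable (lebesgue_on K) f)"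

definition Lspace :: "real set \<Rightarrow> real \<Rightarrow> (real \<Rightarrow> real) set" where
  "Lspace \<Omega> r = {u. u \<in> borel_measurable (lebesgue_on \<Omega>) \<and>
                    integrable (lebesgue_on \<Omega>) (\<lambda>x. \<bar>u x\<bar> powr r)}"

definition has_weak_deriv :: "real set \<Rightarrow> (real \<Rightarrow> real) \<Rightarrow> (real \<Rightarrow> real) \<Rightarrow> bool" where
  "has_weak_deriv \<Omega> u g \<longleftrightarrow> locally_integrable \<Omega> u \<and> locally_integrable \<Omega> g \<and>
     (\<forall>\<phi>. test_function \<Omega> \<phi> \<longrightarrow>
        (LINT x|lebesgue_on \<Omega>. u x * deriv \<phi> x) = - (LINT x|lebesgue_on \<Omega>. g x * \<phi> x))"

text \<open>
  A weak derivative is determined up to a null set, so the choice made here is immaterial for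
  the integrals in which it occurs.
\<close>

definition weak_deriv :: "real set \<Rightarrow> (real \<Rightarrow> real) \<Rightarrow> real \<Rightarrow> real" where
  "weak_deriv \<Omega> u = (SOME g. has_weak_deriv \<Omega> u g)"

definition W1 :: "real set \<Rightarrow> real \<Rightarrow> (real \<Rightarrow> real) set" where
  "W1 \<Omega> r = {u \<in> Lspace \<Omega> r. \<exists>g \<in> Lspace \<Omega> r. has_weak_deriv \<Omega> u g}"

text \<open>The closure of the test functions in the norm of \<open>W1 \<Omega> r\<close>.\<close>

definition W10 :: "real set \<Rightarrow> real \<Rightarrow> (real \<Rightarrow> real) set" where
  "W10 \<Omega> r = {u \<in> W1 \<Omega> r. \<exists>\<phi>. (\<forall>n::nat. test_function \<Omega> (\<phi> n)) \<and>
     (\<lambda>n. LINT x|lebesgue_on \<Omega>. \<bar>\<phi> n x - u x\<bar> powr r) \<longlonglongrightarrow> 0 \<and>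
     (\<lambda>n. LINT x|lebesgue_on \<Omega>. \<bar>deriv (\<phi> n) x - weak_deriv \<Omega> u x\<bar> powr r) \<longlonglongrightarrow> 0}"

definition nonzero_on :: "real set \<Rightarrow> (real \<Rightarrow> real) \<Rightarrow> bool" where
  "nonzero_on \<Omega> u \<longleftrightarrow> \<not> (AE x in lebesgue_on \<Omega>. u x = 0)"

text \<open>The first eigenvalue \<open>\<lambda>(r)\<close>: the minimum, i.e. the least element, of the Rayleigh quotients.\<close>

definition first_eigenvalue :: "real set \<Rightarrow> real \<Rightarrow> real" where
  "first_eigenvalue \<Omega> r = (LEAST \<mu>. \<mu> \<in>
     {(LINT x|lebesgue_on \<Omega>. \<bar>weak_deriv \<Omega> u x\<bar> powr r) / (LINT x|lebesgue_on \<Omega>. \<bar>u x\<bar> powr r)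
      | u. u \<in> W10 \<Omega> r \<and> nonzero_on \<Omega> u})"

text \<open>
  The power \<open>\<bar>t\<bar>\<^sup>a\<close> with the convention \<open>\<bar>0\<bar>\<^sup>0 = 1\<close>; note that \<open>0 powr 0 = 0\<close>. The convention matters
  for \<open>\<bar>u\<bar>\<^sup>\<alpha>\<^sup>-\<^sup>1\<close> when \<open>\<alpha> = 1\<close> (and for \<open>\<bar>v\<bar>\<^sup>\<beta>\<^sup>-\<^sup>1\<close> when \<open>\<beta> = 1\<close>).
\<close>

definition abs_pow :: "real \<Rightarrow> real \<Rightarrow> real" where
  "abs_pow t a = (if a = 0 then 1 else \<bar>t\<bar> powr a)"

text \<open>
  Weak solutions of \<open>- \<Delta>\<^sub>p u = \<mu> \<bar>u\<bar>\<^sup>\<alpha>\<^sup>-\<^sup>1 \<bar>v\<bar>\<^sup>\<beta>\<^sup>-\<^sup>1 v\<close>, \<open>- \<Delta>\<^sub>q v = \<mu> \<bar>u\<bar>\<^sup>\<alpha>\<^sup>-\<^sup>1 \<bar>v\<bar>\<^sup>\<beta>\<^sup>-\<^sup>1 u\<close> with zero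
  boundary values. At a zero of a derivative \<open>w\<close> the term \<open>\<bar>w\<bar> powr (r - 2) * w\<close> is \<open>0\<close>, also
  for \<open>r \<le> 2\<close>, as it should be.
\<close>

definition weak_solution ::
  "real set \<Rightarrow> real \<Rightarrow> real \<Rightarrow> real \<Rightarrow> real \<Rightarrow> real \<Rightarrow> (real \<Rightarrow> real) \<Rightarrow> (real \<Rightarrow> real) \<Rightarrow> bool" where
  "weak_solution \<Omega> p q \<alpha> \<beta> \<mu> u v \<longleftrightarrow> u \<in> W10 \<Omega> p \<and> v \<in> W10 \<Omega> q \<and>
     (\<forall>\<phi> \<in> W10 \<Omega> p.
        (LINT x|lebesgue_on \<Omega>. \<bar>weak_deriv \<Omega> u x\<bar> powr (p - 2) * weak_deriv \<Omega> u x * weak_deriv \<Omega> \<phi> x)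
        = \<mu> * (LINT x|lebesgue_on \<Omega>. abs_pow (u x) (\<alpha> - 1) * abs_pow (v x) (\<beta> - 1) * v x * \<phi> x)) \<and>
     (\<forall>\<psi> \<in> W10 \<Omega> q.
        (LINT x|lebesgue_on \<Omega>. \<bar>weak_deriv \<Omega> v x\<bar> powr (q - 2) * weak_deriv \<Omega> v x * weak_deriv \<Omega> \<psi> x)
        = \<mu> * (LINT x|lebesgue_on \<Omega>. abs_pow (u x) (\<alpha> - 1) * abs_pow (v x) (\<beta> - 1) * u x * \<psi> x))"

definition principal_eigenvalue :: "real set \<Rightarrow> real \<Rightarrow> real \<Rightarrow> real \<Rightarrow> real \<Rightarrow> real" where
  "principal_eigenvalue \<Omega> p q \<alpha> \<beta> = (LEAST \<mu>. \<mu> > 0 \<and>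
     (\<exists>u v. weak_solution \<Omega> p q \<alpha> \<beta> \<mu> u v \<and> nonzero_on \<Omega> u \<and> nonzero_on \<Omega> v))"

end

theory Submission
  imports Defs "HOL-Complex_Analysis.Great_Picard" "HOL-Real_Asymp.Real_Asymp"
begin

text \<open>
  Pairs of functions are measured by the coupling \<open>K(u,v) = \<integral> \<bar>u\<bar>\<^sup>\<alpha> \<bar>v\<bar>\<^sup>\<beta>\<close>. Because
  \<open>\<alpha>/p + \<beta>/q = 1\<close>, both sides of \<open>K(u,v) \<le> \<Lambda> (\<integral> \<bar>u'\<bar>\<^sup>p)\<^bsup>\<alpha>/p\<^esup> (\<integral> \<bar>v'\<bar>\<^sup>q)\<^bsup>\<beta>/q\<^esup>\<close> scale in the same
  way, and the principal eigenvalue is the reciprocal of the best constant \<open>\<Lambda>\<close>. On the one hand,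
  testing a weak solution with itself gives \<open>\<integral> \<bar>u'\<bar>\<^sup>p = \<integral> \<bar>v'\<bar>\<^sup>q = \<mu> K\<^sub>\<plusminus>\<close>, where the signed
  coupling \<open>K\<^sub>\<plusminus>\<close> is at most \<open>K(u,v)\<close>, so \<open>\<mu> \<ge> 1/\<Lambda>\<close> (\<open>eigenvalue_ge\<close>). On the other hand, a pair
  of nonnegative functions with energies 1 that attains \<open>\<Lambda>\<close> solves the system with \<open>\<mu> = 1/\<Lambda>\<close>
  (\<open>maximising_pair_weak_solution\<close>). The exponents \<open>p, p, p, 0\<close> instead of \<open>p, q, \<alpha>, \<beta>\<close> turn the
  coupling into \<open>\<integral> \<bar>u\<bar>\<^sup>p\<close>, so that the same theory describes the first eigenvalue of the
  \<open>p\<close>-Laplacian (\<open>first_eigenvalue_eq\<close>).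

  Since both eigenvalues are least elements, extremal functions have to be produced. In
  dimension one this needs no weak compactness. For fixed \<open>v\<close> the coupling is convex in \<open>u \<ge> 0\<close>,
  because \<open>\<alpha> \<ge> 1\<close>. So it does not decrease if \<open>u\<close> is replaced by the maximiser of its
  linearisation at \<open>u\<close> over the unit ball of \<open>W\<^sub>0\<^sup>1\<^sup>,\<^sup>p\<close>. This maximiser \<open>w\<close>, the best response,
  is explicit: if \<open>f\<close> denotes the linearisation, then \<open>- \<Delta>\<^sub>p w\<close> is a positive multiple of \<open>f\<close>,
  hence it is obtained from a primitive of \<open>f\<close> by elementary operations. Primitives of bounded
  functions are equicontinuous, so best responses to a maximising sequence have a convergent
  subsequence by the theorem of Arzela and Ascoli (\<open>power_functional_compact\<close>,
  \<open>maximising_pair\<close>). A maximiser agrees with its own best response, which is the Euler-Lagrange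
  equation. All this takes place among continuously differentiable functions; test functions
  carry the inequality to the Sobolev space (\<open>coupling_bound_W10\<close>), and, conversely, primitives
  of continuous functions with mean zero are shown to lie in the Sobolev space
  (\<open>primitive_in_W10\<close>).

  For the estimate, the equation makes the first eigenfunction of the \<open>p\<close>-Laplacian concave. The
  rising or the falling part of it, whichever is defined on an interval of length at most \<open>1/2\<close>,
  is stretched to \<open>[0,1/2]\<close> and reflected, which yields a symmetric function whose Rayleigh
  quotient is at most \<open>\<lambda>(p)\<close> (\<open>half_profile_of_maximiser\<close>). For two such functions \<open>u\<close> and \<open>v\<close>,
  which increase on the same half of the interval, Chebyshev's inequality gives
  \<open>\<integral> u\<^sup>\<alpha> v\<^sup>\<beta> \<ge> \<integral> u\<^sup>\<alpha> \<integral> v\<^sup>\<beta>\<close>; Berwald's inequality for concave functions compares \<open>\<integral> u\<^sup>\<alpha>\<close> with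
  \<open>\<integral> u\<^sup>p\<close> and \<open>\<integral> v\<^sup>\<beta>\<close> with \<open>\<integral> v\<^sup>q\<close>; and Chebyshev's inequality for oppositely ordered functions
  shows \<open>B(1+\<alpha>, 1+\<beta>) \<le> 1/((1+\<alpha>)(1+\<beta>))\<close>. Together \<open>C (\<integral> u\<^sup>p)\<^bsup>\<alpha>/p\<^esup> (\<integral> v\<^sup>q)\<^bsup>\<beta>/q\<^esup> \<le> K(u,v)\<close>
  (\<open>coupling_mirrored_ge\<close>), and therefore \<open>C \<le> \<Lambda> \<lambda>(p)\<^bsup>\<alpha>/p\<^esup> \<lambda>(q)\<^bsup>\<beta>/q\<^esup>\<close>. The inequality between
  weighted means finishes the proof.
\<close>

section \<open>Powers of real numbers\<close>

text \<open>
  If \<open>g\<close> is the slope of a function, \<open>spow (g x) (r - 1)\<close> is the flux \<open>\<bar>g\<bar>\<^bsup>r-2\<^esup> g\<close> of the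
  \<open>r\<close>-Laplacian. Powers with reciprocal exponents are inverse to each other, so the slope can be
  recovered from the flux.
\<close>

definition spow :: "real \<Rightarrow> real \<Rightarrow> real" where
  "spow t a = sgn t * \<bar>t\<bar> powr a"

lemma abs_spow [simp]: "\<bar>spow t a\<bar> = \<bar>t\<bar> powr a"
  by (cases "t = 0") (auto simp: spow_def abs_mult abs_sgn_eq)

lemma spow_minus [simp]: "spow (- t) a = - spow t a"
  by (simp add: spow_def sgn_minus)

lemma spow_spow:
  assumes "a * b = 1"
  shows "spow (spow t a) b = t"
  using assms by (cases "t = 0") (auto simp: spow_def abs_mult sgn_mult powr_powr abs_sgn_eq
    sgn_mult_abs sgn_if)

lemma spow_mult:
  assumes "0 \<le> s"
  shows "spow (s * t) a = s powr a * spow t a"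
  using assms by (cases "s = 0") (auto simp: spow_def abs_mult sgn_mult powr_mult)

lemma spow_mult_self: "spow t a * t = \<bar>t\<bar> powr (a + 1)"
  by (cases "t = 0") (auto simp: spow_def powr_add sgn_if)

lemma spow_eq_powr_mult: "spow t (r - 1) = \<bar>t\<bar> powr (r - 2) * t"
proof (cases "t = 0")
  case False
  have "\<bar>t\<bar> powr (r - 1) = \<bar>t\<bar> powr (r - 2) * \<bar>t\<bar>"
    using False powr_add[of "\<bar>t\<bar>" "r - 2" 1] by simp
  then show ?thesis
    by (auto simp: spow_def sgn_if)
qed (simp add: spow_def)

lemma spow_mono:
  assumes "0 \<le> a" "s \<le> t"
  shows "spow s a \<le> spow t a"
proof (cases "s < 0 \<and> 0 < t")
  case True
  then show ?thesis by (auto simp: spow_def intro: order.trans[of _ 0])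
next
  case False
  show ?thesis
    using assms False by (cases s "0::real" rule: linorder_cases; cases t "0::real" rule:
      linorder_cases)
      (auto simp: spow_def intro: powr_mono2)
qed

lemma continuous_on_spow:
  assumes "0 < a" "continuous_on S f"
  shows "continuous_on S (\<lambda>x. spow (f x) a)"
proof -
  have eq: "spow t a = max t 0 powr a - max (- t) 0 powr a" for t
    using assms(1) by (auto simp: spow_def sgn_if max_def)
  show ?thesis
    unfolding eq using assms
    by (intro continuous_intros continuous_on_powr') (auto intro!: continuous_intros)
qed

lemma tendsto_spow:
  assumes "0 < a" "(f \<longlongrightarrow> l) F"
  shows "((\<lambda>x. spow (f x) a) \<longlongrightarrow> spow l a) F"
proof -
  have "continuous_on UNIV (\<lambda>x. spow x a)"
    using assms(1) by (intro continuous_on_spow continuous_intros)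
  then have "isCont (\<lambda>x. spow x a) l"
    by (simp add: continuous_on_eq_continuous_at)
  then show ?thesis using assms(2) by (rule isCont_tendsto_compose)
qed

lemma continuous_on_abs_powr [continuous_intros]:
  fixes f :: "'a::topological_space \<Rightarrow> real"
  assumes "0 < a" "continuous_on S f"
  shows "continuous_on S (\<lambda>x. \<bar>f x\<bar> powr a)"
  using assms by (intro continuous_on_powr') (auto intro!: continuous_intros)

lemma abs_pow_nonneg [simp]: "0 \<le> abs_pow t a"
  by (simp add: abs_pow_def)

lemma abs_pow_0 [simp]: "abs_pow t 0 = 1"
  by (simp add: abs_pow_def)

lemma abs_pow_powr: "a \<noteq> 0 \<Longrightarrow> abs_pow t a = \<bar>t\<bar> powr a"
  by (simp add: abs_pow_def)

lemma continuous_on_abs_pow [continuous_intros]: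
  assumes "0 \<le> a" "continuous_on S f"
  shows "continuous_on S (\<lambda>x. abs_pow (f x) a)"
proof (cases "a = 0")
  case False
  then have "0 < a" using assms(1) by simp
  then show ?thesis using continuous_on_abs_powr[of a S f] assms(2) False
    by (simp add: abs_pow_powr)
qed simp

lemma tendsto_abs_pow:
  assumes "0 \<le> a" "(f \<longlongrightarrow> l) F"
  shows "((\<lambda>x. abs_pow (f x) a) \<longlongrightarrow> abs_pow l a) F"
proof -
  have "continuous_on UNIV (\<lambda>x. abs_pow x a)"
    using assms(1) by (intro continuous_intros)
  then have "isCont (\<lambda>x. abs_pow x a) l"
    by (simp add: continuous_on_eq_continuous_at)
  then show ?thesis using assms(2) by (rule isCont_tendsto_compose)
qed

lemma abs_pow_mono:
  assumes "0 \<le> a" "\<bar>s\<bar> \<le> \<bar>t\<bar>"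
  shows "abs_pow s a \<le> abs_pow t a"
  using assms by (auto simp: abs_pow_def intro: powr_mono2)

lemma abs_pow_le_1:
  assumes "0 \<le> a" "\<bar>t\<bar> \<le> 1"
  shows "abs_pow t a \<le> 1"
  using assms by (auto simp: abs_pow_def intro: powr_le1)

lemma abs_pow_mult:
  assumes "0 \<le> s"  "0 < s \<or> 0 < a"
  shows "abs_pow (s * t) a = s powr a * abs_pow t a"
  using assms by (auto simp: abs_pow_def abs_mult powr_mult)

lemma abs_pow_pred_mult:
  assumes "0 < a"
  shows "abs_pow t (a - 1) * \<bar>t\<bar> = abs_pow t a"
proof (cases "t = 0")
  case True then show ?thesis using assms by (simp add: abs_pow_def)
next
  case False
  then have "\<bar>t\<bar> powr (a - 1) * \<bar>t\<bar> = \<bar>t\<bar> powr a"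
    using powr_add[of "\<bar>t\<bar>" "a - 1" 1] by simp
  then show ?thesis using assms False by (auto simp: abs_pow_def)
qed

lemma powr_strict_Bernoulli:
  fixes t p :: real
  assumes "1 < p" "0 \<le> t" "t \<noteq> 1"
  shows "1 + p * (t - 1) < t powr p"
proof (cases "t = 0")
  case True then show ?thesis using assms by simp
next
  case False
  then have t: "0 < t" using assms by simp
  define f where "f = (\<lambda>t. t powr p - 1 - p * (t - 1))"
  have D: "DERIV f z :> p * (z powr (p - 1) - 1)" if "0 < z" for z
    unfolding f_def using that by (auto intro!: derivative_eq_intros simp: algebra_simps)
  have "0 < f t"
  proof (cases "t < 1")
    case True
    obtain z where z: "t < z" "z < 1" "f 1 - f t = (1 - t) * (p * (z powr (p - 1) - 1))"
      using MVT2[of t 1 f "\<lambda>z. p * (z powr (p - 1) - 1)"] True t D by force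
    have "z powr (p - 1) < 1"
      using z t assms(1) by (simp add: powr01_less_one)
    then have "(1 - t) * (p * (z powr (p - 1) - 1)) < 0"
      using True assms(1) by (intro mult_pos_neg) auto
    then show ?thesis using z by (simp add: f_def)
  next
    case F: False
    then have "1 < t" using assms by simp
    then obtain z where z: "1 < z" "z < t" "f t - f 1 = (t - 1) * (p * (z powr (p - 1) - 1))"
      using MVT2[of 1 t f "\<lambda>z. p * (z powr (p - 1) - 1)"] t D by force
    have "1 < z powr (p - 1)"
      using z assms(1) by (simp add: gr_one_powr)
    then have "(t - 1) * (p * (z powr (p - 1) - 1)) > 0"
      using \<open>1 < t\<close> assms(1) by (intro mult_pos_pos) auto
    then show ?thesis using z by (simp add: f_def)
  qed
  then show ?thesis by (simp add: f_def)
qed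

text \<open>
  The graph of the strictly convex function \<open>\<bar>t\<bar>\<^sup>p\<close> lies above its tangent at \<open>a\<close>, whose slope
  is \<open>p * spow a (p - 1)\<close>. All convexity arguments in spaces of \<open>p\<close>-integrable functions below
  come from this inequality, which replaces those of Hoelder and Minkowski.
\<close>

lemma powr_abs_tangent_strict:
  fixes a b p :: real
  assumes "1 < p" "a \<noteq> b"
  shows "\<bar>a\<bar> powr p + p * spow a (p - 1) * (b - a) < \<bar>b\<bar> powr p"
proof -
  have pos: "\<bar>a\<bar> powr p + p * spow a (p - 1) * (b - a) < \<bar>b\<bar> powr p" if "0 < a" "a \<noteq> b" for a b
  proof -
    define t where "t = b / a"
    have b: "b = t * a" using that by (simp add: t_def)
    have "1 + p * (t - 1) < \<bar>t\<bar> powr p"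
    proof (cases "0 \<le> t")
      case True
      then show ?thesis using powr_strict_Bernoulli[OF assms(1)] that b by auto
    next
      case False
      then have "p * (t - 1) \<le> 1 * (t - 1)"
        using assms(1) by (intro mult_right_mono_neg) auto
      then have "1 + p * (t - 1) < 0" using False by (simp only: algebra_simps not_le)
      also have "0 \<le> \<bar>t\<bar> powr p" by simp
      finally show ?thesis .
    qed
    then have "(1 + p * (t - 1)) * a powr p < \<bar>t\<bar> powr p * a powr p"
      using that by simp
    moreover have "\<bar>b\<bar> powr p = \<bar>t\<bar> powr p * a powr p"
      using that by (simp add: b abs_mult powr_mult)
    moreover have "a powr p = a powr (p - 1) * a"
      using that powr_add[of a "p - 1" 1] by simp
    then have "(1 + p * (t - 1)) * a powr p = \<bar>a\<bar> powr p + p * spow a (p - 1) * (b - a)"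
      using that by (simp add: spow_def b algebra_simps)
    ultimately show ?thesis by simp
  qed
  consider "0 < a" | "a < 0" | "a = 0" by linarith
  then show ?thesis
  proof cases
    case 2
    then show ?thesis using pos[of "- a" "- b"] assms by (simp add: algebra_simps)
  next
    case 3
    then show ?thesis using assms by (simp add: spow_def)
  qed (use pos assms in auto)
qed

lemma powr_abs_tangent:
  fixes a b p :: real
  assumes "1 < p"
  shows "\<bar>a\<bar> powr p + p * spow a (p - 1) * (b - a) \<le> \<bar>b\<bar> powr p"
  using powr_abs_tangent_strict[OF assms, of a b] by (cases "a = b") auto

lemma abs_le_powr:
  fixes t p :: real
  assumes "1 < p"
  shows "\<bar>t\<bar> \<le> \<bar>t\<bar> powr p / p + (1 - 1 / p)"
proof -
  have "1 + p * (\<bar>t\<bar> - 1) \<le> \<bar>t\<bar> powr p"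
    using powr_abs_tangent[OF assms, of 1 "\<bar>t\<bar>"] by (simp add: spow_def)
  then have "p * \<bar>t\<bar> \<le> p * (\<bar>t\<bar> powr p / p + (1 - 1 / p))"
    using assms by (simp add: distrib_left right_diff_distrib)
  then show ?thesis using assms by simp
qed

text \<open>
  This is where exponents at least 1 are needed: it makes couplings convex in each nonnegative
  argument.
\<close>

lemma abs_pow_tangent:
  assumes "1 \<le> \<alpha>" "0 \<le> s" "0 \<le> t"
  shows "abs_pow s \<alpha> + \<alpha> * abs_pow s (\<alpha> - 1) * (t - s) \<le> abs_pow t \<alpha>"
proof (cases "\<alpha> = 1")
  case True then show ?thesis using assms by (simp add: abs_pow_def)
next
  case False
  then have "spow s (\<alpha> - 1) = abs_pow s (\<alpha> - 1)"
    using assms by (cases "s = 0") (auto simp: spow_def abs_pow_def)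
  then show ?thesis
    using powr_abs_tangent[of \<alpha> s t] assms False by (simp add: abs_pow_powr)
qed

section \<open>Primitives\<close>

definition primitive :: "(real \<Rightarrow> real) \<Rightarrow> real \<Rightarrow> real" where
  "primitive g x = integral {0..x} g"

lemma primitive_0 [simp]: "primitive g 0 = 0"
  by (simp add: primitive_def)

lemma primitive_1: "primitive g 1 = integral {0..1} g"
  by (simp add: primitive_def)

lemma primitive_cmult [simp]: "primitive (\<lambda>x. c * g x) x = c * primitive g x"
  by (simp add: primitive_def)

lemma primitive_has_derivative:
  assumes "continuous_on {0..1} g" "x \<in> {0..1}"
  shows "(primitive g has_real_derivative g x) (at x within {0..1})"
  unfolding primitive_def has_real_derivative_iff_has_vector_derivative
  using integral_has_vector_derivative[OF assms] .

lemma continuous_on_primitive: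
  assumes "continuous_on {0..1} g"
  shows "continuous_on {0..1} (primitive g)"
  using primitive_has_derivative[OF assms] DERIV_continuous_on by blast

lemma primitive_eqI:
  assumes "\<And>x. x \<in> {0..1} \<Longrightarrow> (w has_real_derivative g x) (at x within {0..1})" "w 0 = 0" "x \<in> {0..1}"
  shows "primitive g x = w x"
proof -
  have "(g has_integral (w x - w 0)) {0..x}"
  proof (rule fundamental_theorem_of_calculus)
    fix y assume "y \<in> {0..x}"
    then have "(w has_real_derivative g y) (at y within {0..x})"
      using assms(1)[of y] assms(3) by (auto intro: DERIV_subset)
    then show "(w has_vector_derivative g y) (at y within {0..x})"
      by (simp add: has_real_derivative_iff_has_vector_derivative)
  qed (use assms in auto)
  then show ?thesis using assms by (simp add: primitive_def integral_unique)
qed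

lemma integral_by_parts:
  fixes N N' w w' :: "real \<Rightarrow> real"
  assumes "a \<le> b"
    and "\<And>x. x \<in> {a..b} \<Longrightarrow> (N has_real_derivative N' x) (at x within {a..b})"
    and "\<And>x. x \<in> {a..b} \<Longrightarrow> (w has_real_derivative w' x) (at x within {a..b})"
    and "continuous_on {a..b} N'" "continuous_on {a..b} w'"
  shows "integral {a..b} (\<lambda>x. N x * w' x) = N b * w b - N a * w a - integral {a..b} (\<lambda>x. N' x
    * w x)"
proof -
  have cN: "continuous_on {a..b} N" and cw: "continuous_on {a..b} w"
    using assms DERIV_continuous_on by blast+
  have "((\<lambda>x. N x * w' x + N' x * w x) has_integral (N b * w b - N a * w a)) {a..b}"
  proof (rule fundamental_theorem_of_calculus)
    fix x assume x: "x \<in> {a..b}"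
    have "((\<lambda>x. N x * w x) has_real_derivative N x * w' x + N' x * w x) (at x within {a..b})"
      using DERIV_mult[OF assms(2)[OF x] assms(3)[OF x]] by (simp add: mult_ac add_ac)
    then show "((\<lambda>x. N x * w x) has_vector_derivative N x * w' x + N' x * w x) (at x within {a..b})"
      by (simp add: has_real_derivative_iff_has_vector_derivative)
  qed (rule assms)
  moreover have "integral {a..b} (\<lambda>x. N x * w' x + N' x * w x)
      = integral {a..b} (\<lambda>x. N x * w' x) + integral {a..b} (\<lambda>x. N' x * w x)"
    using cN cw assms by (intro integral_add integrable_continuous_real continuous_intros)
  ultimately show ?thesis by (simp add: integral_unique)
qed

lemma integral_mult_primitive:
  assumes f: "continuous_on {0..1} f" and g: "continuous_on {0..1} g" and "integral {0..1} g = 0"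
  shows "integral {0..1} (\<lambda>x. f x * primitive g x)
       = integral {0..1} (\<lambda>x. (c - primitive f x) * g x)"
proof -
  have "integral {0..1} (\<lambda>x. (c - primitive f x) * g x)
      = (c - primitive f 1) * primitive g 1 - (c - primitive f 0) * primitive g 0
        - integral {0..1} (\<lambda>x. - f x * primitive g x)"
    using f g
    by (intro integral_by_parts)
      (auto intro!: derivative_eq_intros continuous_intros primitive_has_derivative)
  then show ?thesis using assms(3) by (simp add: primitive_1)
qed

lemma abs_primitive_le:
  assumes "continuous_on {0..1} g" "x \<in> {0..1}"
  shows "\<bar>primitive g x\<bar> \<le> integral {0..1} (\<lambda>x. \<bar>g x\<bar>)"
proof -
  have c: "continuous_on {0..x} g" 
    using assms by (auto intro: continuous_on_subset)
  have "\<bar>primitive g x\<bar> \<le> integral {0..x} (\<lambda>x. \<bar>g x\<bar>)"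
    unfolding primitive_def
    using integral_norm_bound_integral[of g "{0..x}" "\<lambda>x. \<bar>g x\<bar>"] c
    by (auto intro!: integrable_continuous_real continuous_intros)
  also have "\<dots> \<le> integral {0..1} (\<lambda>x. \<bar>g x\<bar>)"
    using assms c by (intro integral_subset_le) (auto intro!: integrable_continuous_real
      continuous_intros)
  finally show ?thesis .
qed

lemma integral_abs_le:
  fixes g :: "real \<Rightarrow> real"
  assumes "continuous_on {0..1} g" "1 < p"
  shows "integral {0..1} (\<lambda>x. \<bar>g x\<bar>) \<le> integral {0..1} (\<lambda>x. \<bar>g x\<bar> powr p) / p + (1 - 1 / p)"
proof -
  have "integral {0..1} (\<lambda>x. \<bar>g x\<bar>) \<le> integral {0..1} (\<lambda>x. \<bar>g x\<bar> powr p / p + (1 - 1 / p))"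
  proof (rule integral_le)
    show "\<bar>g x\<bar> \<le> \<bar>g x\<bar> powr p / p + (1 - 1 / p)" for x
      using assms(2) by (rule abs_le_powr)
  qed (use assms in \<open>auto intro!: integrable_continuous_real continuous_intros\<close>)
  also have "\<dots> = integral {0..1} (\<lambda>x. \<bar>g x\<bar> powr p) / p + (1 - 1 / p)"
    using assms by (subst integral_add) (auto intro!: integrable_continuous_real continuous_intros)
  finally show ?thesis .
qed

text \<open>
  A nonincreasing slope with mean zero is first nonnegative, then nonpositive; its primitive
  rises from 0 and falls back to 0.
\<close>

lemma primitive_nonneg:
  assumes g: "continuous_on {0..1} g" "integral {0..1} g = 0"
    and anti: "\<And>x y. 0 \<le> x \<Longrightarrow> x \<le> y \<Longrightarrow> y \<le> 1 \<Longrightarrow> g y \<le> g x" and x: "x \<in> {0..1}"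
  shows "0 \<le> primitive g x"
proof (cases "0 \<le> g x")
  case True
  have "0 \<le> integral {0..x} g"
  proof (rule integral_nonneg)
    show "g integrable_on {0..x}"
      using g x by (auto intro!: integrable_continuous_real intro: continuous_on_subset)
    fix y assume "y \<in> {0..x}"
    then show "0 \<le> g y" using anti[of y x] x True by auto
  qed
  then show ?thesis by (simp add: primitive_def)
next
  case False
  have "integral {0..x} g + integral {x..1} g = integral {0..1} g"
    using x g by (intro Henstock_Kurzweil_Integration.integral_combine
      integrable_continuous_real) auto
  moreover have "integral {x..1} g \<le> integral {x..1} (\<lambda>x. 0)"
  proof (rule integral_le)
    show "g integrable_on {x..1}"
      using g x by (auto intro!: integrable_continuous_real intro: continuous_on_subset)
    fix y assume "y \<in> {x..1}"
    then show "g y \<le> 0" using anti[of x y] x False by auto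
  qed auto
  ultimately show ?thesis using g by (simp add: primitive_def)
qed

lemma integral_pos_if_pos_somewhere:
  fixes f :: "real \<Rightarrow> real"
  assumes "continuous_on {0..1} f" "\<And>x. x \<in> {0..1} \<Longrightarrow> 0 \<le> f x" "y \<in> {0..1}" "0 < f y"
  shows "0 < integral {0..1} f"
proof -
  have "integral {0..1} f \<noteq> 0"
    using assms integral_eq_0_iff[of 0 1 f] by force
  moreover have "0 \<le> integral {0..1} f"
    using assms by (intro integral_nonneg integrable_continuous_real) auto
  ultimately show ?thesis by linarith
qed

section \<open>Maximising a linear functional on the unit ball\<close>

text \<open>
  Functions are represented by their slopes; the function itself is \<open>primitive g\<close>, which
  vanishes at both ends because \<open>g\<close> has mean zero. Under the sign condition, derivatives of
  couplings are nonnegative, and so are the best responses to them; it is removed in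
  \<open>coupling_bound_general\<close>.
\<close>

definition unit_ball :: "real \<Rightarrow> (real \<Rightarrow> real) set" where
  "unit_ball p = {g. continuous_on {0..1} g \<and> integral {0..1} g = 0 \<and>
     (\<forall>x\<in>{0..1}. 0 \<le> primitive g x) \<and> integral {0..1} (\<lambda>x. \<bar>g x\<bar> powr p) \<le> 1}"

lemma unit_ballD:
  assumes "g \<in> unit_ball p"
  shows "continuous_on {0..1} g" "integral {0..1} g = 0"
    "\<And>x. x \<in> {0..1} \<Longrightarrow> 0 \<le> primitive g x" "integral {0..1} (\<lambda>x. \<bar>g x\<bar> powr p) \<le> 1"
  using assms by (auto simp: unit_ball_def)

lemma primitive_unit_ball_le_1:
  assumes "g \<in> unit_ball p" "1 < p" "x \<in> {0..1}"
  shows "primitive g x \<le> 1"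
proof -
  have "\<bar>primitive g x\<bar> \<le> integral {0..1} (\<lambda>x. \<bar>g x\<bar> powr p) / p + (1 - 1 / p)"
    using abs_primitive_le[of g x] integral_abs_le[of g p] unit_ballD[OF assms(1)] assms by linarith
  also have "\<dots> \<le> 1 / p + (1 - 1 / p)"
    using unit_ballD(4)[OF assms(1)] assms(2) by (intro add_right_mono divide_right_mono) auto
  finally show ?thesis by simp
qed

text \<open>
  The function \<open>w\<close> with zero boundary values and \<open>- \<Delta>\<^sub>p w = f\<close> has the flux \<open>c - primitive f\<close>,
  where the constant \<open>c\<close> is determined by the mean of the slope of \<open>w\<close> being zero (\<open>balanced\<close>).
  Normalising this slope gives \<open>best_response\<close>. The number \<open>dual_norm\<close> is the power \<open>p/(p-1)\<close> of
  the norm of the functional \<open>u \<mapsto> \<integral> f u\<close>.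
\<close>

definition dual_norm :: "real \<Rightarrow> (real \<Rightarrow> real) \<Rightarrow> real \<Rightarrow> real" where
  "dual_norm p f c = integral {0..1} (\<lambda>x. \<bar>c - primitive f x\<bar> powr (p / (p - 1)))"

definition best_response :: "real \<Rightarrow> (real \<Rightarrow> real) \<Rightarrow> real \<Rightarrow> real \<Rightarrow> real" where
  "best_response p f c x = spow (c - primitive f x) (1 / (p - 1)) / dual_norm p f c powr (1 / p)"

definition balanced :: "real \<Rightarrow> (real \<Rightarrow> real) \<Rightarrow> real \<Rightarrow> bool" where
  "balanced p f c \<longleftrightarrow> c \<in> {0..primitive f 1} \<and>
     integral {0..1} (\<lambda>x. spow (c - primitive f x) (1 / (p - 1))) = 0"

locale load =
  fixes p :: real and f :: "real \<Rightarrow> real"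
  assumes p: "1 < p" and contf: "continuous_on {0..1} f"
    and nonneg: "\<And>x. x \<in> {0..1} \<Longrightarrow> 0 \<le> f x" and pos: "0 < integral {0..1} f"
begin

lemma exponent_pos: "0 < 1 / (p - 1)"
  using p by simp

lemma primitive_mono:
  assumes "0 \<le> x" "x \<le> y" "y \<le> 1"
  shows "primitive f x \<le> primitive f y"
  unfolding primitive_def using assms nonneg
  by (intro integral_subset_le integrable_continuous_real continuous_on_subset[OF contf]) auto

lemma primitive_range:
  assumes "x \<in> {0..1}"
  shows "0 \<le> primitive f x" "primitive f x \<le> primitive f 1"
  using primitive_mono[of 0 x] primitive_mono[of x 1] assms by auto

lemma continuous_spow: "continuous_on {0..1} (\<lambda>x. spow (c - primitive f x) (1 / (p - 1)))"
  using exponent_pos contf by (intro continuous_on_spow continuous_intros continuous_on_primitive)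

text \<open>
  The mean of the slope is nonpositive for \<open>c = 0\<close>, nonnegative for \<open>c = primitive f 1\<close>, and
  continuous in \<open>c\<close>.
\<close>

lemma exists_balanced: "\<exists>c. balanced p f c"
proof -
  define \<Phi> where "\<Phi> c = integral {0..1} (\<lambda>x. spow (c - primitive f x) (1 / (p - 1)))" for c
  have "continuous_on {0..primitive f 1} \<Phi>"
  proof -
    have "continuous_on ({0..primitive f 1} \<times> cbox 0 1) (\<lambda>(c, x). spow (c
      - primitive f x) (1 / (p - 1)))"
      unfolding case_prod_beta using exponent_pos
      by (intro continuous_on_spow continuous_intros
          continuous_on_compose2[OF continuous_on_primitive[OF contf]]) auto
    then have "continuous_on {0..primitive f 1} (\<lambda>c. integral (cbox 0 1) (\<lambda>x. spow (c
      - primitive f x) (1 / (p - 1))))"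
      by (rule integral_continuous_on_param)
    then show ?thesis by (simp add: \<Phi>_def)
  qed
  moreover have "\<Phi> 0 \<le> 0"
  proof -
    have "\<Phi> 0 \<le> integral {0..1 :: real} (\<lambda>x. 0 :: real)"
      unfolding \<Phi>_def
    proof (rule integral_le)
      fix x :: real assume "x \<in> {0..1}"
      then show "spow (0 - primitive f x) (1 / (p - 1)) \<le> 0"
        using primitive_range[of x] by (simp add: spow_def sgn_if)
    qed (use continuous_spow[of 0] in \<open>auto intro!: integrable_continuous_real\<close>)
    then show ?thesis by simp
  qed
  moreover have "0 \<le> \<Phi> (primitive f 1)"
    unfolding \<Phi>_def
  proof (rule integral_nonneg)
    fix x :: real assume "x \<in> {0..1}"
    then show "0 \<le> spow (primitive f 1 - primitive f x) (1 / (p - 1))"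
      using primitive_range[of x] by (simp add: spow_def sgn_if)
  qed (auto intro!: integrable_continuous_real continuous_spow)
  moreover have "0 \<le> primitive f 1" using primitive_range[of 1] by simp
  ultimately obtain c where "0 \<le> c" "c \<le> primitive f 1" "\<Phi> c = 0"
    using IVT'[of \<Phi> 0 0 "primitive f 1"] by auto
  then show ?thesis by (auto simp: balanced_def \<Phi>_def)
qed

lemma dual_norm_pos: "0 < dual_norm p f c"
proof -
  have "\<exists>y\<in>{0..1}. c \<noteq> primitive f y"
    using pos primitive_1[of f] by (cases "c = 0") (force intro: bexI[of _ 1], force intro:
      bexI[of _ 0])
  then obtain y where "y \<in> {0..1}" "c \<noteq> primitive f y" by blast
  then show ?thesis
    unfolding dual_norm_def using p contf
    by (intro integral_pos_if_pos_somewhere[of _ y] continuous_on_abs_powr continuous_intros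
        continuous_on_primitive) auto
qed

lemma continuous_best_response: "continuous_on {0..1} (best_response p f c)"
  unfolding best_response_def[abs_def] using dual_norm_pos[of c]
  by (intro continuous_intros continuous_spow) auto

lemma spow_best_response:
  "spow (best_response p f c x) (p - 1) = (c - primitive f x) / dual_norm p f c powr (1 - 1 / p)"
proof -
  let ?N = "dual_norm p f c"
  have "spow (best_response p f c x) (p - 1)
      = spow (inverse (?N powr (1 / p)) * spow (c - primitive f x) (1 / (p - 1))) (p - 1)"
    by (simp add: best_response_def field_simps)
  also have "\<dots> = inverse (?N powr (1 / p)) powr (p - 1) * (c - primitive f x)"
    using p by (subst spow_mult) (auto simp: spow_spow)
  also have "inverse (?N powr (1 / p)) powr (p - 1) = inverse (?N powr (1 - 1 / p))"
  proof -
    have "1 - 1 / p = 1 / p * (p - 1)" using p by (simp add: field_simps)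
    then show ?thesis by (simp add: powr_powr inverse_powr)
  qed
  finally show ?thesis by (simp add: field_simps)
qed

lemma abs_best_response_powr:
  "\<bar>best_response p f c x\<bar> powr p = \<bar>c - primitive f x\<bar> powr (p / (p - 1)) / dual_norm p f c"
  using p dual_norm_pos[of c] by (simp add: best_response_def powr_divide powr_powr)

lemma integral_abs_best_response: "integral {0..1} (\<lambda>x. \<bar>best_response p f c x\<bar> powr p) = 1"
  unfolding abs_best_response_powr using dual_norm_pos[of c] by (simp add: dual_norm_def[symmetric])

lemma integral_best_response:
  assumes "balanced p f c"
  shows "integral {0..1} (best_response p f c) = 0"
  unfolding best_response_def[abs_def] using assms by (simp add: balanced_def)

lemma best_response_antimono:
  assumes "0 \<le> x" "x \<le> y" "y \<le> 1"
  shows "best_response p f c y \<le> best_response p f c x"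
  unfolding best_response_def
  using primitive_mono[OF assms] exponent_pos by (intro divide_right_mono spow_mono) auto

lemma best_response_unit_ball:
  assumes "balanced p f c"
  shows "best_response p f c \<in> unit_ball p"
  using assms integral_best_response integral_abs_best_response[of c]
    primitive_nonneg[OF continuous_best_response[of c] integral_best_response[OF assms]
      best_response_antimono]
  by (auto simp: unit_ball_def continuous_best_response)

lemma load_best_response:
  assumes "balanced p f c"
  shows "integral {0..1} (\<lambda>x. f x * primitive (best_response p f c) x) = dual_norm p f c powr (1
    - 1 / p)"
proof -
  let ?N = "dual_norm p f c"
  have "1 / (p - 1) + 1 = p / (p - 1)" using p by (simp add: field_simps)
  then have e: "\<bar>t\<bar> powr (p / (p - 1)) = t * spow t (1 / (p - 1))" for t
    using spow_mult_self[of t "1 / (p - 1)"] by (simp add: mult_ac)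
  have "integral {0..1} (\<lambda>x. f x * primitive (best_response p f c) x)
      = integral {0..1} (\<lambda>x. (c - primitive f x) * best_response p f c x)"
    using assms by (intro integral_mult_primitive contf continuous_best_response
      integral_best_response)
  also have "(\<lambda>x. (c - primitive f x) * best_response p f c x)
      = (\<lambda>x. \<bar>c - primitive f x\<bar> powr (p / (p - 1)) / ?N powr (1 / p))"
    by (rule ext) (simp add: best_response_def e)
  also have "integral {0..1} \<dots> = ?N / ?N powr (1 / p)"
    by (simp add: dual_norm_def[symmetric])
  also have "\<dots> = ?N powr (1 - 1 / p)"
    using dual_norm_pos[of c] by (simp add: powr_diff)
  finally show ?thesis .
qed

text \<open>
  By partial integration \<open>\<integral> f u\<close> is the integral of the flux \<open>c - primitive f\<close> times the slope
  of \<open>u\<close>, and this flux is a positive multiple of \<open>spow g (p - 1)\<close> for the best response \<open>g\<close>.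
  Integrating \<open>powr_abs_tangent\<close> with tangent point \<open>g\<close> therefore compares the linear functional
  at \<open>h\<close> and at \<open>g\<close>. Equality forces the nonnegative continuous deficit to vanish everywhere.
\<close>

lemma best_response_optimal:
  assumes bal: "balanced p f c" and h: "continuous_on {0..1} h" "integral {0..1} h = 0"
    and h1: "integral {0..1} (\<lambda>x. \<bar>h x\<bar> powr p) \<le> 1"
  shows best_response_maximal:
      "integral {0..1} (\<lambda>x. f x * primitive h x)
       \<le> integral {0..1} (\<lambda>x. f x * primitive (best_response p f c) x)"
    and best_response_unique:
      "\<lbrakk>integral {0..1} (\<lambda>x. f x * primitive h x)
        = integral {0..1} (\<lambda>x. f x * primitive (best_response p f c) x); x \<in> {0..1}\<rbrakk>
       \<Longrightarrow> h x = best_response p f c x"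
proof -
  let ?L = "\<lambda>h. integral {0..1} (\<lambda>x. f x * primitive h x)" and ?g = "best_response p f c"
  let ?k = "p / dual_norm p f c powr (1 - 1 / p)"
  (* The deficit in the tangent inequality at the best response. *)
  define D where "D x = \<bar>h x\<bar> powr p - (\<bar>?g x\<bar> powr p + p * spow (?g x) (p - 1) * (h x - ?g x))"
    for x
  have D0: "0 \<le> D x" for x
    unfolding D_def using powr_abs_tangent[OF p, of "?g x" "h x"] by simp
  have Deq: "h x = ?g x" if "D x = 0" for x
    using powr_abs_tangent_strict[OF p, of "?g x" "h x"] that by (fastforce simp: D_def)
  have Dform: "D x = \<bar>h x\<bar> powr p - \<bar>?g x\<bar> powr p
      - (?k * ((c - primitive f x) * h x) - ?k * ((c - primitive f x) * ?g x))" for x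
    unfolding D_def spow_best_response by (simp add: algebra_simps diff_divide_distrib)
  have g: "continuous_on {0..1} ?g" by (rule continuous_best_response)
  have F: "continuous_on {0..1} (primitive f)" by (rule continuous_on_primitive[OF contf])
  have cD: "continuous_on {0..1} D"
    unfolding Dform[abs_def] using p h g F
    by (intro continuous_intros continuous_on_abs_powr) auto
  have I: "integral {0..1} (\<lambda>x. (c - primitive f x) * h x) = ?L h"
    "integral {0..1} (\<lambda>x. (c - primitive f x) * ?g x) = ?L ?g"
    using integral_mult_primitive[OF contf, of _ c] h g integral_best_response[OF bal] by auto
  have "integral {0..1} D = integral {0..1} (\<lambda>x. \<bar>h x\<bar> powr p) - integral {0..1} (\<lambda>x. \<bar>?g x\<bar> powr p)
      - (integral {0..1} (\<lambda>x. ?k * ((c - primitive f x) * h x)) 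
        - integral {0..1} (\<lambda>x. ?k * ((c - primitive f x) * ?g x)))"
    unfolding Dform[abs_def] using p h g F
    by (subst integral_diff, (intro integrable_continuous_real continuous_intros
      continuous_on_abs_powr; simp)+)+ simp
  then have ID: "integral {0..1} D = integral {0..1} (\<lambda>x. \<bar>h x\<bar> powr p) - 1 - ?k * (?L h - ?L ?g)"
    by (simp only: integral_mult_right I integral_abs_best_response right_diff_distrib)
  have k: "0 < ?k" using p dual_norm_pos[of c] by simp
  have "0 \<le> integral {0..1} D"
    using cD D0 by (intro integral_nonneg integrable_continuous_real) auto
  then have "?k * (?L h - ?L ?g) \<le> 0" using ID h1 by simp
  then show "?L h \<le> ?L ?g" using k mult_le_0_iff[of ?k "?L h - ?L ?g"] by linarith
  assume "?L h = ?L ?g" and x: "x \<in> {0..1}"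
  then have "integral {0..1} D \<le> 0" using ID h1 by simp
  then have "integral {0..1} D = 0" using \<open>0 \<le> integral {0..1} D\<close> by simp
  then have "D x = 0"
    using integral_eq_0_iff[of 0 1 D] cD D0 x by simp
  then show "h x = ?g x" by (rule Deq)
qed

end

section \<open>Convexity: the best response increases a power functional\<close>

definition weighted_power :: "real \<Rightarrow> (real \<Rightarrow> real) \<Rightarrow> (real \<Rightarrow> real) \<Rightarrow> real" where
  "weighted_power \<alpha> \<rho> g = integral {0..1} (\<lambda>x. abs_pow (primitive g x) \<alpha> * \<rho> x)"

text \<open>
  Up to the factor \<open>\<alpha>\<close>, the derivative of \<open>weighted_power \<alpha> \<rho>\<close> at \<open>primitive g\<close>.
\<close>

definition gradient :: "real \<Rightarrow> (real \<Rightarrow> real) \<Rightarrow> (real \<Rightarrow> real) \<Rightarrow> real \<Rightarrow> real" where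
  "gradient \<alpha> \<rho> g x = abs_pow (primitive g x) (\<alpha> - 1) * \<rho> x"

locale weighted_element =
  fixes p \<alpha> :: real and \<rho> g :: "real \<Rightarrow> real"
  assumes p: "1 < p" and \<alpha>: "1 \<le> \<alpha>" and cont\<rho>: "continuous_on {0..1} \<rho>"
    and \<rho>: "\<And>x. x \<in> {0..1} \<Longrightarrow> 0 \<le> \<rho> x"
    and g: "g \<in> unit_ball p" and pos: "0 < weighted_power \<alpha> \<rho> g"
begin

lemma continuous_gradient: "continuous_on {0..1} (gradient \<alpha> \<rho> g)"
  unfolding gradient_def[abs_def] using \<alpha> cont\<rho> unit_ballD(1)[OF g]
  by (intro continuous_intros continuous_on_primitive) auto

lemma gradient_self:
  "integral {0..1} (\<lambda>x. gradient \<alpha> \<rho> g x * primitive g x) = weighted_power \<alpha> \<rho> g"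
  unfolding weighted_power_def
proof (rule integral_cong)
  fix x :: real assume "x \<in> {0..1}"
  then have "abs_pow (primitive g x) (\<alpha> - 1) * primitive g x = abs_pow (primitive g x) \<alpha>"
    using abs_pow_pred_mult[of \<alpha> "primitive g x"] unit_ballD(3)[OF g, of x] \<alpha> by simp
  then show "gradient \<alpha> \<rho> g x * primitive g x = abs_pow (primitive g x) \<alpha> * \<rho> x"
    by (simp add: gradient_def mult_ac)
qed

lemma load_gradient: "load p (gradient \<alpha> \<rho> g)"
proof
  show "1 < p" by (rule p)
  show "continuous_on {0..1} (gradient \<alpha> \<rho> g)" by (rule continuous_gradient)
  show nn: "0 \<le> gradient \<alpha> \<rho> g x" if "x \<in> {0..1}" for x
    using \<rho>[OF that] by (simp add: gradient_def)
  have "integral {0..1} (\<lambda>x. gradient \<alpha> \<rho> g x * primitive g x) \<le> integral {0..1} (gradient \<alpha> \<rho> g)"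
  proof (rule integral_le)
    show "(\<lambda>x. gradient \<alpha> \<rho> g x * primitive g x) integrable_on {0..1}"
      using continuous_gradient unit_ballD(1)[OF g]
      by (intro integrable_continuous_real continuous_intros continuous_on_primitive)
    show "gradient \<alpha> \<rho> g x * primitive g x \<le> gradient \<alpha> \<rho> g x" if "x \<in> {0..1}" for x
      using mult_left_mono[OF primitive_unit_ball_le_1[OF g p that] nn[OF that]] by simp
  qed (intro integrable_continuous_real continuous_gradient)
  then show "0 < integral {0..1} (gradient \<alpha> \<rho> g)"
    using pos gradient_self by simp
qed

sublocale load p "gradient \<alpha> \<rho> g"
  by (rule load_gradient)

lemma weighted_power_ge_tangent:
  assumes h: "h \<in> unit_ball p"
  shows "weighted_power \<alpha> \<rho> g + \<alpha> * (integral {0..1} (\<lambda>x. gradient \<alpha> \<rho> g x * primitive h x)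
     - integral {0..1} (\<lambda>x. gradient \<alpha> \<rho> g x * primitive g x)) \<le> weighted_power \<alpha> \<rho> h"
proof -
  let ?u = "primitive g" and ?w = "primitive h" and ?f = "gradient \<alpha> \<rho> g"
  note cu = continuous_on_primitive[OF unit_ballD(1)[OF g]]
  note cw = continuous_on_primitive[OF unit_ballD(1)[OF h]]
  have "weighted_power \<alpha> \<rho> g + \<alpha> * (integral {0..1} (\<lambda>x. ?f x * ?w x) - integral {0..1} (\<lambda>x. ?f x
    * ?u x))
     = integral {0..1} (\<lambda>x. abs_pow (?u x) \<alpha> * \<rho> x + \<alpha> * (?f x * ?w x - ?f x * ?u x))"
    unfolding weighted_power_def using \<alpha> cu cw continuous_gradient cont\<rho>
    by (subst integral_add integral_diff integral_mult_right
        | intro integrable_continuous_real continuous_intros | simp)+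
  also have "\<dots> \<le> integral {0..1} (\<lambda>x. abs_pow (?w x) \<alpha> * \<rho> x)"
  proof (rule integral_le)
    fix x :: real assume x: "x \<in> {0..1}"
    have "(abs_pow (?u x) \<alpha> + \<alpha> * abs_pow (?u x) (\<alpha> - 1) * (?w x - ?u x)) * \<rho> x
      \<le> abs_pow (?w x) \<alpha> * \<rho> x"
      using unit_ballD(3)[OF g x] unit_ballD(3)[OF h x] \<alpha> \<rho>[OF x]
      by (intro mult_right_mono abs_pow_tangent)
    then show "abs_pow (?u x) \<alpha> * \<rho> x + \<alpha> * (?f x * ?w x - ?f x * ?u x) \<le> abs_pow (?w x) \<alpha> * \<rho> x"
      by (simp add: gradient_def algebra_simps)
  qed (use \<alpha> cu cw continuous_gradient cont\<rho> in \<open>auto intro!: integrable_continuous_real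
    continuous_intros\<close>)
  finally show ?thesis by (simp add: weighted_power_def)
qed

text \<open>
  The convex functional lies above its linearisation at \<open>g\<close>, and the best response to the
  gradient maximises the linearisation.
\<close>

lemma weighted_power_best_response:
  assumes "balanced p (gradient \<alpha> \<rho> g) c"
  shows "weighted_power \<alpha> \<rho> g \<le> weighted_power \<alpha> \<rho> (best_response p (gradient \<alpha> \<rho> g) c)"
proof -
  let ?h = "best_response p (gradient \<alpha> \<rho> g) c"
  have "0 \<le> \<alpha> * (integral {0..1} (\<lambda>x. gradient \<alpha> \<rho> g x * primitive ?h x)
     - integral {0..1} (\<lambda>x. gradient \<alpha> \<rho> g x * primitive g x))"
    using best_response_maximal[OF assms] unit_ballD[OF g] \<alpha> by simp
  then show ?thesis
    using weighted_power_ge_tangent[OF best_response_unit_ball[OF assms]] by linarith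
qed

text \<open>
  A lower bound for the functional thus keeps the normalising factor of the best response away
  from zero, which is needed for compactness.
\<close>

lemma weighted_power_le_dual_norm:
  assumes "balanced p (gradient \<alpha> \<rho> g) c"
  shows "weighted_power \<alpha> \<rho> g \<le> dual_norm p (gradient \<alpha> \<rho> g) c powr (1 - 1 / p)"
  using best_response_maximal[OF assms, of g] unit_ballD[OF g]
  by (simp add: load_best_response[OF assms] gradient_self)

text \<open>
  At a maximiser \<open>g\<close> the linearisation cannot increase towards the best response. So \<open>g\<close>
  maximises the linear functional as well and is its own best response by uniqueness. The flux
  of a best response is known, and \<open>dual_norm powr (1 - 1/p)\<close> is the maximum of the linear
  functional, that is, \<open>weighted_power \<alpha> \<rho> g\<close>.
\<close>

lemma Euler_Lagrange:
  assumes max: "\<And>h. h \<in> unit_ball p \<Longrightarrow> weighted_power \<alpha> \<rho> h \<le> weighted_power \<alpha> \<rho> g"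
  shows "\<exists>c. \<forall>x\<in>{0..1}. spow (g x) (p - 1) = (c
    - primitive (gradient \<alpha> \<rho> g) x) / weighted_power \<alpha> \<rho> g"
proof -
  obtain c where c: "balanced p (gradient \<alpha> \<rho> g) c"
    using exists_balanced by blast
  let ?h = "best_response p (gradient \<alpha> \<rho> g) c"
  let ?L = "\<lambda>h. integral {0..1} (\<lambda>x. gradient \<alpha> \<rho> g x * primitive h x)"
  have "\<alpha> * (?L ?h - ?L g) \<le> 0"
    using weighted_power_ge_tangent[OF best_response_unit_ball[OF c]] max[OF
      best_response_unit_ball[OF c]]
    by linarith
  then have "?L ?h \<le> ?L g" using \<alpha> by (simp add: mult_le_0_iff)
  moreover have "?L g \<le> ?L ?h"
    using best_response_maximal[OF c] unit_ballD[OF g] by blast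
  ultimately have eq: "?L g = ?L ?h" by simp
  then have "weighted_power \<alpha> \<rho> g = dual_norm p (gradient \<alpha> \<rho> g) c powr (1 - 1 / p)"
    by (simp add: gradient_self load_best_response[OF c])
  moreover have "g x = ?h x" if "x \<in> {0..1}" for x
    using best_response_unique[OF c _ _ _ eq that] unit_ballD[OF g] by blast
  ultimately show ?thesis
    using spow_best_response[of c] by (intro exI[of _ c]) simp
qed

end

section \<open>Compactness\<close>

lemma primitive_tendsto:
  fixes g :: "nat \<Rightarrow> real \<Rightarrow> real"
  assumes "\<And>n. continuous_on {0..1} (g n)" "\<And>n x. x \<in> {0..1} \<Longrightarrow> \<bar>g n x\<bar> \<le> B"
    and "\<And>x. x \<in> {0..1} \<Longrightarrow> (\<lambda>n. g n x) \<longlonglongrightarrow> g' x" "x \<in> {0..1}"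
  shows "(\<lambda>n. primitive (g n) x) \<longlonglongrightarrow> primitive g' x"
  unfolding primitive_def
proof (rule dominated_convergence(2)[where h = "\<lambda>_. B"])
  show "g n integrable_on {0..x}" for n
    using assms(1)[of n] assms(4) by (auto intro!: integrable_continuous_real intro:
      continuous_on_subset)
qed (use assms in auto)

lemma unit_ball_closed:
  fixes g :: "nat \<Rightarrow> real \<Rightarrow> real"
  assumes p: "1 < p" and g: "\<And>n. g n \<in> unit_ball p" and B: "\<And>n x. x \<in> {0..1} \<Longrightarrow> \<bar>g n x\<bar> \<le> B"
    and lim: "\<And>x. x \<in> {0..1} \<Longrightarrow> (\<lambda>n. g n x) \<longlonglongrightarrow> g' x" and cont: "continuous_on {0..1} g'"
  shows "g' \<in> unit_ball p"
proof -
  have P: "(\<lambda>n. primitive (g n) x) \<longlonglongrightarrow> primitive g' x" if "x \<in> {0..1}" for x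
    by (rule primitive_tendsto[OF unit_ballD(1)[OF g] B lim that])
  have "0 \<le> primitive g' x" if "x \<in> {0..1}" for x
    using P[OF that] unit_ballD(3)[OF g that] by (intro LIMSEQ_le_const) auto
  moreover have "integral {0..1} g' = 0"
    using P[of 1] unit_ballD(2)[OF g] by (simp add: primitive_1 LIMSEQ_const_iff)
  moreover have "integral {0..1} (\<lambda>x. \<bar>g' x\<bar> powr p) \<le> 1"
  proof (rule LIMSEQ_le_const2)
    show "(\<lambda>n. integral {0..1} (\<lambda>x. \<bar>g n x\<bar> powr p)) \<longlonglongrightarrow> integral {0..1} (\<lambda>x. \<bar>g' x\<bar> powr p)"
    proof (rule dominated_convergence(2)[where h = "\<lambda>_. B powr p"])
      show "(\<lambda>x. \<bar>g n x\<bar> powr p) integrable_on {0..1}" for n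
        using unit_ballD(1)[OF g] p by (intro integrable_continuous_real continuous_on_abs_powr)
          auto
      show "norm (\<bar>g n x\<bar> powr p) \<le> B powr p" if "x \<in> {0..1}" for n x
        using B[OF that] p by (auto intro!: powr_mono2)
      show "(\<lambda>n. \<bar>g n x\<bar> powr p) \<longlonglongrightarrow> \<bar>g' x\<bar> powr p" if "x \<in> {0..1}" for x
        using tendsto_abs_pow[OF _ lim[OF that], of p] p by (simp add: abs_pow_def)
    qed auto
    show "\<exists>N. \<forall>n\<ge>N. integral {0..1} (\<lambda>x. \<bar>g n x\<bar> powr p) \<le> 1"
      using unit_ballD(4)[OF g] by blast
  qed
  ultimately show ?thesis using cont by (simp add: unit_ball_def)
qed

text \<open>
  A best response depends continuously on the primitive of the load, on \<open>c\<close> and on the dual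
  norm. The primitives are 1-Lipschitz, the constants \<open>c\<close> lie in \<open>[0,1]\<close>, and the dual norms
  stay away from 0. Hence the slopes converge along a subsequence, pointwise and boundedly.
\<close>

lemma best_response_compact:
  fixes f :: "nat \<Rightarrow> real \<Rightarrow> real"
  assumes load: "\<And>n. load p (f n)" and f1: "\<And>n x. x \<in> {0..1} \<Longrightarrow> f n x \<le> 1"
    and bal: "\<And>n. balanced p (f n) (c n)" and \<delta>: "0 < \<delta>" "\<And>n. \<delta> \<le> dual_norm p (f n) (c n)"
  obtains r g where "strict_mono (r :: nat \<Rightarrow> nat)" "g \<in> unit_ball p"
    "\<And>x. x \<in> {0..1} \<Longrightarrow> (\<lambda>n. primitive (best_response p (f (r n)) (c (r n))) x) \<longlonglongrightarrow> primitive g x"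
proof -
  have p: "1 < p" using load by (rule load.p)
  let ?e = "1 / (p - 1)"
  have e: "0 < ?e" using p by simp
  have contf: "continuous_on {0..1} (f n)" for n using load by (rule load.contf)
  have lip: "\<bar>primitive (f n) x - primitive (f n) y\<bar> \<le> \<bar>x - y\<bar>"
    if "x \<in> {0..1}" "y \<in> {0..1}" for n x y
  proof -
    have *: "\<bar>primitive (f n) x - primitive (f n) y\<bar> \<le> \<bar>x - y\<bar>" if "0 \<le> x" "x \<le> y" "y \<le> 1" for x y
    proof -
      have "integral {0..x} (f n) + integral {x..y} (f n) = integral {0..y} (f n)"
        using that contf[of n]
        by (intro Henstock_Kurzweil_Integration.integral_combine integrable_continuous_real)
          (auto intro: continuous_on_subset)
      moreover have "integral {x..y} (f n) \<le> integral {x..y} (\<lambda>_. 1)"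
        using that contf[of n] f1[of _ n]
        by (intro integral_le integrable_continuous_real) (auto intro: continuous_on_subset)
      moreover have "primitive (f n) x \<le> primitive (f n) y"
        using load.primitive_mono[OF load that] .
      ultimately show ?thesis using that by (simp add: primitive_def)
    qed
    show ?thesis using *[of x y] *[of y x] that by (cases "x \<le> y") (auto simp: abs_minus_commute)
  qed
  have range: "0 \<le> primitive (f n) x" "primitive (f n) x \<le> 1" if "x \<in> {0..1}" for n x
    using load.primitive_range[OF load that] lip[OF that, of 0 n] that by auto
  obtain F k where F: "continuous_on {0..1::real} F" and k: "strict_mono (k :: nat \<Rightarrow> nat)"
    and unif: "\<And>e. 0 < e \<Longrightarrow> \<exists>N. \<forall>n x. n \<ge> N \<and> x \<in> {0..1} \<longrightarrow> norm (primitive (f (k n)) x - F x) < e"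
  proof (rule Arzela_Ascoli[of "{0..1::real}" "\<lambda>n. primitive (f n)" 1])
    show "norm (primitive (f n) x) \<le> 1" if "x \<in> {0..1}" for n x
      using range[OF that, of n] by simp
    show "\<exists>d>0. \<forall>n y. y \<in> {0..1} \<and> norm (x - y) < d \<longrightarrow> norm (primitive (f n) x
      - primitive (f n) y) < e"
      if "x \<in> {0..1}" "0 < e" for x e :: real
      using lip[OF that(1)] that(2) by (intro exI[of _ e]) (auto intro: le_less_trans)
  qed auto
  have limF: "(\<lambda>n. primitive (f (k n)) x) \<longlonglongrightarrow> F x" if "x \<in> {0..1}" for x
    unfolding LIMSEQ_iff using unif that by blast
  have c: "c n \<in> {0..1}" for n
    using bal[of n] range[of 1 n] by (auto simp: balanced_def)
  have "seq_compact {0..1::real}" using compact_imp_seq_compact by blast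
  then obtain c' l where l: "strict_mono (l :: nat \<Rightarrow> nat)" and "((\<lambda>n. c (k n)) \<circ> l) \<longlonglongrightarrow> c'"
    using c by (auto elim!: seq_compactE[of _ "\<lambda>n. c (k n)"])
  then have limc: "(\<lambda>n. c (k (l n))) \<longlonglongrightarrow> c'" by (simp add: o_def)
  define r where "r = k \<circ> l"
  have limd: "(\<lambda>n. c (r n) - primitive (f (r n)) x) \<longlonglongrightarrow> c' - F x" if "x \<in> {0..1}" for x
    using tendsto_diff[OF limc LIMSEQ_subseq_LIMSEQ[OF limF[OF that] l]] by (simp add: r_def o_def)
  have bd: "\<bar>c n - primitive (f n) x\<bar> \<le> 1" if "x \<in> {0..1}" for n x
    using c[of n] range[OF that, of n] by auto
  define N where "N = integral {0..1} (\<lambda>x. \<bar>c' - F x\<bar> powr (p / (p - 1)))"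
  have limN: "(\<lambda>n. dual_norm p (f (r n)) (c (r n))) \<longlonglongrightarrow> N"
    unfolding dual_norm_def N_def
  proof (rule dominated_convergence(2)[where h = "\<lambda>_. 1"])
    show "(\<lambda>x. \<bar>c (r n) - primitive (f (r n)) x\<bar> powr (p / (p - 1))) integrable_on {0..1}" for n
      using p contf by (intro integrable_continuous_real continuous_on_abs_powr continuous_intros
          continuous_on_primitive) auto
    show "norm (\<bar>c (r n) - primitive (f (r n)) x\<bar> powr (p / (p - 1))) \<le> 1" if "x \<in> {0..1}" for n x
      using bd[OF that, of "r n"] p by (auto intro!: powr_le1)
    show "(\<lambda>n. \<bar>c (r n) - primitive (f (r n)) x\<bar> powr (p / (p - 1))) \<longlonglongrightarrow> \<bar>c' - F x\<bar> powr (p / (p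
      - 1))"
      if "x \<in> {0..1}" for x
      using tendsto_abs_pow[OF _ limd[OF that], of "p / (p - 1)"] p by (simp add: abs_pow_def)
  qed auto
  have N: "\<delta> \<le> N" using limN \<delta>(2) by (intro LIMSEQ_le_const[OF limN]) auto
  define g where "g x = spow (c' - F x) ?e / N powr (1 / p)" for x
  have "continuous_on {0..1} g"
    unfolding g_def[abs_def] using N \<delta>(1) e F by (intro continuous_intros continuous_on_spow) auto
  moreover have "(\<lambda>n. best_response p (f (r n)) (c (r n)) x) \<longlonglongrightarrow> g x" if "x \<in> {0..1}" for x
    unfolding best_response_def g_def using N \<delta>(1) e
    by (intro tendsto_divide tendsto_spow limd[OF that] tendsto_powr limN tendsto_const) auto
  moreover have "\<bar>best_response p (f n) (c n) x\<bar> \<le> 1 / \<delta> powr (1 / p)" if "x \<in> {0..1}" for n x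
  proof -
    have "\<bar>spow (c n - primitive (f n) x) ?e\<bar> \<le> 1"
      using bd[OF that, of n] e by (auto intro!: powr_le1)
    moreover have "\<delta> powr (1 / p) \<le> dual_norm p (f n) (c n) powr (1 / p)"
      using \<delta> p by (intro powr_mono2) auto
    ultimately show ?thesis
      using \<delta>(1) by (auto simp: best_response_def abs_divide intro!: frac_le)
  qed
  ultimately show ?thesis
    using that[of r g] k l
      unit_ball_closed[OF p, of "\<lambda>n. best_response p (f (r n)) (c (r n))" "1 / \<delta> powr (1 / p)" g]
      primitive_tendsto[of "\<lambda>n. best_response p (f (r n)) (c (r n))" "1 / \<delta> powr (1 / p)" g]
      load.best_response_unit_ball[OF load bal] load.continuous_best_response[OF load]
    by (simp add: r_def strict_mono_o)
qed

text \<open>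
  An element of all unit balls with positive primitive; it shows that suprema of couplings are
  positive.
\<close>

definition parabola_slope :: "real \<Rightarrow> real" where
  "parabola_slope x = 1 - 2 * x"

lemma primitive_parabola_slope: "x \<in> {0..1} \<Longrightarrow> primitive parabola_slope x = x * (1 - x)"
  by (rule primitive_eqI) (auto intro!: derivative_eq_intros simp: parabola_slope_def)

lemma parabola_slope_unit_ball:
  assumes "1 < p"
  shows "parabola_slope \<in> unit_ball p"
proof -
  have c: "continuous_on {0..1} parabola_slope"
    unfolding parabola_slope_def[abs_def] by (intro continuous_intros)
  have "integral {0..1} (\<lambda>x. \<bar>parabola_slope x\<bar> powr p) \<le> integral {0..1::real} (\<lambda>x. 1)"
  proof (rule integral_le)
    show "(\<lambda>x. \<bar>parabola_slope x\<bar> powr p) integrable_on {0..1}"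
      using c assms by (intro integrable_continuous_real continuous_on_abs_powr) auto
    show "\<bar>parabola_slope x\<bar> powr p \<le> 1" if "x \<in> {0..1}" for x
      using that assms by (auto simp: parabola_slope_def intro!: powr_le1)
  qed auto
  then show ?thesis
    using c primitive_parabola_slope by (auto simp: unit_ball_def primitive_1[symmetric])
qed

text \<open>
  A sequence in the unit ball is replaced by its best responses, which do no worse and have a
  convergent subsequence. For \<open>\<alpha> = 0\<close> the functional is constant, and so is the sequence chosen.
\<close>

lemma power_functional_compact:
  fixes g \<rho> :: "nat \<Rightarrow> real \<Rightarrow> real"
  assumes p: "1 < p" and \<alpha>: "1 \<le> \<alpha> \<or> \<alpha> = 0"
    and \<rho>: "\<And>n. continuous_on {0..1} (\<rho> n)" "\<And>n x. x \<in> {0..1} \<Longrightarrow> 0 \<le> \<rho> n x \<and> \<rho> n x \<le> 1"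
    and g: "\<And>n. g n \<in> unit_ball p" and d: "0 < d" "\<And>n. d \<le> weighted_power \<alpha> (\<rho> n) (g n)"
  obtains h h' r where "\<And>n. h n \<in> unit_ball p" "h' \<in> unit_ball p"
    "\<And>n. weighted_power \<alpha> (\<rho> n) (g n) \<le> weighted_power \<alpha> (\<rho> n) (h n)"
    "strict_mono (r :: nat \<Rightarrow> nat)" 
    "\<And>x. x \<in> {0..1} \<Longrightarrow> (\<lambda>n. primitive (h (r n)) x) \<longlonglongrightarrow> primitive h' x"
proof (cases "\<alpha> = 0")
  case True
  then show ?thesis
    using that[of "\<lambda>_. g 0" "g 0" id] g by (simp add: weighted_power_def strict_mono_id)
next
  case False
  then have \<alpha>: "1 \<le> \<alpha>" using \<alpha> by simp
  have W: "weighted_element p \<alpha> (\<rho> n) (g n)" for n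
    using p \<alpha> \<rho> g less_le_trans[OF d] by unfold_locales blast+
  let ?f = "\<lambda>n. gradient \<alpha> (\<rho> n) (g n)"
  have L: "load p (?f n)" for n using weighted_element.load_gradient[OF W] .
  obtain c where c: "balanced p (?f n) (c n)" for n
    using load.exists_balanced[OF L] by metis
  let ?h = "\<lambda>n. best_response p (?f n) (c n)"
  have f1: "?f n x \<le> 1" if "x \<in> {0..1}" for n x
  proof -
    have "abs_pow (primitive (g n) x) (\<alpha> - 1) \<le> 1"
      using primitive_unit_ball_le_1[OF g p that, of n] unit_ballD(3)[OF g that, of n] \<alpha>
      by (intro abs_pow_le_1) auto
    then show ?thesis unfolding gradient_def using \<rho>(2)[OF that, of n] by (intro mult_le_one) auto
  qed
  have lb: "d powr (1 / (1 - 1 / p)) \<le> dual_norm p (?f n) (c n)" for n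
  proof -
    have e: "0 < 1 - 1 / p" using p by simp
    have "d \<le> dual_norm p (?f n) (c n) powr (1 - 1 / p)"
      using d(2)[of n] weighted_element.weighted_power_le_dual_norm[OF W c, of n] by linarith
    then have "d powr (1 / (1 - 1 / p)) \<le> (dual_norm p (?f n) (c n) powr (1
      - 1 / p)) powr (1 / (1 - 1 / p))"
      using d(1) e by (intro powr_mono2) auto
    then show ?thesis using p load.dual_norm_pos[OF L, of n "c n"]
      by (simp add: powr_powr split: if_splits)
  qed
  have d': "0 < d powr (1 / (1 - 1 / p))" using d(1) by simp
  show ?thesis
  proof (rule best_response_compact[of p ?f c, OF L f1 c d' lb])
    fix r :: "nat \<Rightarrow> nat" and h'
    assume "strict_mono r" "h' \<in> unit_ball p"
      "\<And>x. x \<in> {0..1} \<Longrightarrow> (\<lambda>n. primitive (?h (r n)) x) \<longlonglongrightarrow> primitive h' x"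
    then show ?thesis
      using that[of ?h h' r] load.best_response_unit_ball[OF L c]
        weighted_element.weighted_power_best_response[OF W c] by blast
  qed
qed

section \<open>Existence of a maximising pair\<close>

definition coupling :: "real \<Rightarrow> real \<Rightarrow> (real \<Rightarrow> real) \<Rightarrow> (real \<Rightarrow> real) \<Rightarrow> real" where
  "coupling \<alpha> \<beta> g h = integral {0..1} (\<lambda>x. abs_pow (primitive g x) \<alpha> * abs_pow (primitive h x) \<beta>)"

lemma coupling_commute: "coupling \<alpha> \<beta> g h = coupling \<beta> \<alpha> h g"
  by (simp add: coupling_def mult.commute)

lemma coupling_weighted_power:
  "coupling \<alpha> \<beta> g h = weighted_power \<alpha> (\<lambda>x. abs_pow (primitive h x) \<beta>) g"
  by (simp add: coupling_def weighted_power_def)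

lemma coupling_weighted_power':
  "coupling \<alpha> \<beta> g h = weighted_power \<beta> (\<lambda>x. abs_pow (primitive g x) \<alpha>) h"
  by (simp add: coupling_def weighted_power_def mult.commute)

text \<open>
  The case \<open>\<beta> = 0\<close> is admitted because \<open>coupling p 0 g h\<close> is the integral of the power \<open>p\<close> of
  \<open>primitive g\<close>, for every \<open>h\<close>; this is the variational problem of the first eigenvalue.
\<close>

locale exponents =
  fixes p q \<alpha> \<beta> :: real
  assumes p: "1 < p" and q: "1 < q" and \<alpha>: "1 \<le> \<alpha>" and \<beta>: "1 \<le> \<beta> \<or> \<beta> = 0"
    and homogeneous: "\<alpha> / p + \<beta> / q = 1"
begin

lemma \<alpha>_nonneg: "0 \<le> \<alpha>" and \<beta>_nonneg: "0 \<le> \<beta>"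
  using \<alpha> \<beta> by auto

lemma continuous_coupling_integrand:
  assumes "continuous_on {0..1} g" "continuous_on {0..1} h"
  shows "continuous_on {0..1} (\<lambda>x. abs_pow (primitive g x) \<alpha> * abs_pow (primitive h x) \<beta>)"
  using assms \<alpha>_nonneg \<beta>_nonneg by (intro continuous_intros continuous_on_primitive)

lemma abs_pow_unit_ball_le_1:
  assumes "g \<in> unit_ball r" "1 < r" "x \<in> {0..1}" "0 \<le> \<gamma>"
  shows "abs_pow (primitive g x) \<gamma> \<le> 1"
  using primitive_unit_ball_le_1[OF assms(1-3)] unit_ballD(3)[OF assms(1,3)] assms(4)
  by (intro abs_pow_le_1) auto

lemma coupling_le_1:
  assumes "g \<in> unit_ball p" "h \<in> unit_ball q"
  shows "coupling \<alpha> \<beta> g h \<le> 1"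
proof -
  have "coupling \<alpha> \<beta> g h \<le> integral {0..1::real} (\<lambda>x. 1)"
    unfolding coupling_def
  proof (rule integral_le)
    show "(\<lambda>x. abs_pow (primitive g x) \<alpha> * abs_pow (primitive h x) \<beta>) integrable_on {0..1}"
      using assms by (intro integrable_continuous_real continuous_coupling_integrand unit_ballD)
    show "abs_pow (primitive g x) \<alpha> * abs_pow (primitive h x) \<beta> \<le> 1" if "x \<in> {0..1}" for x
      using abs_pow_unit_ball_le_1[OF assms(1) p that \<alpha>_nonneg]
        abs_pow_unit_ball_le_1[OF assms(2) q that \<beta>_nonneg] by (intro mult_le_one) auto
  qed auto
  then show ?thesis by simp
qed

lemma coupling_tendsto:
  assumes g: "\<And>n. g n \<in> unit_ball p" and h: "\<And>n. h n \<in> unit_ball q"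
    and "\<And>x. x \<in> {0..1} \<Longrightarrow> (\<lambda>n. primitive (g n) x) \<longlonglongrightarrow> primitive g' x"
    and "\<And>x. x \<in> {0..1} \<Longrightarrow> (\<lambda>n. primitive (h n) x) \<longlonglongrightarrow> primitive h' x"
  shows "(\<lambda>n. coupling \<alpha> \<beta> (g n) (h n)) \<longlonglongrightarrow> coupling \<alpha> \<beta> g' h'"
  unfolding coupling_def
proof (rule dominated_convergence(2)[where h = "\<lambda>_. 1"])
  show "(\<lambda>x. abs_pow (primitive (g n) x) \<alpha> * abs_pow (primitive (h n) x) \<beta>) integrable_on {0..1}"
    for n
    using g h by (intro integrable_continuous_real continuous_coupling_integrand unit_ballD)
  show "norm (abs_pow (primitive (g n) x) \<alpha> * abs_pow (primitive (h n) x) \<beta>) \<le> 1"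
    if "x \<in> {0..1}" for n x
    using abs_pow_unit_ball_le_1[OF g p that \<alpha>_nonneg, of n]
      abs_pow_unit_ball_le_1[OF h q that \<beta>_nonneg, of n] by (auto intro!: mult_le_one)
qed (use assms \<alpha>_nonneg \<beta>_nonneg in \<open>auto intro!: tendsto_mult tendsto_abs_pow\<close>)

lemma coupling_parabola_pos: "0 < coupling \<alpha> \<beta> parabola_slope parabola_slope"
  unfolding coupling_def
  using parabola_slope_unit_ball[OF p] primitive_parabola_slope[of "1 / 2"]
  by (intro integral_pos_if_pos_somewhere[of _ "1 / 2"] continuous_coupling_integrand unit_ballD)
    (auto simp: abs_pow_def)

text \<open>
  In a maximising sequence of pairs the first components are replaced by best responses to the
  second ones; along the convergent subsequence, the second components are then replaced by best
  responses to the new first ones (by a constant sequence if \<open>\<beta> = 0\<close>). Neither step lowers the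
  coupling, and both components converge in the end.
\<close>

lemma maximising_pair:
  obtains g h where "g \<in> unit_ball p" "h \<in> unit_ball q" "0 < coupling \<alpha> \<beta> g h"
    "\<And>g' h'. \<lbrakk>g' \<in> unit_ball p; h' \<in> unit_ball q\<rbrakk> \<Longrightarrow> coupling \<alpha> \<beta> g' h' \<le> coupling \<alpha> \<beta> g h"
proof -
  define S where "S = {coupling \<alpha> \<beta> g h | g h. g \<in> unit_ball p \<and> h \<in> unit_ball q}"
  have bdd: "bdd_above S" unfolding S_def using coupling_le_1 by (intro bdd_aboveI[of _ 1]) auto
  have mem: "coupling \<alpha> \<beta> parabola_slope parabola_slope \<in> S"
    unfolding S_def using parabola_slope_unit_ball p q by blast
  define \<Lambda> where "\<Lambda> = Sup S"
  have \<Lambda>: "0 < \<Lambda>"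
    unfolding \<Lambda>_def using coupling_parabola_pos cSup_upper[OF mem bdd] by linarith
  have "\<exists>g h. g \<in> unit_ball p \<and> h \<in> unit_ball q \<and> \<Lambda> - \<Lambda> / (n + 2) < coupling \<alpha> \<beta> g h" for n :: nat
  proof -
    have "\<Lambda> - \<Lambda> / (n + 2) < Sup S" using \<Lambda> by (simp add: \<Lambda>_def)
    then show ?thesis using less_cSupE[of _ S] mem unfolding S_def by blast
  qed
  then obtain g h where g: "\<And>n. g n \<in> unit_ball p" and h: "\<And>n. h n \<in> unit_ball q"
    and near: "\<And>n. \<Lambda> - \<Lambda> / real (n + 2) < coupling \<alpha> \<beta> (g n) (h n)"
    by metis
  (* A uniform positive lower bound, as required for compactness. *)
  have half: "\<Lambda> / 2 \<le> coupling \<alpha> \<beta> (g n) (h n)" for n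
  proof -
    have "\<Lambda> / real (n + 2) \<le> \<Lambda> / 2" using \<Lambda> by (intro divide_left_mono) auto
    then show ?thesis using near[of n] by linarith
  qed
  obtain g1 g' r where g1: "\<And>n. g1 n \<in> unit_ball p" "g' \<in> unit_ball p"
    and le1: "\<And>n. coupling \<alpha> \<beta> (g n) (h n) \<le> coupling \<alpha> \<beta> (g1 n) (h n)"
    and r: "strict_mono (r :: nat \<Rightarrow> nat)"
    and lim1: "\<And>x. x \<in> {0..1} \<Longrightarrow> (\<lambda>n. primitive (g1 (r n)) x) \<longlonglongrightarrow> primitive g' x"
    unfolding coupling_weighted_power
  proof (rule power_functional_compact[OF p disjI1[OF \<alpha>], of "\<lambda>n x. abs_pow (primitive (h n) x)
    \<beta>" g "\<Lambda> / 2"])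
    show "continuous_on {0..1} (\<lambda>x. abs_pow (primitive (h n) x) \<beta>)" for n
      using \<beta>_nonneg unit_ballD(1)[OF h] by (intro continuous_intros continuous_on_primitive)
    show "0 \<le> abs_pow (primitive (h n) x) \<beta> \<and> abs_pow (primitive (h n) x) \<beta> \<le> 1"
      if "x \<in> {0..1}" for n x
      using abs_pow_unit_ball_le_1[OF h q that \<beta>_nonneg] by simp
    show "\<Lambda> / 2 \<le> weighted_power \<alpha> (\<lambda>x. abs_pow (primitive (h n) x) \<beta>) (g n)" for n
      using half by (simp add: coupling_weighted_power)
  qed (use g \<Lambda> in auto)
  obtain h1 h' s where h1: "\<And>n. h1 n \<in> unit_ball q" "h' \<in> unit_ball q"
    and le2: "\<And>n. coupling \<alpha> \<beta> (g1 (r n)) (h (r n)) \<le> coupling \<alpha> \<beta> (g1 (r n)) (h1 n)"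
    and s: "strict_mono (s :: nat \<Rightarrow> nat)"
    and lim2: "\<And>x. x \<in> {0..1} \<Longrightarrow> (\<lambda>n. primitive (h1 (s n)) x) \<longlonglongrightarrow> primitive h' x"
    unfolding coupling_weighted_power'
  proof (rule power_functional_compact[OF q \<beta>, of "\<lambda>n x. abs_pow (primitive (g1 (r n)) x) \<alpha>" "\<lambda>n.
    h (r n)" "\<Lambda> / 2"])
    show "continuous_on {0..1} (\<lambda>x. abs_pow (primitive (g1 (r n)) x) \<alpha>)" for n
      using \<alpha>_nonneg unit_ballD(1)[OF g1(1)] by (intro continuous_intros continuous_on_primitive)
    show "0 \<le> abs_pow (primitive (g1 (r n)) x) \<alpha> \<and> abs_pow (primitive (g1 (r n)) x) \<alpha> \<le> 1"
      if "x \<in> {0..1}" for n x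
      using abs_pow_unit_ball_le_1[OF g1(1) p that \<alpha>_nonneg] by simp
    show "\<Lambda> / 2 \<le> weighted_power \<beta> (\<lambda>x. abs_pow (primitive (g1 (r n)) x) \<alpha>) (h (r n))" for n
      using half[of "r n"] le1[of "r n"] by (simp add: coupling_weighted_power'[symmetric])
  qed (use h \<Lambda> in auto)
  have lim: "(\<lambda>n. coupling \<alpha> \<beta> (g1 (r (s n))) (h1 (s n))) \<longlonglongrightarrow> coupling \<alpha> \<beta> g' h'"
    using g1 h1 lim2 LIMSEQ_subseq_LIMSEQ[OF lim1 s] by (intro coupling_tendsto) (auto simp: o_def)
  have "(\<lambda>n. \<Lambda> - \<Lambda> / real (n + 2)) \<longlonglongrightarrow> \<Lambda>" by real_asymp
  moreover have "strict_mono (\<lambda>n. r (s n))" using r s by (auto simp: strict_mono_def)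
  ultimately have lim0: "(\<lambda>n. \<Lambda> - \<Lambda> / real (r (s n) + 2)) \<longlonglongrightarrow> \<Lambda>"
    by (drule_tac LIMSEQ_subseq_LIMSEQ) (auto simp: o_def)
  have "\<Lambda> - \<Lambda> / real (r (s n) + 2) \<le> coupling \<alpha> \<beta> (g1 (r (s n))) (h1 (s n))" for n
    using near[of "r (s n)"] le1[of "r (s n)"] le2[of "s n"] by simp
  then have "\<Lambda> \<le> coupling \<alpha> \<beta> g' h'"
    using lim0 lim by (rule_tac LIMSEQ_le) auto
  moreover have "coupling \<alpha> \<beta> g h \<le> \<Lambda>" if "g \<in> unit_ball p" "h \<in> unit_ball q" for g h
    unfolding \<Lambda>_def S_def[symmetric] using that by (intro cSup_upper bdd) (auto simp: S_def)
  ultimately show ?thesis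
    using that[of g' h'] g1(2) h1(2) \<Lambda> by (meson order.trans less_le_trans)
qed

end

section \<open>The inequality without sign and norm restrictions\<close>

context exponents
begin

definition coupling_bound :: "real \<Rightarrow> bool" where
  "coupling_bound \<Lambda> \<longleftrightarrow> (\<forall>g\<in>unit_ball p. \<forall>h\<in>unit_ball q. coupling \<alpha> \<beta> g h \<le> \<Lambda>)"

text \<open>
  Homogeneity: dividing \<open>g\<close> by \<open>A\<^bsup>1/p\<^esup>\<close> and \<open>h\<close> by \<open>B\<^bsup>1/q\<^esup>\<close> puts them into the unit balls.
\<close>

lemma coupling_bound_nonneg_case:
  assumes \<Lambda>: "coupling_bound \<Lambda>"
    and g: "continuous_on {0..1} g" "integral {0..1} g = 0" "\<And>x. x \<in> {0..1} \<Longrightarrow> 0 \<le> primitive g x"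
    and h: "continuous_on {0..1} h" "integral {0..1} h = 0" "\<And>x. x \<in> {0..1} \<Longrightarrow> 0 \<le> primitive h x"
    and A: "integral {0..1} (\<lambda>x. \<bar>g x\<bar> powr p) \<le> A" "0 < A"
    and B: "integral {0..1} (\<lambda>x. \<bar>h x\<bar> powr q) \<le> B" "0 < B"
  shows "coupling \<alpha> \<beta> g h \<le> \<Lambda> * A powr (\<alpha> / p) * B powr (\<beta> / q)"
proof -
  have ball: "(\<lambda>x. D powr (- 1 / r) * k x) \<in> unit_ball r"
    if "continuous_on {0..1} k" "integral {0..1} k = 0" "\<And>x. x \<in> {0..1} \<Longrightarrow> 0 \<le> primitive k x"
      "integral {0..1} (\<lambda>x. \<bar>k x\<bar> powr r) \<le> D" "0 < D" "1 < r" for k D r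
  proof -
    have "(D powr (- 1 / r)) powr r = inverse D"
      using that by (simp only: powr_powr) (simp add: powr_minus)
    then have "(\<lambda>x. \<bar>D powr (- 1 / r) * k x\<bar> powr r) = (\<lambda>x. \<bar>k x\<bar> powr r / D)"
      by (auto simp: abs_mult powr_mult divide_inverse)
    then have "integral {0..1} (\<lambda>x. \<bar>D powr (- 1 / r) * k x\<bar> powr r) \<le> 1"
      using that by simp
    then show ?thesis
      using that by (auto simp: unit_ball_def intro!: continuous_intros)
  qed
  let ?a = "A powr (- 1 / p)" and ?b = "B powr (- 1 / q)"
  have "coupling \<alpha> \<beta> (\<lambda>x. ?a * g x) (\<lambda>x. ?b * h x) \<le> \<Lambda>"
    using \<Lambda> ball[OF g A p] ball[OF h B q] by (simp add: coupling_bound_def)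
  moreover have "coupling \<alpha> \<beta> (\<lambda>x. ?a * g x) (\<lambda>x. ?b * h x)
      = ?a powr \<alpha> * ?b powr \<beta> * coupling \<alpha> \<beta> g h"
  proof -
    have "(\<lambda>x. abs_pow (?a * primitive g x) \<alpha> * abs_pow (?b * primitive h x) \<beta>)
        = (\<lambda>x. (?a powr \<alpha> * ?b powr \<beta>) * (abs_pow (primitive g x) \<alpha> * abs_pow (primitive h x) \<beta>))"
      using A B by (auto simp: abs_pow_mult)
    then show ?thesis by (simp add: coupling_def)
  qed
  moreover have "?a powr \<alpha> = inverse (A powr (\<alpha> / p))" "?b powr \<beta> = inverse (B powr (\<beta> / q))"
    by (simp_all add: powr_powr powr_minus[symmetric])
  ultimately have le: "inverse (A powr (\<alpha> / p)) * inverse (B powr (\<beta> / q)) * coupling \<alpha> \<beta> g h \<le> \<Lambda>"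
    by simp
  have "K \<le> \<Lambda> * X * Y" if "inverse X * inverse Y * K \<le> \<Lambda>" "0 < X" "0 < Y" for K X Y :: real
    using that by (simp add: field_simps)
  from this[OF le] show ?thesis using A B by simp
qed

text \<open>
  A function \<open>u\<close> of arbitrary sign is approximated by \<open>sqrt (u\<^sup>2 + \<epsilon>\<^sup>2) - \<epsilon>\<close>. This is
  continuously differentiable, nonnegative and zero at both ends, its slope is at most that of
  \<open>u\<close> in absolute value, and it tends to \<open>\<bar>u\<bar>\<close>.
\<close>

lemma coupling_bound_general:
  assumes \<Lambda>: "coupling_bound \<Lambda>"
    and g: "continuous_on {0..1} g" "integral {0..1} g = 0"
    and h: "continuous_on {0..1} h" "integral {0..1} h = 0"
    and A: "integral {0..1} (\<lambda>x. \<bar>g x\<bar> powr p) \<le> A" "0 < A"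
    and B: "integral {0..1} (\<lambda>x. \<bar>h x\<bar> powr q) \<le> B" "0 < B"
  shows "coupling \<alpha> \<beta> g h \<le> \<Lambda> * A powr (\<alpha> / p) * B powr (\<beta> / q)"
proof -
  define \<epsilon> where "\<epsilon> n = 1 / (real n + 1)" for n
  have \<epsilon>: "0 < \<epsilon> n" for n by (simp add: \<epsilon>_def)
  have \<epsilon>0: "\<epsilon> \<longlonglongrightarrow> 0" unfolding \<epsilon>_def by real_asymp
  define R where "R n k x = sqrt ((primitive k x)\<^sup>2 + (\<epsilon> n)\<^sup>2)" for n k x
  define S where "S n k x = primitive k x * k x / R n k x" for n k x
  have Rpos: "0 < R n k x" for n k x
    using \<epsilon>[of n] by (auto simp: R_def intro: add_nonneg_pos)
  have Rle: "\<bar>primitive k x\<bar> \<le> R n k x" for n k x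
    unfolding R_def by (rule real_le_rsqrt) simp
  have contS: "continuous_on {0..1} (S n k)" if "continuous_on {0..1} k" for n k
    unfolding S_def[abs_def] R_def using that \<epsilon>[of n]
    by (intro continuous_intros continuous_on_primitive) (auto simp: add_nonneg_eq_0_iff)
  have primS: "primitive (S n k) x = R n k x - \<epsilon> n" if k: "continuous_on {0..1} k"
    and x: "x \<in> {0..1}" for n k x
  proof (rule primitive_eqI[OF _ _ x])
    fix y :: real assume y: "y \<in> {0..1}"
    have "0 < (primitive k y)\<^sup>2 + (\<epsilon> n)\<^sup>2" using \<epsilon>[of n] by (auto intro: add_nonneg_pos)
    then show "((\<lambda>x. R n k x - \<epsilon> n) has_real_derivative S n k y) (at y within {0..1})"
      unfolding R_def S_def
      by (auto intro!: derivative_eq_intros primitive_has_derivative[OF k y] simp: field_simps)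
  qed (use \<epsilon>[of n] in \<open>simp add: R_def\<close>)
  have Sle: "\<bar>S n k x\<bar> \<le> \<bar>k x\<bar>" for n k x
  proof -
    have "\<bar>primitive k x\<bar> * \<bar>k x\<bar> \<le> R n k x * \<bar>k x\<bar>"
      by (intro mult_right_mono Rle) auto
    then show ?thesis using Rpos[of n k x] by (simp add: S_def abs_mult field_simps)
  qed
  have prim_nonneg: "0 \<le> primitive (S n k) x" if "continuous_on {0..1} k" "x \<in> {0..1}" for n k x
    using \<epsilon>[of n] by (simp add: primS[OF that] R_def real_le_rsqrt)
  have prim_le: "\<bar>primitive (S n k) x\<bar> \<le> \<bar>primitive k x\<bar>"
    if "continuous_on {0..1} k" "x \<in> {0..1}" for n k x
  proof -
    have "R n k x \<le> \<bar>primitive k x\<bar> + \<epsilon> n"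
      unfolding R_def using \<epsilon>[of n] by (intro real_le_lsqrt) (auto simp: power2_sum)
    then show ?thesis using prim_nonneg[OF that, of n] primS[OF that] by simp
  qed
  have int0: "integral {0..1} (S n k) = 0" if "continuous_on {0..1} k" "integral {0..1} k = 0"
    for n k
    using primS[OF that(1), of 1 n] that(2) \<epsilon>[of n] by (simp add: primitive_1 R_def)
  have norm_le: "integral {0..1} (\<lambda>x. \<bar>S n k x\<bar> powr r) \<le> D"
    if "continuous_on {0..1} k" "1 < r" "integral {0..1} (\<lambda>x. \<bar>k x\<bar> powr r) \<le> D" for n k r D
  proof -
    have "integral {0..1} (\<lambda>x. \<bar>S n k x\<bar> powr r) \<le> integral {0..1} (\<lambda>x. \<bar>k x\<bar> powr r)"
      using that contS[OF that(1), of n] Sle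
      by (intro integral_le integrable_continuous_real continuous_on_abs_powr) (auto intro!:
        powr_mono2)
    then show ?thesis using that by simp
  qed
  have lim: "(\<lambda>n. primitive (S n k) x) \<longlonglongrightarrow> \<bar>primitive k x\<bar>"
    if "continuous_on {0..1} k" "x \<in> {0..1}" for k x
  proof -
    have "(\<lambda>n. R n k x - \<epsilon> n) \<longlonglongrightarrow> sqrt ((primitive k x)\<^sup>2 + 0\<^sup>2) - 0"
      unfolding R_def by (intro tendsto_intros \<epsilon>0)
    then show ?thesis using primS[OF that] by simp
  qed
  have "(\<lambda>n. coupling \<alpha> \<beta> (S n g) (S n h)) \<longlonglongrightarrow> coupling \<alpha> \<beta> g h"
    unfolding coupling_def
  proof (rule dominated_convergence(2)[where h = "\<lambda>x. abs_pow (primitive g x) \<alpha>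
    * abs_pow (primitive h x) \<beta>"])
    show "(\<lambda>x. abs_pow (primitive (S n g) x) \<alpha>
      * abs_pow (primitive (S n h) x) \<beta>) integrable_on {0..1}" for n
      using contS g h by (intro integrable_continuous_real continuous_coupling_integrand)
    show "(\<lambda>x. abs_pow (primitive g x) \<alpha> * abs_pow (primitive h x) \<beta>) integrable_on {0..1}"
      using g h by (intro integrable_continuous_real continuous_coupling_integrand)
    show "norm (abs_pow (primitive (S n g) x) \<alpha> * abs_pow (primitive (S n h) x) \<beta>)
        \<le> abs_pow (primitive g x) \<alpha> * abs_pow (primitive h x) \<beta>" if "x \<in> {0..1}" for n x
      using prim_le[OF g(1) that] prim_le[OF h(1) that] \<alpha>_nonneg \<beta>_nonneg
      by (auto intro!: mult_mono abs_pow_mono)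
    show "(\<lambda>n. abs_pow (primitive (S n g) x) \<alpha> * abs_pow (primitive (S n h) x) \<beta>)
        \<longlonglongrightarrow> abs_pow (primitive g x) \<alpha> * abs_pow (primitive h x) \<beta>" if "x \<in> {0..1}" for x
    proof -
      have "abs_pow \<bar>t\<bar> a = abs_pow t a" for t a by (simp add: abs_pow_def)
      then show ?thesis
        using tendsto_mult[OF tendsto_abs_pow[OF \<alpha>_nonneg lim[OF g(1) that]]
            tendsto_abs_pow[OF \<beta>_nonneg lim[OF h(1) that]]] by simp
    qed
  qed
  moreover have "coupling \<alpha> \<beta> (S n g) (S n h) \<le> \<Lambda> * A powr (\<alpha> / p) * B powr (\<beta> / q)" for n
    using A B p q g h
    by (intro coupling_bound_nonneg_case \<Lambda> contS int0 prim_nonneg norm_le)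
  ultimately show ?thesis by (intro LIMSEQ_le_const2) auto
qed

end

section \<open>Chebyshev and Berwald inequalities\<close>

text \<open>
  Let \<open>z\<close> be a point where \<open>g\<close> equals its mean. The product of \<open>f x - f z\<close> and \<open>g x - g z\<close> is
  nonnegative, and its integral is the difference of the two sides.
\<close>

lemma Chebyshev_integral:
  fixes f g :: "real \<Rightarrow> real"
  assumes f: "continuous_on {0..1} f" and g: "continuous_on {0..1} g"
    and mono: "\<And>x y. 0 \<le> x \<Longrightarrow> x \<le> y \<Longrightarrow> y \<le> 1 \<Longrightarrow> f x \<le> f y \<and> g x \<le> g y"
  shows "integral {0..1} f * integral {0..1} g \<le> integral {0..1} (\<lambda>x. f x * g x)"
proof -
  have ig: "g integrable_on {0..1}" by (intro integrable_continuous_real g)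
  have "g 0 \<le> integral {0..1} g" "integral {0..1} g \<le> g 1"
    using integral_le[of "\<lambda>_. g 0" "{0..1}" g] integral_le[of g "{0..1}" "\<lambda>_. g 1"] ig mono by auto
  then obtain z where z: "0 \<le> z" "z \<le> 1" "g z = integral {0..1} g"
    using IVT'[of g 0 "integral {0..1} g" 1] g by auto
  have "0 \<le> integral {0..1} (\<lambda>x. (f x - f z) * (g x - g z))"
  proof (rule integral_nonneg)
    show "(\<lambda>x. (f x - f z) * (g x - g z)) integrable_on {0..1}"
      using f g by (intro integrable_continuous_real continuous_intros)
    show "0 \<le> (f x - f z) * (g x - g z)" if "x \<in> {0..1}" for x
      using mono[of x z] mono[of z x] z that
      by (cases "x \<le> z") (auto intro: mult_nonneg_nonneg mult_nonpos_nonpos)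
  qed
  also have "(\<lambda>x. (f x - f z) * (g x - g z)) = (\<lambda>x. f x * g x - g z * f x - f z * g x + f z * g z)"
    by (auto simp: algebra_simps)
  also have "integral {0..1} \<dots> = integral {0..1} (\<lambda>x. f x * g x) - g z * integral {0..1} f
      - f z * integral {0..1} g + f z * g z"
  proof -
    have i: "(\<lambda>x. f x * g x) integrable_on {0..1}" "(\<lambda>x. g z * f x) integrable_on {0..1}"
      "(\<lambda>x. f z * g x) integrable_on {0..1}"
      by (intro integrable_continuous_real continuous_intros f g)+
    show ?thesis
      using integral_diff[OF i(1,2)] integral_diff[OF integrable_diff[OF i(1,2)] i(3)]
        integral_add[OF integrable_diff[OF integrable_diff[OF i(1,2)] i(3)]
          integrable_const_ivl[of "f z * g z" 0 1]]
      by simp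
  qed
  finally show ?thesis using z(3) by (simp add: mult.commute)
qed

lemma has_integral_power: 
  assumes "0 < a"
  shows "((\<lambda>x. x powr a) has_integral 1 / (1 + a)) {0..1::real}"
  using has_integral_powr_from_0[of a 1] assms by (simp add: add.commute)

text \<open>
  The powers of \<open>x\<close> and of \<open>1 - x\<close> are oppositely ordered.
\<close>

lemma Beta_le:
  fixes \<alpha> \<beta> :: real
  assumes "0 < \<alpha>" "0 < \<beta>"
  shows "Beta (1 + \<alpha>) (1 + \<beta>) \<le> 1 / ((1 + \<alpha>) * (1 + \<beta>))"
proof -
  have B: "integral {0..1} (\<lambda>x. x powr \<alpha> * (1 - x) powr \<beta>) = Beta (1 + \<alpha>) (1 + \<beta>)"
    using has_integral_Beta_real[of "1 + \<alpha>" "1 + \<beta>"] assms by (simp add: integral_unique)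
  have "((\<lambda>x. (1 - x) powr \<beta>) has_integral
      (- ((1 - 1) powr (1 + \<beta>) / (1 + \<beta>)) - - ((1 - 0) powr (1 + \<beta>) / (1 + \<beta>)))) {0..1::real}"
  proof (rule fundamental_theorem_of_calculus_interior)
    show "continuous_on {0..1::real} (\<lambda>x. - ((1 - x) powr (1 + \<beta>) / (1 + \<beta>)))"
      using assms by (intro continuous_intros continuous_on_powr') auto
    show "((\<lambda>x. - ((1 - x) powr (1 + \<beta>) / (1 + \<beta>))) has_vector_derivative (1 - x) powr \<beta>) (at x)"
      if "x \<in> {0<..<1}" for x
      unfolding has_real_derivative_iff_has_vector_derivative[symmetric]
      using that assms by (auto intro!: derivative_eq_intros)
  qed auto
  then have "integral {0..1::real} (\<lambda>x. (1 - x) powr \<beta>) = 1 / (1 + \<beta>)"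
    by (simp add: integral_unique)
  moreover have "integral {0..1::real} (\<lambda>x. x powr \<alpha>) = 1 / (1 + \<alpha>)"
    using has_integral_power[of \<alpha>] assms by (simp add: integral_unique)
  moreover have "integral {0..1} (\<lambda>x. x powr \<alpha>) * integral {0..1} (\<lambda>x. - ((1 - x) powr \<beta>))
      \<le> integral {0..1} (\<lambda>x. x powr \<alpha> * - ((1 - x) powr \<beta>))"
    using assms
    by (intro Chebyshev_integral continuous_intros continuous_on_powr') (auto intro!: powr_mono2)
  ultimately show ?thesis using B by simp
qed

text \<open>
  For \<open>s \<le> 1\<close> the power \<open>s\<close> is concave and lies below its tangent at \<open>a\<close>.
\<close>

lemma powr_concave_tangent:
  fixes a b s :: real
  assumes "0 < a" "0 \<le> b" "0 < s" "s \<le> 1"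
  shows "b powr s \<le> a powr s + s * a powr (s - 1) * (b - a)"
proof (cases "b = 0")
  case True
  have "a powr (s - 1) * a = a powr s"
    using assms powr_add[of a "s - 1" 1] by simp
  then have "s * (a powr (s - 1) * a) = s * a powr s" by simp
  then have "s * a powr (s - 1) * (b - a) = - (s * a powr s)" using True by (simp add: mult.assoc)
  moreover have "s * a powr s \<le> 1 * a powr s" using assms by (intro mult_right_mono) auto
  ultimately show ?thesis using True by (simp only: powr_0)
next
  case False
  then have "b powr s * a powr (1 - s) \<le> s * b + (1 - s) * a"
    using Youngs_inequality_0[of s "1 - s" b a] assms by simp
  then have "b powr s * a powr (1 - s) * a powr (s - 1) \<le> (s * b + (1 - s) * a) * a powr (s - 1)"
    by (intro mult_right_mono) auto
  moreover have "a powr (1 - s) * a powr (s - 1) = 1"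
    using assms by (simp add: powr_add[symmetric])
  moreover have "a powr (s - 1) * a = a powr s"
    using assms powr_add[of a "s - 1" 1] by simp
  moreover have "(s * b + (1 - s) * a) * a powr (s - 1)
      = s * b * a powr (s - 1) + (1 - s) * (a powr (s - 1) * a)"
    by (simp add: algebra_simps)
  ultimately have "b powr s \<le> s * b * a powr (s - 1) + (1 - s) * a powr s"
    by (simp add: mult.assoc)
  also have "\<dots> = a powr s + s * a powr (s - 1) * b - s * (a powr (s - 1) * a)"
    unfolding \<open>a powr (s - 1) * a = a powr s\<close> by (simp add: algebra_simps)
  finally show ?thesis by (simp add: algebra_simps)
qed

text \<open>
  The slope of a nondecreasing concave function on \<open>[0,1]\<close> that vanishes at 0.
\<close>

locale profile =
  fixes \<phi> :: "real \<Rightarrow> real"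
  assumes cont: "continuous_on {0..1} \<phi>"
    and nonneg: "\<And>x. x \<in> {0..1} \<Longrightarrow> 0 \<le> \<phi> x"
    and antimono: "\<And>x y. 0 \<le> x \<Longrightarrow> x \<le> y \<Longrightarrow> y \<le> 1 \<Longrightarrow> \<phi> y \<le> \<phi> x"
begin

abbreviation "\<Phi> \<equiv> primitive \<phi>"

lemma cont\<Phi>: "continuous_on {0..1} \<Phi>"
  by (rule continuous_on_primitive[OF cont])

lemma increment:
  assumes "0 \<le> x" "x \<le> y" "y \<le> 1"
  shows "\<Phi> x \<le> \<Phi> y" "\<Phi> y - \<Phi> x \<le> (y - x) * \<phi> x"
proof -
  have i: "\<phi> integrable_on {x..y}"
    using cont assms by (auto intro!: integrable_continuous_real intro: continuous_on_subset)
  have "integral {0..x} \<phi> + integral {x..y} \<phi> = integral {0..y} \<phi>"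
    using assms cont
    by (intro Henstock_Kurzweil_Integration.integral_combine integrable_continuous_real)
      (auto intro: continuous_on_subset)
  then have e: "\<Phi> y - \<Phi> x = integral {x..y} \<phi>" by (simp add: primitive_def)
  have "0 \<le> integral {x..y} \<phi>" using i nonneg assms by (intro integral_nonneg) auto
  then show "\<Phi> x \<le> \<Phi> y" using e by simp
  have "integral {x..y} \<phi> \<le> integral {x..y} (\<lambda>_. \<phi> x)"
    using i antimono assms by (intro integral_le) auto
  then show "\<Phi> y - \<Phi> x \<le> (y - x) * \<phi> x" using e assms by simp
qed

lemma \<Phi>_nonneg: "x \<in> {0..1} \<Longrightarrow> 0 \<le> \<Phi> x"
  using increment(1)[of 0 x] by simp

lemma cont\<Phi>_powr: "0 < r \<Longrightarrow> continuous_on {0..1} (\<lambda>x. \<Phi> x powr r)"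
  using \<Phi>_nonneg by (intro continuous_on_powr' cont\<Phi> continuous_intros) auto

text \<open>
  Concavity: \<open>\<Phi> x / x\<close> is nonincreasing.
\<close>

lemma \<Phi>_ratio:
  assumes "0 \<le> x" "x \<le> y" "y \<le> 1"
  shows "x * \<Phi> y \<le> y * \<Phi> x"
proof -
  have "integral {0..x} (\<lambda>_. \<phi> x) \<le> integral {0..x} \<phi>"
    using antimono assms cont
    by (intro integral_le integrable_continuous_real) (auto intro: continuous_on_subset)
  then have "x * \<phi> x \<le> \<Phi> x" using assms by (simp add: primitive_def)
  then have "(y - x) * (x * \<phi> x) \<le> (y - x) * \<Phi> x" using assms by (intro mult_left_mono) auto
  moreover have "x * (\<Phi> y - \<Phi> x) \<le> x * ((y - x) * \<phi> x)"
    using increment(2)[OF assms] assms by (intro mult_left_mono) auto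
  ultimately show ?thesis by (simp add: algebra_simps)
qed

text \<open>
  Among all \<open>\<Phi>\<close> with a given integral of the power \<open>p\<close>, the linear one, \<open>k * x\<close>, has the least
  integral of the power \<open>a \<le> p\<close>. Since \<open>\<Phi> x / x\<close> is nonincreasing, \<open>\<Phi>\<close> lies above the line up to
  some point \<open>z\<close> and below it afterwards. As \<open>\<Phi>\<close> is also nondecreasing, its power \<open>p\<close> is at most
  \<open>T = (k z)\<^sup>p\<close> before \<open>z\<close> and at least \<open>T\<close> after it. The tangent inequality for the concave
  power \<open>s = a/p\<close> then bounds \<open>\<Phi>\<^sup>a - (k x)\<^sup>a\<close> from below by \<open>s T\<^bsup>s-1\<^esup> (\<Phi>\<^sup>p - (k x)\<^sup>p)\<close>, whose
  integral is zero.
\<close>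

lemma Berwald:
  assumes ap: "0 < a" "a \<le> p" and pos: "0 < integral {0..1} (\<lambda>x. \<Phi> x powr p)"
  shows "((1 + p) * integral {0..1} (\<lambda>x. \<Phi> x powr p)) powr (a / p) / (1 + a)
      \<le> integral {0..1} (\<lambda>x. \<Phi> x powr a)"
proof -
  define I where "I = integral {0..1} (\<lambda>x. \<Phi> x powr p)"
  have p: "0 < p" using ap by simp
  note cp = cont\<Phi>_powr
  (* The slope for which the line has the same integral of the power p as the profile. *)
  define k where "k = ((1 + p) * I) powr (1 / p)"
  have k: "0 < k" using p pos by (simp add: k_def I_def)
  have kp: "k powr p = (1 + p) * I" using p pos by (simp add: k_def I_def powr_powr)
  have ck: "continuous_on {0..1} (\<lambda>x. (k * x) powr r)" if "0 < r" for r
    using that k by (intro continuous_on_powr' continuous_intros) auto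
  have Ik: "integral {0..1} (\<lambda>x. (k * x) powr r) = k powr r / (1 + r)" if "0 < r" for r
  proof -
    have "integral {0..1} (\<lambda>x. (k * x) powr r) = integral {0..1} (\<lambda>x. k powr r * x powr r)"
      using k by (intro integral_cong) (auto simp: powr_mult)
    then show ?thesis using has_integral_power[OF that] by (simp add: integral_unique)
  qed
  have Idiff: "integral {0..1} (\<lambda>x. \<Phi> x powr r - (k * x) powr r)
      = integral {0..1} (\<lambda>x. \<Phi> x powr r) - k powr r / (1 + r)" if "0 < r" for r
    using that cp ck Ik by (subst integral_diff) (auto intro!: integrable_continuous_real)
  have zero: "integral {0..1} (\<lambda>x. \<Phi> x powr p - (k * x) powr p) = 0"
    using Idiff[OF p] kp p by (simp add: I_def)
  have cdiff: "continuous_on {0..1} (\<lambda>x. \<Phi> x powr p - (k * x) powr p)"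
    by (intro continuous_on_diff cp ck p)
  (* The line meets the profile away from 0; otherwise one of them would have the larger
     integral. *)
  obtain z where z: "0 < z" "z \<le> 1" "\<Phi> z = k * z"
  proof (cases "\<Phi> 1 = k")
    case True then show ?thesis using that[of 1] by simp
  next
    case False
    have "\<not> k < \<Phi> 1"
    proof
      assume less: "k < \<Phi> 1"
      have "(k * x) powr p \<le> \<Phi> x powr p" if "x \<in> {0..1}" for x
      proof (rule powr_mono2)
        have "x * k \<le> x * \<Phi> 1" using less that by (intro mult_left_mono) auto
        then show "k * x \<le> \<Phi> x" using \<Phi>_ratio[of x 1] that by (simp add: mult.commute)
      qed (use p k that in auto)
      then have "0 < integral {0..1} (\<lambda>x. \<Phi> x powr p - (k * x) powr p)"
        using less k p by (intro integral_pos_if_pos_somewhere[of _ 1] cdiff) (auto intro!: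
          powr_less_mono2)
      then show False using zero by simp
    qed
    then have less: "\<Phi> 1 < k" using False by simp
    have "\<exists>y\<in>{0..1}. k * y < \<Phi> y"
    proof (rule ccontr)
      assume "\<not> ?thesis"
      then have le: "\<Phi> x \<le> k * x" if "x \<in> {0..1}" for x using that by (auto simp: not_less)
      have "0 < integral {0..1} (\<lambda>x. - (\<Phi> x powr p - (k * x) powr p))"
      proof (rule integral_pos_if_pos_somewhere[of _ 1])
        show "0 \<le> - (\<Phi> x powr p - (k * x) powr p)" if "x \<in> {0..1}" for x
          using powr_mono2[OF _ \<Phi>_nonneg[OF that] le[OF that], of p] p by simp
        show "0 < - (\<Phi> 1 powr p - (k * 1) powr p)"
          using powr_less_mono2[OF p _ less] \<Phi>_nonneg[of 1] by simp
      qed (auto intro!: continuous_on_minus cdiff simp del: minus_diff_eq)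
      then show False using zero by (simp del: minus_diff_eq)
    qed
    then obtain y where y: "y \<in> {0..1}" "k * y < \<Phi> y" by blast
    then have "y \<noteq> 0" by auto
    obtain z where "y \<le> z" "z \<le> 1" "k * z - \<Phi> z = 0"
      using IVT'[of "\<lambda>x. k * x - \<Phi> x" y 0 1] y less
        continuous_on_subset[OF cont\<Phi>, of "{y..1}"] by (force intro!: continuous_intros)
    then show ?thesis using that[of z] y \<open>y \<noteq> 0\<close> by auto
  qed
  define s where "s = a / p"
  have s: "0 < s" "s \<le> 1" using ap p by (auto simp: s_def)
  define T where "T = (k * z) powr p"
  have T: "0 < T" using k z by (simp add: T_def)
  have pow_s: "(t powr p) powr s = t powr a" for t using p by (simp add: powr_powr s_def)
  have key: "s * T powr (s - 1) * (\<Phi> x powr p - (k * x) powr p) \<le> \<Phi> x powr a - (k * x) powr a"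
    if x: "x \<in> {0..1}" for x
  proof (cases "x = 0")
    case False
    then have x0: "0 < x" using x by simp
    define A B where "A = \<Phi> x powr p" and "B = (k * x) powr p"
    have B0: "0 \<le> B" by (simp add: B_def)
    (* The order is B, A, T before z and T, A, B after z. *)
    have "0 < A \<and> (B \<le> A \<and> A \<le> T \<or> A \<le> B \<and> T \<le> A)"
    proof (cases "x \<le> z")
      case True
      have "x * \<Phi> z \<le> z * \<Phi> x" using \<Phi>_ratio[of x z] True x z by simp
      then have "k * x \<le> \<Phi> x" using z by (simp add: mult_ac)
      moreover from this have "0 < \<Phi> x" using mult_pos_pos[OF k x0] by linarith
      moreover have "\<Phi> x \<le> k * z" using increment(1)[of x z] True x z by simp
      ultimately show ?thesis
        unfolding A_def B_def T_def using k p x0 \<Phi>_nonneg[OF x] by (auto intro!: powr_mono2)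
    next
      case False
      have "z * \<Phi> x \<le> x * \<Phi> z" using \<Phi>_ratio[of z x] False x z by simp
      then have "\<Phi> x \<le> k * x" using z by (simp add: mult_ac)
      moreover have "k * z \<le> \<Phi> x" using increment(1)[of z x] False x z by simp
      moreover have "0 < k * z" using k z by simp
      ultimately show ?thesis
        unfolding A_def B_def T_def using k p x0 \<Phi>_nonneg[OF x] by (auto intro!: powr_mono2)
    qed
    then have A: "0 < A" and cases: "B \<le> A \<and> A \<le> T \<or> A \<le> B \<and> T \<le> A" by auto
    have "B powr s \<le> A powr s + s * A powr (s - 1) * (B - A)"
      by (rule powr_concave_tangent[OF A B0 s])
    moreover have "A powr (s - 1) * (B - A) \<le> T powr (s - 1) * (B - A)"
      using cases
    proof
      assume "B \<le> A \<and> A \<le> T"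
      then show ?thesis using A s by (intro mult_right_mono_neg powr_mono2') auto
    next
      assume "A \<le> B \<and> T \<le> A"
      then show ?thesis using T s by (intro mult_right_mono powr_mono2') auto
    qed
    then have "s * A powr (s - 1) * (B - A) \<le> s * T powr (s - 1) * (B - A)"
      using s by (simp add: mult.assoc)
    ultimately have "s * T powr (s - 1) * (A - B) \<le> A powr s - B powr s"
      by (simp add: algebra_simps)
    then show ?thesis by (simp add: A_def B_def pow_s)
  qed simp
  have "integral {0..1} (\<lambda>x. s * T powr (s - 1) * (\<Phi> x powr p - (k * x) powr p))
      \<le> integral {0..1} (\<lambda>x. \<Phi> x powr a - (k * x) powr a)"
    by (intro integral_le integrable_continuous_real continuous_on_mult continuous_on_const cdiff
        continuous_on_diff cp ck ap(1) key)
  then have "0 \<le> integral {0..1} (\<lambda>x. \<Phi> x powr a) - k powr a / (1 + a)"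
    using zero Idiff[OF ap(1)] by simp
  moreover have "k powr a = ((1 + p) * I) powr (a / p)"
    by (simp add: k_def powr_powr)
  ultimately show ?thesis by (simp add: I_def)
qed

end

section \<open>Symmetric functions built from a profile\<close>

lemma DERIV_affine_within:
  fixes F :: "real \<Rightarrow> real"
  assumes "(F has_real_derivative D) (at (k * x + d) within {0..1})"
    and "\<And>y. y \<in> S \<Longrightarrow> k * y + d \<in> {0..1}"
  shows "((\<lambda>x. F (k * x + d)) has_real_derivative k * D) (at x within S)"
proof -
  have "(F has_real_derivative D) (at (k * x + d) within (\<lambda>x. k * x + d) ` S)"
    using assms by (auto intro: DERIV_subset)
  moreover have "((\<lambda>x. k * x + d) has_real_derivative k) (at x within S)"
    by (auto intro!: derivative_eq_intros)
  ultimately show ?thesis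
    using DERIV_image_chain[of F D "\<lambda>x. k * x + d" x S k] by (simp add: o_def mult.commute)
qed

lemma integral_affine:
  fixes F :: "real \<Rightarrow> real"
  assumes F: "continuous_on {0..1} F" and "a \<le> b" and S: "\<And>x. x \<in> {a..b} \<Longrightarrow> k * x + d \<in> {0..1}"
  shows "((\<lambda>x. k * F (k * x + d)) has_integral (primitive F (k * b + d) - primitive F (k * a
    + d))) {a..b}"
  using assms
  by (intro fundamental_theorem_of_calculus)
    (auto simp: has_real_derivative_iff_has_vector_derivative[symmetric]
      intro!: DERIV_affine_within primitive_has_derivative)

definition tent :: "real \<Rightarrow> real" where
  "tent x = (if x \<le> 1 / 2 then 2 * x else 2 - 2 * x)"

lemma tent_range: "x \<in> {0..1} \<Longrightarrow> tent x \<in> {0..1}"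
  by (auto simp: tent_def)

lemma integral_tent:
  fixes F :: "real \<Rightarrow> real"
  assumes "continuous_on {0..1} F"
  shows "integral {0..1} (\<lambda>x. F (tent x)) = integral {0..1} F"
proof -
  have "((\<lambda>x. 1 / 2 * (2 * F (2 * x + 0))) has_integral 1 / 2 * (primitive F (2 * (1 / 2) + 0)
    - primitive F (2 * 0 + 0))) {0..1/2}"
    by (intro has_integral_mult_right integral_affine assms) auto
  then have "((\<lambda>x. F (tent x)) has_integral integral {0..1} F / 2) {0..1/2}"
    by (rule_tac has_integral_eq_rhs[OF has_integral_eq]) (auto simp: tent_def primitive_1)
  moreover have "((\<lambda>x. - 1 / 2 * (- 2 * F (- 2 * x + 2))) has_integral
      - 1 / 2 * (primitive F (- 2 * 1 + 2) - primitive F (- 2 * (1 / 2) + 2))) {1/2..1}"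
    by (intro has_integral_mult_right integral_affine assms) auto
  then have "((\<lambda>x. F (tent x)) has_integral integral {0..1} F / 2) {1/2..1}"
    by (rule_tac has_integral_eq_rhs[OF has_integral_eq]) (auto simp: tent_def primitive_1
      algebra_simps)
  ultimately have "((\<lambda>x. F (tent x)) has_integral integral {0..1} F / 2
    + integral {0..1} F / 2) {0..1}"
    by (rule_tac has_integral_combine[of 0 "1 / 2" 1]) auto
  then show ?thesis by (simp add: integral_unique)
qed

locale half_profile = profile +
  assumes end_zero: "\<phi> 1 = 0"
begin

text \<open>
  The slope of the function that follows \<open>\<Phi>\<close> on \<open>[0,1/2]\<close> at double speed and returns
  symmetrically. It is continuous because \<open>\<phi>\<close> ends at 0.
\<close>

definition mirrored :: "real \<Rightarrow> real" where
  "mirrored x = (if x \<le> 1 / 2 then 2 * \<phi> (2 * x) else - 2 * \<phi> (2 - 2 * x))"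

lemma continuous_mirrored: "continuous_on {0..1} mirrored"
proof -
  have "continuous_on ({0..1/2} \<union> {1/2..1}) (\<lambda>x.
    if x \<le> 1 / 2 then 2 * \<phi> (2 * x) else - 2 * \<phi> (2 - 2 * x))"
  proof (rule continuous_on_If)
    show "continuous_on {0..1 / 2} (\<lambda>x. 2 * \<phi> (2 * x))"
      by (intro continuous_intros continuous_on_compose2[OF cont]) auto
    show "continuous_on {1 / 2..1} (\<lambda>x. - 2 * \<phi> (2 - 2 * x))"
      by (intro continuous_intros continuous_on_compose2[OF cont]) auto
    show "2 * \<phi> (2 * x) = - 2 * \<phi> (2 - 2 * x)" if "x \<in> {1 / 2..1}" "x \<le> 1 / 2" for x
    proof -
      have x: "x = 1 / 2" using that by simp
      show ?thesis unfolding x using end_zero by simp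
    qed
  qed auto
  moreover have "{0..1/2} \<union> {1/2..1} = {0..1::real}" by auto
  ultimately show ?thesis by (simp add: mirrored_def[abs_def])
qed

lemma primitive_mirrored:
  assumes "x \<in> {0..1}"
  shows "primitive mirrored x = \<Phi> (tent x)"
proof -
  have left: "(mirrored has_integral \<Phi> (2 * y)) {0..y}" if "0 \<le> y" "y \<le> 1 / 2" for y
  proof -
    have "((\<lambda>x. 2 * \<phi> (2 * x + 0)) has_integral (\<Phi> (2 * y + 0) - \<Phi> (2 * 0 + 0))) {0..y}"
      using that by (intro integral_affine cont) auto
    then show ?thesis
      using that by (rule_tac has_integral_eq_rhs[OF has_integral_eq]) (auto simp: mirrored_def)
  qed
  show ?thesis
  proof (cases "x \<le> 1 / 2")
    case True
    then show ?thesis using left[of x] assms by (simp add: primitive_def tent_def integral_unique)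
  next
    case False
    have "((\<lambda>x. - 2 * \<phi> (- 2 * x + 2)) has_integral (\<Phi> (- 2 * x + 2) - \<Phi> (- 2 * (1 / 2)
      + 2))) {1/2..x}"
      using assms False by (intro integral_affine cont) auto
    then have "(mirrored has_integral (\<Phi> (2 - 2 * x) - \<Phi> 1)) {1/2..x}"
      using end_zero
      by (rule_tac has_integral_eq_rhs[OF has_integral_eq]) (auto simp: mirrored_def
        algebra_simps dest: order.antisym)
    then have "(mirrored has_integral (\<Phi> (2 * (1 / 2)) + (\<Phi> (2 - 2 * x) - \<Phi> 1))) {0..x}"
      using left[of "1 / 2"] False by (intro has_integral_combine[of 0 "1 / 2" x]) auto
    then show ?thesis using False by (simp add: primitive_def tent_def integral_unique)
  qed
qed

lemma integral_mirrored: "integral {0..1} mirrored = 0"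
  using primitive_mirrored[of 1] by (simp add: primitive_1 tent_def)

lemma integral_abs_mirrored:
  assumes "0 < p"
  shows "integral {0..1} (\<lambda>x. \<bar>mirrored x\<bar> powr p) = 2 powr p * integral {0..1} (\<lambda>x. \<phi> x powr p)"
proof -
  have "integral {0..1} (\<lambda>x. \<bar>mirrored x\<bar> powr p) = integral {0..1} (\<lambda>x. 2 powr p
    * \<phi> (tent x) powr p)"
    using nonneg by (intro integral_cong) (auto simp: mirrored_def tent_def abs_mult powr_mult)
  also have "\<dots> = 2 powr p * integral {0..1} (\<lambda>x. \<phi> x powr p)"
    using integral_tent[of "\<lambda>x. \<phi> x powr p"] assms cont nonneg
    by (simp add: continuous_on_powr')
  finally show ?thesis .
qed

end

text \<open>
  Both functions are \<open>\<Phi>\<close>, \<open>\<Psi>\<close> composed with the same tent, so the coupling is an integral of a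
  product of two nondecreasing functions. The factors are separated by Chebyshev's inequality
  and estimated by Berwald's, which applies because \<open>\<alpha>/p + \<beta>/q = 1\<close> implies \<open>\<alpha> \<le> p\<close> and \<open>\<beta> \<le> q\<close>.
\<close>

lemma coupling_mirrored_ge:
  assumes "half_profile \<phi>" "half_profile \<psi>" and p: "1 < p" "1 < q" and \<alpha>: "1 \<le> \<alpha>" "1 \<le> \<beta>"
    and hom: "\<alpha> / p + \<beta> / q = 1"
    and pos: "0 < integral {0..1} (\<lambda>x. primitive \<phi> x powr p)" "0
      < integral {0..1} (\<lambda>x. primitive \<psi> x powr q)"
  shows "(1 + p) powr (\<alpha> / p) * (1 + q) powr (\<beta> / q) * Beta (1 + \<alpha>) (1 + \<beta>)
      * integral {0..1} (\<lambda>x. primitive \<phi> x powr p) powr (\<alpha> / p)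
      * integral {0..1} (\<lambda>x. primitive \<psi> x powr q) powr (\<beta> / q)
      \<le> coupling \<alpha> \<beta> (half_profile.mirrored \<phi>) (half_profile.mirrored \<psi>)"
proof -
  interpret \<phi>: half_profile \<phi> by fact
  interpret \<psi>: half_profile \<psi> by fact
  let ?I = "integral {0..1} (\<lambda>x. primitive \<phi> x powr p)"
    and ?J = "integral {0..1} (\<lambda>x. primitive \<psi> x powr q)"
  let ?P = "((1 + p) * ?I) powr (\<alpha> / p)" and ?Q = "((1 + q) * ?J) powr (\<beta> / q)"
  have "\<alpha> / p \<le> 1" "\<beta> / q \<le> 1"
    using hom p \<alpha> by (smt (verit) divide_nonneg_nonneg)+
  then have le: "\<alpha> \<le> p" "\<beta> \<le> q" using p by auto
  have c: "continuous_on {0..1} (\<lambda>x. primitive \<phi> x powr \<alpha>)" "continuous_on {0..1} (\<lambda>x. primitive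
    \<psi> x powr \<beta>)"
    using \<alpha> by (auto intro!: \<phi>.cont\<Phi>_powr \<psi>.cont\<Phi>_powr)
  have "(1 + p) powr (\<alpha> / p) * (1 + q) powr (\<beta> / q) * Beta (1 + \<alpha>) (1 + \<beta>) * ?I powr (\<alpha> / p)
    * ?J powr (\<beta> / q)
      = ?P * ?Q * Beta (1 + \<alpha>) (1 + \<beta>)"
    using p pos by (simp add: powr_mult mult_ac)
  also have "\<dots> \<le> ?P * ?Q * (1 / ((1 + \<alpha>) * (1 + \<beta>)))"
    using Beta_le[of \<alpha> \<beta>] \<alpha> by (intro mult_left_mono) auto
  also have "\<dots> = ?P / (1 + \<alpha>) * (?Q / (1 + \<beta>))" by simp
  also have "\<dots> \<le> integral {0..1} (\<lambda>x. primitive \<phi> x powr \<alpha>)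
    * integral {0..1} (\<lambda>x. primitive \<psi> x powr \<beta>)"
    using \<phi>.Berwald[of \<alpha> p] \<psi>.Berwald[of \<beta> q] \<alpha> le pos c
    by (intro mult_mono) (auto intro!: integral_nonneg integrable_continuous_real)
  also have "\<dots> \<le> integral {0..1} (\<lambda>x. primitive \<phi> x powr \<alpha> * primitive \<psi> x powr \<beta>)"
    using c \<alpha> \<phi>.\<Phi>_nonneg \<psi>.\<Phi>_nonneg \<phi>.increment(1) \<psi>.increment(1)
    by (intro Chebyshev_integral) (auto intro!: powr_mono2)
  also have "\<dots> = integral {0..1} (\<lambda>x. primitive \<phi> (tent x) powr \<alpha> * primitive \<psi> (tent x) powr \<beta>)"
    by (intro integral_tent[symmetric] continuous_on_mult c)
  also have "\<dots> = coupling \<alpha> \<beta> (half_profile.mirrored \<phi>) (half_profile.mirrored \<psi>)"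
    unfolding coupling_def
  proof (rule integral_cong)
    fix x :: real assume x: "x \<in> {0..1}"
    show "primitive \<phi> (tent x) powr \<alpha> * primitive \<psi> (tent x) powr \<beta>
      = abs_pow (primitive \<phi>.mirrored x) \<alpha> * abs_pow (primitive \<psi>.mirrored x) \<beta>"
      using \<alpha> \<phi>.\<Phi>_nonneg[OF tent_range[OF x]] \<psi>.\<Phi>_nonneg[OF tent_range[OF x]]
      by (simp add: \<phi>.primitive_mirrored[OF x] \<psi>.primitive_mirrored[OF x] abs_pow_powr)
  qed
  finally show ?thesis .
qed

section \<open>A symmetric function with small Rayleigh quotient\<close>

text \<open>
  The hypotheses say that \<open>u\<close> is a concave solution of \<open>- \<Delta>\<^sub>p u = u\<^bsup>p-1\<^esup> / \<Lambda>\<close> with \<open>u 0 = 0\<close>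
  whose slope vanishes at \<open>m\<close>. Stretching \<open>[0,m]\<close> to \<open>[0,1]\<close> gives \<open>\<phi>\<close>. As the flux vanishes at
  one end and \<open>u\<close> at the other, partial integration shows that the integral of \<open>\<phi>\<^sup>p\<close> is exactly
  \<open>m\<^sup>p/\<Lambda>\<close> times that of \<open>\<Phi>\<^sup>p\<close>, and \<open>2 m \<le> 1\<close>.
\<close>

lemma half_profile_of_solution:
  fixes u g :: "real \<Rightarrow> real"
  assumes p: "1 < p" and \<Lambda>: "0 < \<Lambda>" and g: "continuous_on {0..1} g"
    and anti: "\<And>x y. 0 \<le> x \<Longrightarrow> x \<le> y \<Longrightarrow> y \<le> 1 \<Longrightarrow> g y \<le> g x"
    and u: "\<And>x. x \<in> {0..1} \<Longrightarrow> (u has_real_derivative g x) (at x within {0..1})"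
    and u0: "u 0 = 0" and unn: "\<And>x. x \<in> {0..1} \<Longrightarrow> 0 \<le> u x"
    and N: "\<And>x. x \<in> {0..1} \<Longrightarrow> ((\<lambda>x. spow (g x) (p - 1)) has_real_derivative - (u x powr (p
      - 1)) / \<Lambda>) (at x within {0..1})"
    and m: "0 < m" "m \<le> 1 / 2" "g m = 0" and um: "0 < u m"
  shows "\<exists>\<phi>. half_profile \<phi> \<and> 0 < integral {0..1} (\<lambda>x. primitive \<phi> x powr p) \<and>
    2 powr p * integral {0..1} (\<lambda>x. \<phi> x powr p) \<le> integral {0..1} (\<lambda>x. primitive \<phi> x powr p) / \<Lambda>"
proof -
  define \<phi> where "\<phi> y = m * g (m * y)" for y
  have my: "m * y + 0 \<in> {0..1}" "m * y \<le> m" if "y \<in> {0..1}" for y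
  proof -
    have "0 \<le> m * y" "m * y \<le> m" using that m mult_left_mono[of y 1 m] by auto
    moreover from this have "m * y \<le> 1" using m by linarith
    ultimately show "m * y + 0 \<in> {0..1}" "m * y \<le> m" by simp_all
  qed
  have cont\<phi>: "continuous_on {0..1} \<phi>"
    unfolding \<phi>_def using my by (intro continuous_intros continuous_on_compose2[OF g]) auto
  have hp: "half_profile \<phi>"
  proof
    show "0 \<le> \<phi> x" if "x \<in> {0..1}" for x
      using anti[of "m * x" m] my[OF that] m that by (simp add: \<phi>_def)
    show "\<phi> y \<le> \<phi> x" if "0 \<le> x" "x \<le> y" "y \<le> 1" for x y
      using anti[of "m * x" "m * y"] my[of y] m that by (simp add: \<phi>_def)
  qed (use cont\<phi> m in \<open>auto simp: \<phi>_def\<close>)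
  interpret half_profile \<phi> by fact
  have prim: "\<Phi> y = u (m * y)" if "y \<in> {0..1}" for y
  proof (rule primitive_eqI[OF _ _ that])
    fix x :: real assume "x \<in> {0..1}"
    then show "((\<lambda>y. u (m * y)) has_real_derivative \<phi> x) (at x within {0..1})"
      using DERIV_affine_within[of u "g (m * x)" m x 0 "{0..1}"] u[of "m * x"] my
        by (simp add: \<phi>_def)
  qed (use u0 in auto)
  let ?I = "integral {0..1} (\<lambda>x. \<Phi> x powr p)"
  note contp = cont\<Phi>_powr
  have pos: "0 < ?I"
    using contp[of p] p um prim[of 1] by (intro integral_pos_if_pos_somewhere[of _ 1]) auto
  (* The flux of the stretched function; it vanishes at 1, the function itself at 0. *)
  define M where "M y = spow (\<phi> y) (p - 1)" for y
  have M_deriv: "(M has_real_derivative - (m powr p / \<Lambda> * \<Phi> y powr (p - 1))) (at y within {0..1})"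
    if y: "y \<in> {0..1}" for y
  proof -
    have "((\<lambda>y. spow (g (m * y)) (p - 1)) has_real_derivative m * (- (u (m * y) powr (p
      - 1)) / \<Lambda>)) (at y within {0..1})"
      using DERIV_affine_within[of "\<lambda>x. spow (g x) (p - 1)" "- (u (m * y) powr (p
        - 1)) / \<Lambda>" m y 0 "{0..1}"] N[of "m * y"] my y by simp
    then have "((\<lambda>y. m powr (p - 1) * spow (g (m * y)) (p - 1)) has_real_derivative
        m powr (p - 1) * (m * (- (u (m * y) powr (p - 1)) / \<Lambda>))) (at y within {0..1})"
      by (rule DERIV_cmult)
    moreover have "(\<lambda>y. m powr (p - 1) * spow (g (m * y)) (p - 1)) = M"
      using m by (auto simp: M_def \<phi>_def spow_mult)
    moreover have "m powr p = m powr (p - 1) * m" using m powr_add[of m "p - 1" 1] by simp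
    ultimately show ?thesis using prim[OF y] by (simp add: mult_ac)
  qed
  have "integral {0..1} (\<lambda>x. M x * \<phi> x)
      = M 1 * \<Phi> 1 - M 0 * \<Phi> 0 - integral {0..1} (\<lambda>x. - (m powr p / \<Lambda> * \<Phi> x powr (p - 1)) * \<Phi> x)"
    using p by (intro integral_by_parts M_deriv primitive_has_derivative cont\<phi>
        continuous_on_minus continuous_on_mult continuous_on_const contp) auto
  also have "integral {0..1} (\<lambda>x. - (m powr p / \<Lambda> * \<Phi> x powr (p - 1)) * \<Phi> x)
      = integral {0..1} (\<lambda>x. - (m powr p / \<Lambda>) * \<Phi> x powr p)"
  proof (rule integral_cong)
    fix x :: real assume "x \<in> {0..1}"
    then have "\<Phi> x powr (p - 1) * \<Phi> x = \<Phi> x powr p"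
      using \<Phi>_nonneg[of x] abs_pow_pred_mult[of p "\<Phi> x"] p by (simp add: abs_pow_powr)
    then show "- (m powr p / \<Lambda> * \<Phi> x powr (p - 1)) * \<Phi> x = - (m powr p / \<Lambda>) * \<Phi> x powr p"
      by (simp add: mult.assoc)
  qed
  also have "M 1 = 0" using end_zero by (simp add: M_def spow_def)
  finally have "integral {0..1} (\<lambda>x. M x * \<phi> x) = m powr p / \<Lambda> * ?I"
    by simp
  moreover have "integral {0..1} (\<lambda>x. M x * \<phi> x) = integral {0..1} (\<lambda>x. \<phi> x powr p)"
    using nonneg by (intro integral_cong) (simp add: M_def spow_mult_self)
  ultimately have eq: "integral {0..1} (\<lambda>x. \<phi> x powr p) = m powr p / \<Lambda> * ?I" by simp
  have "2 powr p * m powr p = (2 * m) powr p" using m by (simp add: powr_mult)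
  also have "\<dots> \<le> 1" using m p by (intro powr_le1) auto
  finally have "(2 powr p * m powr p) * (?I / \<Lambda>) \<le> 1 * (?I / \<Lambda>)"
    using pos \<Lambda> by (intro mult_right_mono) auto
  then show ?thesis using eq hp pos by (intro exI[of _ \<phi>]) simp
qed

text \<open>
  By the Euler-Lagrange equation the flux of a maximiser is nonincreasing, so the maximiser is
  concave. Its slope changes sign at some \<open>m\<close>. If \<open>m > 1/2\<close>, the reflected function is used,
  whose slope changes sign at \<open>1 - m\<close>.
\<close>

lemma half_profile_of_maximiser:
  assumes p: "1 < p" and g: "g \<in> unit_ball p" and pos: "0 < weighted_power p (\<lambda>_. 1) g"
    and max: "\<And>h. h \<in> unit_ball p \<Longrightarrow> weighted_power p (\<lambda>_. 1) h \<le> weighted_power p (\<lambda>_. 1) g"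
  shows "\<exists>\<phi>. half_profile \<phi> \<and> 0 < integral {0..1} (\<lambda>x. primitive \<phi> x powr p) \<and>
    2 powr p * integral {0..1} (\<lambda>x. \<phi> x powr p)
      \<le> integral {0..1} (\<lambda>x. primitive \<phi> x powr p) / weighted_power p (\<lambda>_. 1) g"
proof -
  define \<Lambda> where "\<Lambda> = weighted_power p (\<lambda>_. 1) g"
  interpret weighted_element p p "\<lambda>_. 1" g
    using p g pos by unfold_locales auto
  define f where "f = gradient p (\<lambda>_. 1) g"
  obtain c where c: "\<And>x. x \<in> {0..1} \<Longrightarrow> spow (g x) (p - 1) = (c - primitive f x) / \<Lambda>"
    using Euler_Lagrange[OF max] unfolding f_def \<Lambda>_def by blast
  have \<Lambda>: "0 < \<Lambda>" using pos by (simp add: \<Lambda>_def)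
  note contg = unit_ballD(1)[OF g]
  have anti: "g y \<le> g x" if "0 \<le> x" "x \<le> y" "y \<le> 1" for x y
  proof -
    have "spow (g y) (p - 1) \<le> spow (g x) (p - 1)"
      using c[of x] c[of y] primitive_mono[OF that] \<Lambda> that by (simp add: f_def divide_right_mono)
    then have "spow (spow (g y) (p - 1)) (1 / (p - 1)) \<le> spow (spow (g x) (p - 1)) (1 / (p - 1))"
      using p by (intro spow_mono[of "1 / (p - 1)" "spow (g y) (p - 1)"]) auto
    moreover have "(p - 1) * (1 / (p - 1)) = 1" using p by simp
    ultimately show ?thesis by (simp only: spow_spow)
  qed
  have f: "f x = primitive g x powr (p - 1)" if "x \<in> {0..1}" for x
    using p unit_ballD(3)[OF g that] by (simp add: f_def gradient_def abs_pow_powr)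
  have N: "((\<lambda>x. spow (g x) (p - 1)) has_real_derivative - (primitive g x powr (p
    - 1)) / \<Lambda>) (at x within {0..1})"
    if x: "x \<in> {0..1}" for x
  proof -
    have "((\<lambda>x. (c - primitive f x) / \<Lambda>) has_real_derivative - (primitive g x powr (p
      - 1)) / \<Lambda>) (at x within {0..1})"
      using \<Lambda> contf primitive_has_derivative[of f x] x f[OF x]
      by (auto intro!: derivative_eq_intros simp: f_def)
    then show ?thesis
      by (rule has_field_derivative_transform_within[where d = 1]) (use c x in auto)
  qed
  have nonzero: "\<exists>x\<in>{0..1}. primitive g x \<noteq> 0"
  proof (rule ccontr)
    assume "\<not> ?thesis"
    then have "integral {0..1} (\<lambda>x. abs_pow (primitive g x) p * 1)
      = integral {0..1 :: real} (\<lambda>x. 0 :: real)"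
      using p by (intro integral_cong) (auto simp: abs_pow_def)
    then show False using pos by (simp add: weighted_power_def)
  qed
  have le0: "primitive g y \<le> 0" if "y \<in> {0..1}" "\<And>x. x \<in> {0..y} \<Longrightarrow> g x \<le> 0" for y
  proof -
    have "integral {0..y} g \<le> integral {0..y} (\<lambda>_. 0)"
      using that contg by (intro integral_le integrable_continuous_real) (auto intro:
        continuous_on_subset)
    then show ?thesis by (simp add: primitive_def)
  qed
  have "0 < g 0"
  proof (rule ccontr)
    assume "\<not> 0 < g 0"
    then have "g x \<le> 0" if "x \<in> {0..1}" for x using anti[of 0 x] that by auto
    then have "primitive g x \<le> 0" if "x \<in> {0..1}" for x using le0[OF that] that by auto
    then show False using nonzero unit_ballD(3)[OF g] by (metis order.antisym)
  qed
  have "g 1 < 0"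
  proof (rule ccontr)
    assume "\<not> g 1 < 0"
    then have "0 \<le> g x" if "x \<in> {0..1}" for x using anti[of x 1] that by auto
    then have "0 < integral {0..1} g"
      using \<open>0 < g 0\<close> contg by (intro integral_pos_if_pos_somewhere[of _ 0]) auto
    then show False using unit_ballD(2)[OF g] by simp
  qed
  obtain m where m: "0 \<le> m" "m \<le> 1" "g m = 0"
    using IVT2'[of g 1 0 0] \<open>0 < g 0\<close> \<open>g 1 < 0\<close> contg by auto
  have m01: "0 < m" "m < 1" using m \<open>0 < g 0\<close> \<open>g 1 < 0\<close>
    by (metis less_irrefl order.not_eq_order_implies_strict)+
  have um: "0 < primitive g m"
  proof (rule ccontr)
    assume "\<not> 0 < primitive g m"
    then have u0: "primitive g m = 0" using unit_ballD(3)[OF g, of m] m by simp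
    have "primitive g x \<le> 0" if x: "x \<in> {0..1}" for x
    proof (cases "x \<le> m")
      case True
      have "integral {0..x} g + integral {x..m} g = integral {0..m} g"
        using True x m contg by (intro Henstock_Kurzweil_Integration.integral_combine
          integrable_continuous_real)
          (auto intro: continuous_on_subset)
      moreover have "0 \<le> integral {x..m} g"
        using True x m contg anti[of _ m]
        by (intro integral_nonneg integrable_continuous_real) (auto intro: continuous_on_subset)
      ultimately show ?thesis using u0 by (simp add: primitive_def)
    next
      case False
      have "integral {0..m} g + integral {m..x} g = integral {0..x} g"
        using False x m contg by (intro Henstock_Kurzweil_Integration.integral_combine
          integrable_continuous_real)
          (auto intro: continuous_on_subset)
      moreover have "integral {m..x} g \<le> integral {m..x} (\<lambda>_. 0)"
        using False x m contg anti[of m]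
        by (intro integral_le integrable_continuous_real) (auto intro: continuous_on_subset)
      ultimately show ?thesis using u0 by (simp add: primitive_def)
    qed
    then show False using nonzero unit_ballD(3)[OF g] by (metis order.antisym)
  qed
  show ?thesis
    unfolding \<Lambda>_def[symmetric]
  proof (cases "m \<le> 1 / 2")
    case True
    show "\<exists>\<phi>. half_profile \<phi> \<and> 0 < integral {0..1} (\<lambda>x. primitive \<phi> x powr p) \<and>
      2 powr p * integral {0..1} (\<lambda>x. \<phi> x powr p) \<le> integral {0..1} (\<lambda>x. primitive \<phi> x powr p) / \<Lambda>"
      by (rule half_profile_of_solution[of p \<Lambda> g "primitive g" m])
        (use p \<Lambda> contg anti N m01 m True um unit_ballD(3)[OF g] primitive_has_derivative in auto)
  next
    case False
    have reflect: "((\<lambda>x. F (1 - x)) has_real_derivative - D) (at x within {0..1})"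
      if "(F has_real_derivative D) (at (1 - x) within {0..1})" for F :: "real \<Rightarrow> real" and D x
      using DERIV_affine_within[of F D "-1" x 1 "{0..1}"] that by simp
    show "\<exists>\<phi>. half_profile \<phi> \<and> 0 < integral {0..1} (\<lambda>x. primitive \<phi> x powr p) \<and>
      2 powr p * integral {0..1} (\<lambda>x. \<phi> x powr p) \<le> integral {0..1} (\<lambda>x. primitive \<phi> x powr p) / \<Lambda>"
    proof (rule half_profile_of_solution[of p \<Lambda> "\<lambda>x. - g (1 - x)" "\<lambda>x. primitive g (1 - x)" "1
      - m"])
      show "continuous_on {0..1} (\<lambda>x. - g (1 - x))"
        by (intro continuous_intros continuous_on_compose2[OF contg]) auto
      show "((\<lambda>x. primitive g (1 - x)) has_real_derivative - g (1 - x)) (at x within {0..1})"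
        if "x \<in> {0..1}" for x
        using that by (intro reflect primitive_has_derivative contg) auto
      show "((\<lambda>x. spow (- g (1 - x)) (p - 1)) has_real_derivative - (primitive g (1 - x) powr (p
        - 1)) / \<Lambda>) (at x within {0..1})"
        if "x \<in> {0..1}" for x
        using DERIV_minus[OF reflect[OF N[of "1 - x"]]] that by simp
      show "- g (1 - y) \<le> - g (1 - x)" if "0 \<le> x" "x \<le> y" "y \<le> 1" for x y
        using anti[of "1 - y" "1 - x"] that by simp
    qed (use p \<Lambda> m01 m False um unit_ballD(2,3)[OF g] in \<open>auto simp: primitive_1\<close>)
  qed
qed

section \<open>Smooth functions and bumps\<close>

text \<open>
  Differentiability of a finite order is defined by recursion, so that closure properties can be
  proved by induction on the order.
\<close>

primrec times_differentiable :: "nat \<Rightarrow> (real \<Rightarrow> real) \<Rightarrow> bool" where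
  "times_differentiable 0 f \<longleftrightarrow> True"
| "times_differentiable (Suc n) f \<longleftrightarrow>
     (\<exists>f'. (\<forall>x. (f has_real_derivative f' x) (at x)) \<and> times_differentiable n f')"

definition smooth :: "(real \<Rightarrow> real) \<Rightarrow> bool" where
  "smooth f \<longleftrightarrow> (\<forall>n. times_differentiable n f)"

lemma times_differentiable_Suc_imp: "times_differentiable (Suc n) f \<Longrightarrow> times_differentiable n f"
  by (induction n arbitrary: f) fastforce+

lemma times_differentiable_const: "times_differentiable n (\<lambda>x. c)"
proof (induction n arbitrary: c)
  case (Suc n)
  show ?case using Suc[of 0] by (auto intro!: exI[of _ "\<lambda>_. 0"])
qed simp

lemma times_differentiable_add:
  "times_differentiable n f \<Longrightarrow> times_differentiable n g \<Longrightarrow> times_differentiable n (\<lambda>x. f x + g x)"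
proof (induction n arbitrary: f g)
  case (Suc n)
  then obtain f' g' where "\<And>x. (f has_real_derivative f' x) (at x)" "times_differentiable n f'"
    "\<And>x. (g has_real_derivative g' x) (at x)" "times_differentiable n g'" by auto
  then show ?case
    using Suc.IH[of f' g'] by (auto intro!: exI[of _ "\<lambda>x. f' x + g' x"] derivative_eq_intros)
qed simp

lemma times_differentiable_mult:
  "times_differentiable n f \<Longrightarrow> times_differentiable n g \<Longrightarrow> times_differentiable n (\<lambda>x. f x * g x)"
proof (induction n arbitrary: f g)
  case (Suc n)
  then obtain f' g' where f': "\<And>x. (f has_real_derivative f' x) (at x)" "times_differentiable n f'"
    and g': "\<And>x. (g has_real_derivative g' x) (at x)" "times_differentiable n g'" by auto
  have "times_differentiable n (\<lambda>x. f' x * g x + f x * g' x)"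
    using Suc.IH times_differentiable_Suc_imp Suc.prems f' g'
      by (intro times_differentiable_add) blast+
  then show ?case
    using f' g' by (auto intro!: exI[of _ "\<lambda>x. f' x * g x + f x * g' x"] derivative_eq_intros)
qed simp

lemma times_differentiable_affine:
  "times_differentiable n f \<Longrightarrow> times_differentiable n (\<lambda>x. f (a * x + b))"
proof (induction n arbitrary: f)
  case (Suc n)
  then obtain f' where f': "\<And>x. (f has_real_derivative f' x) (at x)" "times_differentiable n f'"
    by auto
  have "((\<lambda>x. a * x + b) has_real_derivative a) (at x)" for x
    by (auto intro!: derivative_eq_intros)
  from DERIV_chain'[OF this f'(1)]
  have "((\<lambda>x. f (a * x + b)) has_real_derivative a * f' (a * x + b)) (at x)" for x
    by (simp add: mult.commute[of _ a])
  moreover have "times_differentiable n (\<lambda>x. a * f' (a * x + b))"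
    using Suc.IH[OF f'(2)] by (intro times_differentiable_mult times_differentiable_const)
  ultimately show ?case
    unfolding times_differentiable.simps by (intro exI[of _ "\<lambda>x. a * f' (a * x + b)"] conjI allI)
qed simp

lemma smooth_const: "smooth (\<lambda>x. c)"
  by (simp add: smooth_def times_differentiable_const)

lemma smooth_add: "smooth f \<Longrightarrow> smooth g \<Longrightarrow> smooth (\<lambda>x. f x + g x)"
  by (simp add: smooth_def times_differentiable_add)

lemma smooth_mult: "smooth f \<Longrightarrow> smooth g \<Longrightarrow> smooth (\<lambda>x. f x * g x)"
  by (simp add: smooth_def times_differentiable_mult)

lemma smooth_affine: "smooth f \<Longrightarrow> smooth (\<lambda>x. f (a * x + b))"
  by (simp add: smooth_def times_differentiable_affine)

lemma smooth_if_derivative_smooth: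
  assumes "\<And>x. (f has_real_derivative f' x) (at x)" "smooth f'"
  shows "smooth f"
  unfolding smooth_def
proof
  show "times_differentiable n f" for n
    using assms by (cases n) (auto simp: smooth_def)
qed

lemma smooth_D:
  assumes "smooth f"
  obtains f' where "\<And>x. (f has_real_derivative f' x) (at x)" "smooth f'"
proof -
  have "times_differentiable (Suc 0) f" using assms unfolding smooth_def by blast
  then obtain f' where f': "\<And>x. (f has_real_derivative f' x) (at x)" by auto
  have "times_differentiable n f'" for n
  proof -
    have "times_differentiable (Suc n) f" using assms unfolding smooth_def by blast
    then obtain g where g: "\<And>x. (f has_real_derivative g x) (at x)" "times_differentiable n g"
      by auto
    have "g = f'" using DERIV_unique[OF g(1) f'] by auto
    then show ?thesis using g by simp
  qed
  then show ?thesis using that f' by (auto simp: smooth_def)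
qed

lemma smooth_continuous: "smooth f \<Longrightarrow> continuous_on S f"
  by (metis smooth_D DERIV_continuous_on has_field_derivative_at_within)

lemma smooth_imp_higher_deriv:
  assumes "smooth f"
  shows "(deriv ^^ k) f field_differentiable at x"
  using assms
proof (induction k arbitrary: f)
  case 0
  then show ?case by (auto simp: field_differentiable_def elim: smooth_D)
next
  case (Suc k)
  then obtain f' where f': "\<And>x. (f has_real_derivative f' x) (at x)" "smooth f'"
    using smooth_D by blast
  then have "deriv f = f'" using DERIV_imp_deriv by blast
  then show ?case using Suc.IH[OF f'(2)] by (simp add: funpow_swap1)
qed

lemma smooth_linear:
  assumes "bounded_linear (f :: real \<Rightarrow> real)"
  shows "smooth f"
proof (rule smooth_if_derivative_smooth)
  obtain c where "f = (\<lambda>x. x * c)"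
    using real_bounded_linear assms by blast
  then show "(f has_real_derivative f 1) (at x)" for x
    by (auto intro!: derivative_eq_intros)
qed (rule smooth_const)

lemma smooth_polynomial: "real_polynomial_function f \<Longrightarrow> smooth f" for f :: "real \<Rightarrow> real"
  by (induction rule: real_polynomial_function.induct)
    (auto intro: smooth_linear smooth_const smooth_add smooth_mult)

text \<open>
  For \<open>k = 0\<close> the standard smooth function that vanishes for \<open>x \<le> 0\<close>. The further members make
  the family closed under derivatives up to linear combinations, which gives smoothness of all
  of them at once.
\<close>

definition flat :: "nat \<Rightarrow> real \<Rightarrow> real" where
  "flat k x = (if x \<le> 0 then 0 else exp (- 1 / x) / x ^ k)"

lemma flat_tendsto_0: "(flat k \<longlongrightarrow> 0) (at 0)"
proof (rule filterlim_split_at)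
  show "(flat k \<longlongrightarrow> 0) (at_left 0)"
    by (rule tendsto_eventually) (auto simp: flat_def eventually_at_left_field intro!: exI[of _
      "-1"])
  have "((\<lambda>x. inverse x ^ k / exp (inverse x)) \<longlongrightarrow> (0::real)) (at_right 0)"
    by (rule filterlim_compose[OF tendsto_power_div_exp_0 filterlim_inverse_at_top_right])
  moreover have "\<forall>\<^sub>F x in at_right 0. inverse x ^ k / exp (inverse x) = flat k x"
    by (auto simp: flat_def eventually_at_right_field exp_minus field_simps power_inverse intro!:
      exI[of _ 1])
  ultimately show "(flat k \<longlongrightarrow> 0) (at_right 0)"
    by (rule Lim_transform_eventually)
qed

lemma flat_derivative:
  "(flat k has_real_derivative flat (k + 2) x - real k * flat (k + 1) x) (at x)"
proof -
  consider "x < 0" | "x = 0" | "0 < x" by linarith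
  then show ?thesis
  proof cases
    case 1
    have "((\<lambda>x. 0) has_real_derivative 0) (at x)" by simp
    then have "(flat k has_real_derivative 0) (at x)"
      by (rule has_field_derivative_transform_within_open[of _ _ _ "{..<0}"]) (use 1 in \<open>auto
        simp: flat_def\<close>)
    then show ?thesis using 1 by (simp add: flat_def)
  next
    case 2
    have "((\<lambda>h. flat k h / h) \<longlongrightarrow> 0) (at 0)"
    proof -
      have "flat (Suc k) = (\<lambda>h. flat k h / h)" by (auto simp: flat_def field_simps)
      then show ?thesis using flat_tendsto_0[of "Suc k"] by simp
    qed
    then show ?thesis using 2 by (simp add: DERIV_def flat_def)
  next
    case 3
    have "((\<lambda>x. exp (- 1 / x) / x ^ k) has_real_derivative
        (exp (- 1 / x) * (1 / x\<^sup>2) * x ^ k - exp (- 1 / x) * (real k * x ^ (k - 1))) / (x ^ k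
          * x ^ k)) (at x)"
      using 3 by (auto intro!: derivative_eq_intros simp: power2_eq_square)
    moreover have "(exp (- 1 / x) * (1 / x\<^sup>2) * x ^ k - exp (- 1 / x) * (real k * x ^ (k
      - 1))) / (x ^ k * x ^ k)
        = exp (- 1 / x) / x ^ (k + 2) - real k * (exp (- 1 / x) / x ^ (k + 1))"
      using 3 by (cases k) (auto simp: field_simps power2_eq_square)
    ultimately have "((\<lambda>x. exp (- 1 / x) / x ^ k) has_real_derivative flat (k + 2) x - real k
      * flat (k + 1) x) (at x)"
      using 3 by (simp add: flat_def)
    then show ?thesis
      by (rule has_field_derivative_transform_within_open[of _ _ _ "{0<..}"]) (use 3 in \<open>auto
        simp: flat_def\<close>)
  qed
qed

lemma smooth_flat: "smooth (flat k)"
proof -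
  have "times_differentiable n (flat k)" for n
  proof (induction n arbitrary: k)
    case (Suc n)
    have "times_differentiable n (\<lambda>x. flat (k + 2) x + (- real k) * flat (k + 1) x)"
      by (intro times_differentiable_add times_differentiable_mult times_differentiable_const
        Suc.IH)
    then show ?case
      using flat_derivative[of k] by (auto intro!: exI[of _ "\<lambda>x. flat (k + 2) x - real k
        * flat (k + 1) x"])
  qed simp
  then show ?thesis by (simp add: smooth_def)
qed

text \<open>
  A smooth function supported in \<open>[a,b]\<close> that tends to 1 inside as \<open>n\<close> grows.
\<close>

definition bump :: "real \<Rightarrow> real \<Rightarrow> real \<Rightarrow> real \<Rightarrow> real" where
  "bump n a b x = flat 0 (n * (x - a)) * flat 0 (n * (b - x))"

lemma smooth_bump: "smooth (bump n a b)"
proof -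
  have "bump n a b = (\<lambda>x. flat 0 (n * x + (- n * a)) * flat 0 ((- n) * x + n * b))"
    by (auto simp: bump_def algebra_simps)
  then show ?thesis by (simp only:) (intro smooth_mult smooth_affine smooth_flat)
qed

lemma flat0_bounds: "0 \<le> flat 0 x" "flat 0 x \<le> 1"
  by (auto simp: flat_def)

lemma bump_bounds: "0 \<le> bump n a b x" "bump n a b x \<le> 1"
  by (auto simp: bump_def flat0_bounds intro: mult_le_one)

lemma bump_outside: "0 \<le> n \<Longrightarrow> x \<notin> {a<..<b} \<Longrightarrow> bump n a b x = 0"
  by (auto simp: bump_def flat_def mult_le_0_iff not_less)

lemma bump_pos: "0 < n \<Longrightarrow> x \<in> {a<..<b} \<Longrightarrow> 0 < bump n a b x"
  by (auto simp: bump_def flat_def mult_le_0_iff intro!: mult_pos_pos)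

lemma flat0_tendsto_1:
  assumes "filterlim f at_top F"
  shows "((\<lambda>x. flat 0 (f x)) \<longlongrightarrow> 1) F"
proof -
  have "((\<lambda>y. exp (- 1 / y) :: real) \<longlongrightarrow> 1) at_top" by real_asymp
  moreover have "\<forall>\<^sub>F y in at_top. exp (- 1 / y) = flat 0 y"
    using eventually_gt_at_top[of 0] by eventually_elim (simp add: flat_def)
  ultimately have "(flat 0 \<longlongrightarrow> 1) at_top" by (rule Lim_transform_eventually)
  then show ?thesis using assms by (rule filterlim_compose)
qed

lemma bump_tendsto_1:
  assumes "x \<in> {a<..<b}"
  shows "(\<lambda>n. bump (real n) a b x) \<longlonglongrightarrow> 1"
proof -
  have "filterlim (\<lambda>n. real n * c) at_top sequentially" if "0 < c" for c
    using that by real_asymp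
  then have "(\<lambda>n. bump (real n) a b x) \<longlonglongrightarrow> 1 * 1"
    unfolding bump_def using assms by (intro tendsto_mult flat0_tendsto_1) auto
  then show ?thesis by simp
qed

text \<open>
  In contrast to a bump with fixed ends, the support \<open>[1/n, 1 - 1/n]\<close> is compact in the open
  interval, while these functions still tend to 1 there.
\<close>

definition cutoff :: "nat \<Rightarrow> real \<Rightarrow> real" where
  "cutoff n x = bump (real n) (1 / real n) (1 - 1 / real n) x"

lemma cutoff_tendsto_1:
  assumes "x \<in> {0<..<1}"
  shows "(\<lambda>n. cutoff n x) \<longlonglongrightarrow> 1"
proof -
  have "filterlim (\<lambda>n. real n * (x - 1 / real n)) at_top sequentially"
    "filterlim (\<lambda>n. real n * (1 - 1 / real n - x)) at_top sequentially"
    using assms by real_asymp+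
  then have "(\<lambda>n. cutoff n x) \<longlonglongrightarrow> 1 * 1"
    unfolding cutoff_def bump_def by (intro tendsto_mult flat0_tendsto_1)
  then show ?thesis by simp
qed

section \<open>Test functions\<close>

lemma test_functionI:
  assumes "smooth \<phi>" "\<And>x. x \<notin> {a..b} \<Longrightarrow> \<phi> x = 0" "{a..b} \<subseteq> \<Omega>"
  shows "test_function \<Omega> \<phi>"
proof -
  have "closure {x. \<phi> x \<noteq> 0} \<subseteq> {a..b}"
    using assms(2) by (intro closure_minimal) (blast, simp)
  then have "compact (closure {x. \<phi> x \<noteq> 0})"
    using closed_closure compact_Icc by (metis inf.absorb_iff2 compact_Int_closed)
  then show ?thesis
    using \<open>closure {x. \<phi> x \<noteq> 0} \<subseteq> {a..b}\<close> assms smooth_imp_higher_deriv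
      by (auto simp: test_function_def)
qed

text \<open>
  The values at 0 and 1 vanish because the support is contained in the open interval.
\<close>

lemma test_functionD:
  assumes "test_function {0<..<1} \<phi>"
  shows "(\<phi> has_real_derivative deriv \<phi> x) (at x within S)" "continuous_on S \<phi>" "continuous_on S
    (deriv \<phi>)"
    "\<phi> 0 = 0" "\<phi> 1 = 0"
proof -
  have d: "(\<phi> has_real_derivative deriv \<phi> x) (at x)" for x
  proof -
    have "(deriv ^^ 0) \<phi> field_differentiable at x"
      using assms unfolding test_function_def by blast
    then show ?thesis by (simp add: DERIV_deriv_iff_field_differentiable)
  qed
  then show "(\<phi> has_real_derivative deriv \<phi> x) (at x within S)"
    by (rule has_field_derivative_at_within)
  show "continuous_on S \<phi>"
    using d DERIV_continuous_on has_field_derivative_at_within by blast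
  have "deriv \<phi> field_differentiable at x" for x
  proof -
    have "(deriv ^^ 1) \<phi> field_differentiable at x"
      using assms unfolding test_function_def by blast
    then show ?thesis by simp
  qed
  then show "continuous_on S (deriv \<phi>)"
    by (meson continuous_at_imp_continuous_on field_differentiable_imp_continuous_at)
  have "x \<in> {0<..<1}" if "\<phi> x \<noteq> 0" for x
  proof -
    have "x \<in> closure {x. \<phi> x \<noteq> 0}" using that by (intro subsetD[OF closure_subset]) simp
    moreover have "closure {x. \<phi> x \<noteq> 0} \<subseteq> {0<..<1}" using assms by (simp add: test_function_def)
    ultimately show ?thesis by blast
  qed
  then show "\<phi> 0 = 0" "\<phi> 1 = 0" by force+
qed

lemma test_function_primitive_deriv:
  assumes "test_function {0<..<1} \<phi>"
  shows "integral {0..1} (deriv \<phi>) = 0" "x \<in> {0..1} \<Longrightarrow> primitive (deriv \<phi>) x = \<phi> x"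
proof -
  show *: "primitive (deriv \<phi>) x = \<phi> x" if "x \<in> {0..1}" for x
    using test_functionD[OF assms] that by (intro primitive_eqI)
  show "integral {0..1} (deriv \<phi>) = 0"
    using *[of 1] test_functionD(5)[OF assms] by (simp add: primitive_1)
qed

text \<open>
  A smooth function of mean zero supported in \<open>[a,b]\<close> is the derivative of a test function: the
  primitive vanishes to the left of \<open>a\<close> trivially and to the right of \<open>b\<close> by the mean.
\<close>

lemma test_function_primitive:
  assumes \<psi>: "smooth \<psi>" and supp: "\<And>x. x \<notin> {a..b} \<Longrightarrow> \<psi> x = 0" and ab: "0 < a" "b < 1"
    and int: "integral {0..1} \<psi> = 0"
  shows "test_function {0<..<1} (primitive \<psi>)" "deriv (primitive \<psi>) = \<psi>"
proof -
  have cont: "continuous_on S \<psi>" for S using smooth_continuous[OF \<psi>] .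
  have left: "primitive \<psi> x = 0" if "x < a" for x
  proof -
    have "integral {0..x} \<psi> = integral {0..x} (\<lambda>_. 0)" using that supp by (intro integral_cong) auto
    then show ?thesis by (simp add: primitive_def)
  qed
  have D: "(primitive \<psi> has_real_derivative \<psi> x) (at x)" for x
  proof (cases "x < a")
    case True
    have "((\<lambda>x. 0) has_real_derivative 0) (at x)" by simp
    then have "(primitive \<psi> has_real_derivative 0) (at x)"
      by (rule has_field_derivative_transform_within_open[of _ _ _ "{..<a}"]) (use True left in
        auto)
    then show ?thesis using supp[of x] True by simp
  next
    case False
    have "(primitive \<psi> has_real_derivative \<psi> x) (at x within {0..x + 1})"
      unfolding primitive_def has_real_derivative_iff_has_vector_derivative
      using False ab by (intro integral_has_vector_derivative cont) auto
    moreover have "x \<in> interior {0..x + 1}" using False ab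
      by (simp add: interior_atLeastAtMost_real)
    ultimately show ?thesis using at_within_interior by metis
  qed
  then show "deriv (primitive \<psi>) = \<psi>" using DERIV_imp_deriv by blast
  have right: "primitive \<psi> x = 0" if "b < x" for x
  proof -
    have zero: "integral {y..z} \<psi> = 0" if "b < y" for y z
    proof -
      have "integral {y..z} \<psi> = integral {y..z} (\<lambda>_. 0)" using that supp
        by (intro integral_cong) auto
      then show ?thesis by simp
    qed
    show ?thesis
    proof (cases "x \<le> 0 \<or> x < a")
      case True then show ?thesis using left[of x] ab by auto
    next
      case False
      have "integral {0..min x 1} \<psi> + integral {min x 1..x} \<psi> = integral {0..x} \<psi>"
        "integral {0..min x 1} \<psi> + integral {min x 1..1} \<psi> = integral {0..1} \<psi>"
        using False cont
        by (intro Henstock_Kurzweil_Integration.integral_combine integrable_continuous_real; simp)+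
      then show ?thesis using zero[of "min x 1"] that ab int by (simp add: primitive_def)
    qed
  qed
  show "test_function {0<..<1} (primitive \<psi>)"
    by (rule test_functionI[OF smooth_if_derivative_smooth[OF D \<psi>], of a b])
      (use left right ab in auto)
qed

section \<open>Integrals over the unit interval\<close>

abbreviation leb01 :: "real measure" where
  "leb01 \<equiv> lebesgue_on {0<..<1}"

lemma integrable_lebesgue_on_subset:
  fixes f :: "real \<Rightarrow> real"
  assumes "integrable (lebesgue_on S) f" "S \<in> sets lebesgue" "T \<in> sets lebesgue" "T \<subseteq> S"
  shows "integrable (lebesgue_on T) f"
proof -
  have "integrable lebesgue (\<lambda>x. indicator S x *\<^sub>R f x)"
    using assms by (simp add: integrable_restrict_space)
  from integrable_mult_indicator[OF assms(3) this]
  have "integrable lebesgue (\<lambda>x. indicator T x *\<^sub>R (indicator S x *\<^sub>R f x))" .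
  also have "(\<lambda>x. indicator T x *\<^sub>R (indicator S x *\<^sub>R f x)) = (\<lambda>x. indicator T x *\<^sub>R f x)"
    by (rule ext) (use assms(4) in \<open>auto simp: indicator_def\<close>)
  finally show ?thesis using assms(3) by (simp add: integrable_restrict_space)
qed

lemma integrable_unit_continuous:
  fixes f :: "real \<Rightarrow> real"
  assumes "continuous_on {0..1} f"
  shows "integrable leb01 f"
  by (rule integrable_lebesgue_on_subset[OF continuous_imp_integrable_real[OF assms]]) auto

lemma LINT_unit_continuous:
  fixes f :: "real \<Rightarrow> real"
  assumes "continuous_on {0..1} f"
  shows "(LINT x|leb01. f x) = integral {0..1} f"
  using lebesgue_integral_eq_integral[OF integrable_unit_continuous[OF assms]]
  by (simp add: integral_open_interval_real)

lemma measurable_unit_continuous: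
  fixes f :: "real \<Rightarrow> real"
  assumes "continuous_on {0..1} f"
  shows "f \<in> borel_measurable leb01"
  using integrable_unit_continuous[OF assms] by simp

lemma integrable_unit_const [simp]: "integrable leb01 (\<lambda>x. c :: real)"
  by (rule integrable_unit_continuous) simp

lemma LINT_unit_const [simp]: "(LINT x|leb01. (c :: real)) = c"
  using LINT_unit_continuous[of "\<lambda>_. c"] by simp

lemma continuous_on_unit_bounded:
  fixes f :: "real \<Rightarrow> real"
  assumes "continuous_on {0..1} f"
  obtains B where "\<And>x. x \<in> {0..1} \<Longrightarrow> \<bar>f x\<bar> \<le> B"
proof -
  have "bounded (f ` {0..1})"
    using assms by (intro compact_imp_bounded compact_continuous_image) auto
  then show ?thesis using that unfolding bounded_iff by fastforce
qed

lemma measure_unit [simp]: "measure leb01 {0<..<1} = 1"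
  using LINT_unit_const[of 1] by simp

section \<open>Uniqueness of weak derivatives\<close>

lemma Icc_subset_unit: "0 < a \<Longrightarrow> {a..1 - a} \<subseteq> {0<..<1 :: real}"
  by auto

lemma locally_integrable_measurable:
  assumes "locally_integrable {0<..<1} h"
  shows "h \<in> borel_measurable leb01"
proof (rule borel_measurable_LIMSEQ_real)
  let ?K = "\<lambda>n::nat. {1 / real (n + 2)..1 - 1 / real (n + 2)}"
  show "(\<lambda>x. indicator (?K n) x *\<^sub>R h x) \<in> borel_measurable leb01" for n
  proof -
    have "?K n \<subseteq> {0<..<1}" by (rule Icc_subset_unit) simp
    then have "h \<in> borel_measurable (lebesgue_on (?K n))"
      using assms compact_Icc unfolding locally_integrable_def by blast
    then have "(\<lambda>x. indicator (?K n) x *\<^sub>R h x) \<in> borel_measurable lebesgue"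
      by (simp add: borel_measurable_restrict_space_iff)
    then show ?thesis by (rule measurable_restrict_space1)
  qed
  fix x assume "x \<in> space leb01"
  then have x: "0 < x" "x < 1" by auto
  have "(\<lambda>n. 1 / real (n + 2)) \<longlonglongrightarrow> 0" by real_asymp
  then have "\<forall>\<^sub>F n in sequentially. 1 / real (n + 2) < min x (1 - x)"
    using x by (intro order_tendstoD(2)) auto
  then have "\<forall>\<^sub>F n in sequentially. h x = indicator (?K n) x *\<^sub>R h x"
    by eventually_elim (auto simp: indicator_def)
  then show "(\<lambda>n. indicator (?K n) x *\<^sub>R h x) \<longlonglongrightarrow> h x"
    by (rule Lim_transform_eventually[OF tendsto_const])
qed

lemma integrable_mult_continuous:
  fixes \<phi> h :: "real \<Rightarrow> real"
  assumes h: "integrable (lebesgue_on {a..b}) h" and \<phi>: "continuous_on {a..b} \<phi>"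
  shows "integrable (lebesgue_on {a..b}) (\<lambda>x. h x * \<phi> x)"
proof -
  have "bounded (\<phi> ` {a..b})" using \<phi> by (intro compact_imp_bounded compact_continuous_image) auto
  then obtain B where B: "\<forall>x\<in>{a..b}. \<bar>\<phi> x\<bar> \<le> B" by (auto simp: bounded_iff)
  have m: "\<phi> \<in> borel_measurable (lebesgue_on {a..b})"
    using continuous_imp_integrable_real[OF \<phi>] by simp
  show ?thesis
  proof (rule Bochner_Integration.integrable_bound)
    show "integrable (lebesgue_on {a..b}) (\<lambda>x. B * h x)" using h by simp
    show "(\<lambda>x. h x * \<phi> x) \<in> borel_measurable (lebesgue_on {a..b})" using h m by simp
    show "AE x in lebesgue_on {a..b}. norm (h x * \<phi> x) \<le> norm (B * h x)"
    proof (rule AE_I2)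
      fix x assume "x \<in> space (lebesgue_on {a..b})"
      then have "\<bar>\<phi> x\<bar> \<le> B" using B by simp
      then have "\<bar>\<phi> x\<bar> \<le> \<bar>B\<bar>" by simp
      then show "norm (h x * \<phi> x) \<le> norm (B * h x)"
        by (simp add: abs_mult mult.commute mult_right_mono)
    qed
  qed
qed

lemma LINT_supported:
  fixes \<phi> h :: "real \<Rightarrow> real"
  assumes h: "locally_integrable {0<..<1} h" and \<phi>: "continuous_on UNIV \<phi>"
    and supp: "\<And>x. x \<notin> {a..b} \<Longrightarrow> \<phi> x = 0" and ab: "0 < a" "b < 1"
  shows "integrable leb01 (\<lambda>x. h x * \<phi> x)"
    "(LINT x|leb01. h x * \<phi> x) = (LINT x|lebesgue_on {a..b}. h x * \<phi> x)"
proof -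
  have "{a..b} \<subseteq> {0<..<1}" using ab by auto
  then have "integrable (lebesgue_on {a..b}) h"
    using h compact_Icc unfolding locally_integrable_def by blast
  then have i: "integrable (lebesgue_on {a..b}) (\<lambda>x. h x * \<phi> x)"
    using \<phi> by (intro integrable_mult_continuous) (auto intro: continuous_on_subset)
  have eq: "(\<lambda>x. indicator {0<..<1} x * (h x * \<phi> x)) = (\<lambda>x. indicator {a..b} x * (h x * \<phi> x))"
  proof
    fix x show "indicator {0<..<1} x * (h x * \<phi> x) = indicator {a..b} x * (h x * \<phi> x)"
      using supp[of x] ab by (cases "x \<in> {a..b}") auto
  qed
  show "integrable leb01 (\<lambda>x. h x * \<phi> x)"
    using i by (simp add: integrable_restrict_space eq)
  show "(LINT x|leb01. h x * \<phi> x) = (LINT x|lebesgue_on {a..b}. h x * \<phi> x)"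
    by (simp add: integral_restrict_space eq)
qed

lemma AE_lebesgue_on_open_interval: "AE x in lebesgue_on {a..b}. x \<in> {a<..<b}" for a b :: real
proof -
  have "AE x in lebesgue. x \<noteq> a" "AE x in lebesgue. x \<noteq> b"
    by (auto intro!: AE_I'[of "{_}"])
  then have "AE x in lebesgue. x \<in> {a..b} \<longrightarrow> x \<in> {a<..<b}"
    by eventually_elim auto
  then show ?thesis by (simp add: AE_restrict_space_iff del: greaterThanLessThan_iff
    atLeastAtMost_iff)
qed

text \<open>
  From smooth functions supported in \<open>[a,b]\<close> the hypothesis passes to polynomials (multiplied by
  bumps that tend to 1), then to continuous functions by the theorem of Weierstrass, and finally
  to the sign of \<open>h\<close>, which is almost everywhere a limit of continuous functions, here truncated
  to \<open>[-1,1]\<close>.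
\<close>

lemma fundamental_lemma_interval:
  assumes h: "integrable (lebesgue_on {a..b}) h"
    and zero: "\<And>\<phi>. smooth \<phi> \<Longrightarrow> (\<And>x. x \<notin> {a..b} \<Longrightarrow> \<phi> x = 0) \<Longrightarrow> (LINT x|lebesgue_on {a..b}. h x * \<phi> x)
      = 0"
  shows "AE x in lebesgue_on {a..b}. h x = 0"
proof -
  let ?M = "lebesgue_on {a..b}"
  have poly: "(LINT x|?M. h x * P x) = 0" if "real_polynomial_function P" for P
  proof -
    have P: "smooth P" using that by (rule smooth_polynomial)
    have cP: "continuous_on S P" for S by (rule smooth_continuous[OF P])
    have "(\<lambda>n. LINT x|?M. h x * (P x * bump (real n) a b x)) \<longlonglongrightarrow> (LINT x|?M. h x * P x)"
    proof (rule integral_dominated_convergence[where w = "\<lambda>x. \<bar>h x * P x\<bar>"])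
      show "AE x in ?M. (\<lambda>n. h x * (P x * bump (real n) a b x)) \<longlonglongrightarrow> h x * P x"
        using AE_lebesgue_on_open_interval
      proof eventually_elim
        fix x assume "x \<in> {a<..<b}"
        from bump_tendsto_1[OF this]
        have "(\<lambda>n. h x * (P x * bump (real n) a b x)) \<longlonglongrightarrow> h x * (P x * 1)"
          by (intro tendsto_intros)
        then show "(\<lambda>n. h x * (P x * bump (real n) a b x)) \<longlonglongrightarrow> h x * P x" by simp
      qed
      show "AE x in ?M. norm (h x * (P x * bump (real n) a b x)) \<le> \<bar>h x * P x\<bar>" for n
        using bump_bounds[of "real n" a b]
        by (intro AE_I2) (auto simp: abs_mult mult.assoc intro!: mult_left_le mult_left_mono)
      show "integrable ?M (\<lambda>x. \<bar>h x * P x\<bar>)"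
        using integrable_mult_continuous[OF h cP] by simp
      show "(\<lambda>x. h x * P x) \<in> borel_measurable ?M"
        using integrable_mult_continuous[OF h cP] by simp
      show "(\<lambda>x. h x * (P x * bump (real n) a b x)) \<in> borel_measurable ?M" for n
        by (rule borel_measurable_integrable[OF integrable_mult_continuous[OF h
              continuous_on_mult[OF cP smooth_continuous[OF smooth_bump]]]])
    qed
    moreover have "(LINT x|?M. h x * (P x * bump (real n) a b x)) = 0" for n
      by (rule zero) (auto intro!: smooth_mult P smooth_bump simp: bump_outside)
    ultimately show ?thesis by (simp add: LIMSEQ_const_iff)
  qed
  have cont: "(LINT x|?M. h x * \<psi> x) = 0" if \<psi>: "continuous_on {a..b} \<psi>" for \<psi>
  proof -
    define J where "J = (LINT x|?M. \<bar>h x\<bar>)"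
    have J: "0 \<le> J" by (simp add: J_def)
    have "\<bar>LINT x|?M. h x * \<psi> x\<bar> \<le> 0 + e" if "0 < e" for e
    proof -
      have "0 < e / (J + 1)" using that J by simp
      then obtain P where P: "real_polynomial_function P" "\<And>x. x \<in> {a..b} \<Longrightarrow> \<bar>\<psi> x - P x\<bar> < e / (J
        + 1)"
        using Stone_Weierstrass_real_polynomial_function[OF compact_Icc \<psi>] by blast
      have cP: "continuous_on {a..b} P" by (rule smooth_continuous[OF smooth_polynomial[OF P(1)]])
      have i: "integrable ?M (\<lambda>x. h x * \<psi> x)" "integrable ?M (\<lambda>x. h x * P x)"
        using integrable_mult_continuous[OF h] \<psi> cP by auto
      have "(LINT x|?M. h x * \<psi> x) = (LINT x|?M. h x * \<psi> x - h x * P x)"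
        using i poly[OF P(1)] by simp
      also have "\<bar>\<dots>\<bar> \<le> (LINT x|?M. \<bar>h x * \<psi> x - h x * P x\<bar>)"
        by (rule integral_abs_bound)
      also have "\<dots> \<le> (LINT x|?M. \<bar>h x\<bar> * (e / (J + 1)))"
      proof (rule integral_mono)
        fix x assume "x \<in> space ?M"
        then have "\<bar>\<psi> x - P x\<bar> \<le> e / (J + 1)" using P(2)[of x] by simp
        then have "\<bar>h x\<bar> * \<bar>\<psi> x - P x\<bar> \<le> \<bar>h x\<bar> * (e / (J + 1))" by (intro mult_left_mono) auto
        then show "\<bar>h x * \<psi> x - h x * P x\<bar> \<le> \<bar>h x\<bar> * (e / (J + 1))"
          by (simp only: right_diff_distrib[symmetric] abs_mult)
      qed (use i h in auto)
      also have "\<dots> = J * (e / (J + 1))" by (simp add: J_def)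
      also have "\<dots> \<le> e" using J that by (simp add: field_simps)
      finally show ?thesis by simp
    qed
    then have "\<bar>LINT x|?M. h x * \<psi> x\<bar> \<le> 0" by (rule field_le_epsilon)
    then show ?thesis by simp
  qed
  (* Testing with the sign of h will give the integral of its absolute value. *)
  define s where "s x = (if x \<in> {a..b} then sgn (h x) else 0)" for x
  have "(\<lambda>x. indicator {a..b} x *\<^sub>R h x) \<in> borel_measurable lebesgue"
    using borel_measurable_integrable[OF h] by (simp add: borel_measurable_restrict_space_iff)
  then have "(\<lambda>x. sgn (indicator {a..b} x *\<^sub>R h x)) \<in> borel_measurable lebesgue"
    by simp
  moreover have "(\<lambda>x. sgn (indicator {a..b} x *\<^sub>R h x)) = s"
    by (auto simp: s_def)
  ultimately have "s measurable_on UNIV"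
    by (simp add: lebesgue_measurable_imp_measurable_on_real)
  then obtain N g where N: "negligible N" and g: "\<And>n::nat. continuous_on UNIV (g n)"
    and lim: "\<And>x. x \<notin> N \<Longrightarrow> (\<lambda>n. g n x) \<longlonglongrightarrow> s x"
    unfolding measurable_on_def by auto
  define \<psi> where "\<psi> n x = max (- 1) (min 1 (g n x))" for n x
  have c\<psi>: "continuous_on {a..b} (\<psi> n)" for n
    unfolding \<psi>_def using g by (auto intro!: continuous_intros intro: continuous_on_subset)
  have "(\<lambda>n. LINT x|?M. h x * \<psi> n x) \<longlonglongrightarrow> (LINT x|?M. h x * sgn (h x))"
  proof (rule integral_dominated_convergence[where w = "\<lambda>x. \<bar>h x\<bar>"])
    have "AE x in lebesgue. x \<notin> N"
      using N by (auto simp: negligible_iff_null_sets intro: AE_not_in)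
    then have "AE x in lebesgue. x \<in> {a..b} \<longrightarrow> (\<lambda>n. h x * \<psi> n x) \<longlonglongrightarrow> h x * sgn (h x)"
    proof eventually_elim
      case (elim x)
      show ?case
      proof
        assume x: "x \<in> {a..b}"
        have "(\<lambda>n. h x * \<psi> n x) \<longlonglongrightarrow> h x * max (- 1) (min 1 (s x))"
          unfolding \<psi>_def by (intro tendsto_intros lim elim)
        then show "(\<lambda>n. h x * \<psi> n x) \<longlonglongrightarrow> h x * sgn (h x)"
          using x by (auto simp: s_def sgn_if split: if_splits)
      qed
    qed
    then show "AE x in ?M. (\<lambda>n. h x * \<psi> n x) \<longlonglongrightarrow> h x * sgn (h x)"
      by (simp add: AE_restrict_space_iff)
    show "AE x in ?M. norm (h x * \<psi> n x) \<le> \<bar>h x\<bar>" for n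
    proof (rule AE_I2)
      fix x have "\<bar>\<psi> n x\<bar> \<le> 1" by (auto simp: \<psi>_def)
      then show "norm (h x * \<psi> n x) \<le> \<bar>h x\<bar>" by (simp add: abs_mult mult_left_le)
    qed
    show "(\<lambda>x. h x * \<psi> n x) \<in> borel_measurable ?M" for n
      using integrable_mult_continuous[OF h c\<psi>[of n]] by simp
  qed (use h in auto)
  then have "(LINT x|?M. h x * sgn (h x)) = 0"
    using cont[OF c\<psi>] by (simp add: LIMSEQ_const_iff)
  then have "(LINT x|?M. \<bar>h x\<bar>) = 0" by (simp add: abs_sgn)
  then have "AE x in ?M. \<bar>h x\<bar> = 0"
    using h by (subst integral_nonneg_eq_0_iff_AE[symmetric]) auto
  then show ?thesis by simp
qed

text \<open>
  Needed because \<open>weak_deriv\<close> is an unspecified choice: it transfers integrability and the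
  values of integrals from one weak derivative to another.
\<close>

lemma has_weak_deriv_unique:
  assumes g: "has_weak_deriv {0<..<1} u g" and g': "has_weak_deriv {0<..<1} u g'"
  shows "AE x in leb01. g x = g' x"
proof -
  have li: "locally_integrable {0<..<1} g" "locally_integrable {0<..<1} g'"
    using g g' by (auto simp: has_weak_deriv_def)
  have AE_I: "AE x in lebesgue. x \<in> {1 / real (n + 2)..1 - 1 / real (n + 2)} \<longrightarrow> g x - g' x = 0" for n
  proof -
    let ?a = "1 / real (n + 2)" and ?b = "1 - 1 / real (n + 2)"
    have ab: "0 < ?a" "?b < 1" by auto
    have K: "{?a..?b} \<subseteq> {0<..<1}" by (rule Icc_subset_unit[OF ab(1)])
    then have i: "integrable (lebesgue_on {?a..?b}) g" "integrable (lebesgue_on {?a..?b}) g'"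
      using li compact_Icc unfolding locally_integrable_def by blast+
    have "AE x in lebesgue_on {?a..?b}. g x - g' x = 0"
    proof (rule fundamental_lemma_interval)
      fix \<phi> :: "real \<Rightarrow> real" assume \<phi>: "smooth \<phi>" and supp: "\<And>x. x \<notin> {?a..?b} \<Longrightarrow> \<phi> x = 0"
      have t: "test_function {0<..<1} \<phi>" by (rule test_functionI[OF \<phi> supp K])
      have "(LINT x|leb01. u x * deriv \<phi> x) = - (LINT x|leb01. g x * \<phi> x)"
        "(LINT x|leb01. u x * deriv \<phi> x) = - (LINT x|leb01. g' x * \<phi> x)"
        using g g' t unfolding has_weak_deriv_def by simp_all
      then have "(LINT x|leb01. g x * \<phi> x) = (LINT x|leb01. g' x * \<phi> x)"
        by linarith
      then have "(LINT x|lebesgue_on {?a..?b}. g x * \<phi> x) = (LINT x|lebesgue_on {?a..?b}. g' x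
        * \<phi> x)"
        using LINT_supported(2)[OF li(1) smooth_continuous[OF \<phi>] supp ab]
          LINT_supported(2)[OF li(2) smooth_continuous[OF \<phi>] supp ab] by simp
      moreover have "(LINT x|lebesgue_on {?a..?b}. (g x - g' x) * \<phi> x)
          = (LINT x|lebesgue_on {?a..?b}. g x * \<phi> x) - (LINT x|lebesgue_on {?a..?b}. g' x * \<phi> x)"
        unfolding left_diff_distrib
        using integrable_mult_continuous[OF i(1) smooth_continuous[OF \<phi>]]
          integrable_mult_continuous[OF i(2) smooth_continuous[OF \<phi>]]
            by (rule Bochner_Integration.integral_diff)
      ultimately show "(LINT x|lebesgue_on {?a..?b}. (g x - g' x) * \<phi> x) = 0" by simp
    qed (use i in auto)
    then show ?thesis by (simp add: AE_restrict_space_iff)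
  qed
  have "AE x in lebesgue. \<forall>n. x \<in> {1 / real (n + 2)..1 - 1 / real (n + 2)} \<longrightarrow> g x - g' x = 0"
    by (subst AE_all_countable) (intro allI AE_I)
  then have "AE x in lebesgue. x \<in> {0<..<1} \<longrightarrow> g x = g' x"
  proof eventually_elim
    case (elim x)
    show ?case
    proof
      assume x: "x \<in> {0<..<1}"
      have "(\<lambda>n. 1 / real (n + 2)) \<longlonglongrightarrow> 0" by real_asymp
      then have "\<forall>\<^sub>F n in sequentially. 1 / real (n + 2) < min x (1 - x)"
        using x by (intro order_tendstoD(2)) auto
      from eventually_happens'[OF sequentially_bot this]
      obtain n where n: "1 / real (n + 2) < min x (1 - x)" by blast
      have "x \<in> {1 / real (n + 2)..1 - 1 / real (n + 2)}"
        unfolding atLeastAtMost_iff using n by (intro conjI) linarith+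
      then have "g x - g' x = 0" using elim by blast
      then show "g x = g' x" by simp
    qed
  qed
  then show ?thesis by (simp add: AE_restrict_space_iff)
qed

section \<open>Approximation of Sobolev functions\<close>

lemma abs_diff_powr_le:
  fixes a b r :: real
  assumes "0 \<le> r"
  shows "\<bar>a - b\<bar> powr r \<le> 2 powr r * (\<bar>a\<bar> powr r + \<bar>b\<bar> powr r)"
proof -
  have "\<bar>a - b\<bar> powr r \<le> (2 * max \<bar>a\<bar> \<bar>b\<bar>) powr r"
    using assms by (intro powr_mono2) auto
  also have "\<dots> = 2 powr r * max \<bar>a\<bar> \<bar>b\<bar> powr r" by (simp add: powr_mult)
  also have "\<dots> \<le> 2 powr r * (\<bar>a\<bar> powr r + \<bar>b\<bar> powr r)"
    by (intro mult_left_mono) (auto simp: max_def)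
  finally show ?thesis .
qed

lemma integrable_abs_diff_powr:
  fixes f g :: "real \<Rightarrow> real"
  assumes "f \<in> borel_measurable leb01" "g \<in> borel_measurable leb01" "0 \<le> r"
    and "integrable leb01 (\<lambda>x. \<bar>f x\<bar> powr r)" "integrable leb01 (\<lambda>x. \<bar>g x\<bar> powr r)"
  shows "integrable leb01 (\<lambda>x. \<bar>f x - g x\<bar> powr r)"
proof (rule Bochner_Integration.integrable_bound)
  show "integrable leb01 (\<lambda>x. 2 powr r * (\<bar>f x\<bar> powr r + \<bar>g x\<bar> powr r))"
    using assms by simp
  show "(\<lambda>x. \<bar>f x - g x\<bar> powr r) \<in> borel_measurable leb01"
    using assms by measurable
  show "AE x in leb01. norm (\<bar>f x - g x\<bar> powr r) \<le> norm (2 powr r * (\<bar>f x\<bar> powr r + \<bar>g x\<bar> powr r))"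
    using abs_diff_powr_le[OF assms(3)] by (intro AE_I2) auto
qed

text \<open>
  Convexity of the power \<open>r\<close>, applied to \<open>\<bar>b\<bar> + \<bar>a - b\<bar>\<close> as the convex combination of
  \<open>\<bar>b\<bar>/(1-\<delta>)\<close> and \<open>\<bar>a - b\<bar>/\<delta>\<close>. For small \<open>\<delta>\<close> the first coefficient is close to 1, so energies of
  approximating functions are eventually below any bound that exceeds the energy of the limit.
\<close>

lemma powr_split_le:
  fixes a b \<delta> r :: real
  assumes r: "1 < r" and \<delta>: "0 < \<delta>" "\<delta> < 1"
  shows "\<bar>a\<bar> powr r \<le> (1 - \<delta>) powr (1 - r) * \<bar>b\<bar> powr r + \<delta> powr (1 - r) * \<bar>a - b\<bar> powr r"
proof -
  define X where "X = \<bar>b\<bar> / (1 - \<delta>)"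
  define Y where "Y = \<bar>a - b\<bar> / \<delta>"
  define m where "m = (1 - \<delta>) * X + \<delta> * Y"
  have m: "m = \<bar>b\<bar> + \<bar>a - b\<bar>" using \<delta> by (simp add: m_def X_def Y_def)
  have "(1 - \<delta>) * (\<bar>m\<bar> powr r + r * spow m (r - 1) * (X - m)) \<le> (1 - \<delta>) * \<bar>X\<bar> powr r"
    "\<delta> * (\<bar>m\<bar> powr r + r * spow m (r - 1) * (Y - m)) \<le> \<delta> * \<bar>Y\<bar> powr r"
    using powr_abs_tangent[OF r, of m] \<delta> by (intro mult_left_mono; simp)+
  moreover have "(1 - \<delta>) * (\<bar>m\<bar> powr r + r * spow m (r - 1) * (X - m))
      + \<delta> * (\<bar>m\<bar> powr r + r * spow m (r - 1) * (Y - m))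
      = \<bar>m\<bar> powr r + r * spow m (r - 1) * ((1 - \<delta>) * X + \<delta> * Y - m)"
    by (simp add: algebra_simps)
  ultimately have "\<bar>m\<bar> powr r \<le> (1 - \<delta>) * \<bar>X\<bar> powr r + \<delta> * \<bar>Y\<bar> powr r"
    by (simp add: m_def[symmetric])
  moreover have "\<bar>a\<bar> powr r \<le> \<bar>m\<bar> powr r" using r m by (intro powr_mono2) auto
  moreover have "e * (t / e) powr r = e powr (1 - r) * t powr r" if "0 < e" "0 \<le> t" for e t
    using that by (simp add: powr_divide powr_diff)
  then have "(1 - \<delta>) * \<bar>X\<bar> powr r = (1 - \<delta>) powr (1 - r) * \<bar>b\<bar> powr r"
    "\<delta> * \<bar>Y\<bar> powr r = \<delta> powr (1 - r) * \<bar>a - b\<bar> powr r"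
    using \<delta> by (simp_all add: X_def Y_def abs_divide)
  ultimately show ?thesis by linarith
qed

text \<open>
  On a space of measure one, from \<open>\<bar>t\<bar> \<le> e + e\<^bsup>1-r\<^esup> \<bar>t\<bar>\<^sup>r\<close>.
\<close>

lemma L1_tendsto_0_if_Lr:
  fixes f :: "nat \<Rightarrow> real \<Rightarrow> real"
  assumes r: "1 < r" and f: "\<And>n. f n \<in> borel_measurable leb01"
    and int: "\<And>n. integrable leb01 (\<lambda>x. \<bar>f n x\<bar> powr r)"
    and lim: "(\<lambda>n. LINT x|leb01. \<bar>f n x\<bar> powr r) \<longlonglongrightarrow> 0"
  shows "\<And>n. integrable leb01 (f n)" "(\<lambda>n. LINT x|leb01. \<bar>f n x\<bar>) \<longlonglongrightarrow> 0"
proof -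
  have le: "\<bar>t\<bar> \<le> e + e powr (1 - r) * \<bar>t\<bar> powr r" if "0 < e" for e t :: real
  proof (cases "\<bar>t\<bar> \<le> e")
    case False
    have "\<bar>t\<bar> = \<bar>t\<bar> powr (1 - r) * \<bar>t\<bar> powr r"
      using False that by (simp add: powr_add[symmetric])
    also have "\<dots> \<le> e powr (1 - r) * \<bar>t\<bar> powr r"
      using False that r by (intro mult_right_mono powr_mono2') auto
    finally show ?thesis using that by simp
  next
    case True
    then show ?thesis by (simp add: add_increasing2)
  qed
  show i: "integrable leb01 (f n)" for n
  proof (rule Bochner_Integration.integrable_bound)
    show "integrable leb01 (\<lambda>x. 1 + 1 * \<bar>f n x\<bar> powr r)" using int[of n] by simp
    show "AE x in leb01. norm (f n x) \<le> norm (1 + 1 * \<bar>f n x\<bar> powr r)"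
      using le[of 1] by (intro AE_I2) simp
  qed (rule f)
  show "(\<lambda>n. LINT x|leb01. \<bar>f n x\<bar>) \<longlonglongrightarrow> 0"
  proof (rule LIMSEQ_I)
    fix d :: real assume d: "0 < d"
    define e where "e = d / 2"
    have e: "0 < e" using d by (simp add: e_def)
    have bound: "(LINT x|leb01. \<bar>f n x\<bar>) \<le> e + e powr (1 - r) * (LINT x|leb01. \<bar>f n x\<bar> powr r)"
      for n
    proof -
      have "(LINT x|leb01. \<bar>f n x\<bar>) \<le> (LINT x|leb01. e + e powr (1 - r) * \<bar>f n x\<bar> powr r)"
        using i int le[OF e] by (intro integral_mono) auto
      also have "\<dots> = e + e powr (1 - r) * (LINT x|leb01. \<bar>f n x\<bar> powr r)"
        using int by (subst Bochner_Integration.integral_add) auto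
      finally show ?thesis .
    qed
    have "(\<lambda>n. e + e powr (1 - r) * (LINT x|leb01. \<bar>f n x\<bar> powr r)) \<longlonglongrightarrow> e + e powr (1 - r) * 0"
      by (intro tendsto_intros lim)
    moreover have "e + e powr (1 - r) * 0 < d" using d by (simp add: e_def)
    ultimately have "\<forall>\<^sub>F n in sequentially. e + e powr (1 - r) * (LINT x|leb01. \<bar>f n x\<bar> powr r) < d"
      by (rule order_tendstoD(2))
    then show "\<exists>no. \<forall>n\<ge>no. norm ((LINT x|leb01. \<bar>f n x\<bar>) - 0) < d"
      using bound by (auto simp: eventually_sequentially intro: le_less_trans)
  qed
qed

lemma has_weak_deriv_weak_deriv:
  "has_weak_deriv \<Omega> u g \<Longrightarrow> has_weak_deriv \<Omega> u (weak_deriv \<Omega> u)"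
  unfolding weak_deriv_def by (rule someI[of "has_weak_deriv \<Omega> u"])

abbreviation energy :: "real \<Rightarrow> (real \<Rightarrow> real) \<Rightarrow> real" where
  "energy r u \<equiv> (LINT x|leb01. \<bar>weak_deriv {0<..<1} u x\<bar> powr r)"

text \<open>
  The Sobolev space provides some weak derivative in \<open>Lspace\<close>; by uniqueness \<open>weak_deriv\<close> agrees
  with it almost everywhere.
\<close>

lemma W10_D:
  assumes u: "u \<in> W10 {0<..<1} r" and r: "1 < r"
  defines "D \<equiv> weak_deriv {0<..<1} u"
  shows "u \<in> borel_measurable leb01" "integrable leb01 (\<lambda>x. \<bar>u x\<bar> powr r)"
    "D \<in> borel_measurable leb01" "integrable leb01 (\<lambda>x. \<bar>D x\<bar> powr r)"
proof -
  from u obtain g where L: "u \<in> Lspace {0<..<1} r"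
    and g: "g \<in> Lspace {0<..<1} r" "has_weak_deriv {0<..<1} u g"
    by (auto simp: W10_def W1_def)
  have D: "has_weak_deriv {0<..<1} u D"
    unfolding D_def by (rule has_weak_deriv_weak_deriv[OF g(2)])
  show "u \<in> borel_measurable leb01" "integrable leb01 (\<lambda>x. \<bar>u x\<bar> powr r)"
    using L by (auto simp: Lspace_def)
  show m: "D \<in> borel_measurable leb01"
    using D by (intro locally_integrable_measurable) (simp add: has_weak_deriv_def)
  have gm: "g \<in> borel_measurable leb01" "integrable leb01 (\<lambda>x. \<bar>g x\<bar> powr r)"
    using g(1) by (auto simp: Lspace_def)
  have "AE x in leb01. \<bar>g x\<bar> powr r = \<bar>D x\<bar> powr r"
    using has_weak_deriv_unique[OF g(2) D] by eventually_elim simp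
  moreover have "(\<lambda>x. \<bar>D x\<bar> powr r) \<in> borel_measurable leb01" using m by measurable
  ultimately show "integrable leb01 (\<lambda>x. \<bar>D x\<bar> powr r)"
    using integrable_cong_AE_imp[OF gm(2)] by blast
qed

text \<open>
  The sequence from the definition of the space, thinned out twice: far enough for the energies
  to be below \<open>A\<close>, and to a subsequence that converges almost everywhere.
\<close>

lemma W10_approximation:
  assumes u: "u \<in> W10 {0<..<1} r" and r: "1 < r"
    and A: "energy r u < A"
  obtains \<phi> where "\<And>n::nat. test_function {0<..<1} (\<phi> n)"
    "\<And>n. integral {0..1} (\<lambda>x. \<bar>deriv (\<phi> n) x\<bar> powr r) \<le> A"
    "AE x in leb01. (\<lambda>n. \<phi> n x) \<longlonglongrightarrow> u x"
    "(\<lambda>n. LINT x|leb01. \<bar>deriv (\<phi> n) x - weak_deriv {0<..<1} u x\<bar>) \<longlonglongrightarrow> 0"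
    "\<And>n. integrable leb01 (\<lambda>x. deriv (\<phi> n) x - weak_deriv {0<..<1} u x)"
proof -
  define D where "D = weak_deriv {0<..<1} u"
  have A: "(LINT x|leb01. \<bar>D x\<bar> powr r) < A" using A by (simp add: D_def)
  note props = W10_D[OF u r, folded D_def]
  obtain \<phi> where test: "\<And>n::nat. test_function {0<..<1} (\<phi> n)"
    and lim: "(\<lambda>n. LINT x|leb01. \<bar>\<phi> n x - u x\<bar> powr r) \<longlonglongrightarrow> 0"
    and limD: "(\<lambda>n. LINT x|leb01. \<bar>deriv (\<phi> n) x - D x\<bar> powr r) \<longlonglongrightarrow> 0"
    using u by (auto simp: W10_def D_def)
  have cont: "continuous_on {0..1} (\<phi> n)" "continuous_on {0..1} (deriv (\<phi> n))" for n
    using test_functionD[OF test] by blast+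
  have contr: "continuous_on {0..1} (\<lambda>x. \<bar>\<phi> n x\<bar> powr r)" "continuous_on {0..1} (\<lambda>x. \<bar>deriv (\<phi> n)
    x\<bar> powr r)" for n
    using cont r by (auto intro!: continuous_on_abs_powr)
  have i: "integrable leb01 (\<lambda>x. \<bar>\<phi> n x - u x\<bar> powr r)"
    "integrable leb01 (\<lambda>x. \<bar>deriv (\<phi> n) x - D x\<bar> powr r)" for n
    using r integrable_abs_diff_powr[OF measurable_unit_continuous[OF cont(1)] props(1) _
        integrable_unit_continuous[OF contr(1)] props(2)]
      integrable_abs_diff_powr[OF measurable_unit_continuous[OF cont(2)] props(3) _
        integrable_unit_continuous[OF contr(2)] props(4)] by simp_all
  have mD: "(\<lambda>x. deriv (\<phi> n) x - D x) \<in> borel_measurable leb01" for n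
    using props(3) measurable_unit_continuous[OF cont(2)] by simp
  have iD: "integrable leb01 (\<lambda>x. deriv (\<phi> n) x - D x)" for n
    using L1_tendsto_0_if_Lr(1)[OF r mD i(2) limD] .
  have L1: "(\<lambda>n. LINT x|leb01. \<bar>deriv (\<phi> n) x - D x\<bar>) \<longlonglongrightarrow> 0"
    using L1_tendsto_0_if_Lr(2)[OF r mD i(2) limD] .
  define E where "E = (LINT x|leb01. \<bar>D x\<bar> powr r)"
  have "\<forall>\<^sub>F n in sequentially. integral {0..1} (\<lambda>x. \<bar>deriv (\<phi> n) x\<bar> powr r) \<le> A"
  proof -
    have "((\<lambda>\<delta>. (1 - \<delta>) powr (1 - r) * E) \<longlongrightarrow> (1 - 0) powr (1 - r) * E) (at_right 0)"
      by (intro tendsto_intros) auto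
    then have "\<forall>\<^sub>F \<delta> in at_right 0. (1 - \<delta>) powr (1 - r) * E < A"
      using A by (intro order_tendstoD(2)) (auto simp: E_def)
    moreover have "\<forall>\<^sub>F \<delta> in at_right 0. \<delta> \<in> {0<..<1::real}"
      by (rule eventually_at_right_real) simp
    ultimately have "\<forall>\<^sub>F \<delta> in at_right 0. (1 - \<delta>) powr (1 - r) * E < A \<and> \<delta> \<in> {0<..<1::real}"
      by eventually_elim simp
    then obtain \<delta> where \<delta>: "(1 - \<delta>) powr (1 - r) * E < A" "0 < \<delta>" "\<delta> < 1"
      using eventually_happens'[OF trivial_limit_at_right_real] by force
    have "(\<lambda>n. (1 - \<delta>) powr (1 - r) * E + \<delta> powr (1 - r) * (LINT x|leb01. \<bar>deriv (\<phi> n) x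
      - D x\<bar> powr r))
        \<longlonglongrightarrow> (1 - \<delta>) powr (1 - r) * E + \<delta> powr (1 - r) * 0"
      by (intro tendsto_intros limD)
    then have "\<forall>\<^sub>F n in sequentially. (1 - \<delta>) powr (1 - r) * E
        + \<delta> powr (1 - r) * (LINT x|leb01. \<bar>deriv (\<phi> n) x - D x\<bar> powr r) < A"
      using \<delta>(1) by (intro order_tendstoD(2)) auto
    then show ?thesis
    proof eventually_elim
      case (elim n)
      have "integral {0..1} (\<lambda>x. \<bar>deriv (\<phi> n) x\<bar> powr r) = (LINT x|leb01. \<bar>deriv (\<phi> n) x\<bar> powr r)"
        using LINT_unit_continuous[OF contr(2)] by simp
      also have "\<dots> \<le> (LINT x|leb01. (1 - \<delta>) powr (1 - r) * \<bar>D x\<bar> powr r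
          + \<delta> powr (1 - r) * \<bar>deriv (\<phi> n) x - D x\<bar> powr r)"
        using powr_split_le[OF r \<delta>(2,3)] props(4) i(2) integrable_unit_continuous[OF contr(2)]
        by (intro integral_mono) auto
      also have "\<dots> = (1 - \<delta>) powr (1 - r) * E + \<delta> powr (1 - r) * (LINT x|leb01. \<bar>deriv (\<phi> n) x
        - D x\<bar> powr r)"
        using props(4) i(2) by (subst Bochner_Integration.integral_add) (auto simp: E_def)
      finally show ?case using elim by simp
    qed
  qed
  then obtain N where N: "\<And>n. N \<le> n \<Longrightarrow> integral {0..1} (\<lambda>x. \<bar>deriv (\<phi> n) x\<bar> powr r) \<le> A"
    by (auto simp: eventually_sequentially)
  have "(\<lambda>n. LINT x|leb01. norm (\<bar>\<phi> (n + N) x - u x\<bar> powr r)) \<longlonglongrightarrow> 0"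
    using LIMSEQ_ignore_initial_segment[OF lim, of N] by simp
  from tendsto_L1_AE_subseq[OF i(1) this]
  obtain s where s: "strict_mono s" and AE: "AE x in leb01. (\<lambda>n. \<bar>\<phi> (s n + N) x - u x\<bar> powr r) \<longlonglongrightarrow> 0"
    by auto
  have sN: "strict_mono (\<lambda>n. s n + N)" using s by (auto simp: strict_mono_def)
  have "AE x in leb01. (\<lambda>n. \<phi> (s n + N) x) \<longlonglongrightarrow> u x"
    using AE
  proof eventually_elim
    case (elim x)
    have "(\<lambda>n. (\<bar>\<phi> (s n + N) x - u x\<bar> powr r) powr (1 / r)) \<longlonglongrightarrow> 0 powr (1 / r)"
      using r by (intro tendsto_powr' elim tendsto_const) auto
    then have "(\<lambda>n. \<bar>\<phi> (s n + N) x - u x\<bar>) \<longlonglongrightarrow> 0"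
      using r by (simp add: powr_powr)
    then show ?case
      by (simp add: tendsto_rabs_zero_iff LIM_zero_iff)
  qed
  moreover have "(\<lambda>n. LINT x|leb01. \<bar>deriv (\<phi> (s n + N)) x - D x\<bar>) \<longlonglongrightarrow> 0"
    using LIMSEQ_subseq_LIMSEQ[OF L1 sN] by (simp add: o_def)
  ultimately show ?thesis
    using that[of "\<lambda>n. \<phi> (s n + N)"] test N iD unfolding D_def by simp
qed

lemma test_function_bound:
  assumes \<phi>: "test_function {0<..<1} \<phi>" and A: "integral {0..1} (\<lambda>x. \<bar>deriv \<phi> x\<bar> powr r) \<le> A"
    and r: "1 < r" and x: "x \<in> {0..1}"
  shows "\<bar>\<phi> x\<bar> \<le> A + 1"
proof -
  have c: "continuous_on {0..1} (deriv \<phi>)" using test_functionD[OF \<phi>] by blast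
  have "0 \<le> integral {0..1} (\<lambda>x. \<bar>deriv \<phi> x\<bar> powr r)"
    using c r by (intro integral_nonneg integrable_continuous_real continuous_on_abs_powr) auto
  then have A0: "0 \<le> A" using A by simp
  have "\<bar>\<phi> x\<bar> \<le> integral {0..1} (\<lambda>x. \<bar>deriv \<phi> x\<bar> powr r) / r + (1 - 1 / r)"
    using abs_primitive_le[OF c x] integral_abs_le[OF c r] test_function_primitive_deriv(2)[OF \<phi>
      x] by simp
  also have "\<dots> \<le> A / r + (1 - 1 / r)"
    using A r by (intro add_right_mono divide_right_mono) auto
  also have "\<dots> \<le> A / 1 + 1"
    using A0 r by (intro add_mono divide_left_mono) auto
  finally show ?thesis by simp
qed

text \<open>
  Test functions with bounded energies are uniformly bounded, so dominated convergence applies.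
  Strict upper bounds \<open>A\<close>, \<open>B\<close> instead of the energies themselves avoid any discussion of zero
  energies.
\<close>

lemma (in exponents) coupling_bound_W10:
  assumes \<Lambda>: "coupling_bound \<Lambda>" and u: "u \<in> W10 {0<..<1} p" and v: "v \<in> W10 {0<..<1} q"
    and A: "energy p u < A"
    and B: "energy q v < B"
  shows "integrable leb01 (\<lambda>x. abs_pow (u x) \<alpha> * abs_pow (v x) \<beta>)"
    "(LINT x|leb01. abs_pow (u x) \<alpha> * abs_pow (v x) \<beta>) \<le> \<Lambda> * A powr (\<alpha> / p) * B powr (\<beta> / q)"
proof -
  have "0 \<le> energy p u"
    "0 \<le> energy q v" by simp_all
  then have A0: "0 < A" and B0: "0 < B" using A B by linarith+
  obtain \<phi> where \<phi>: "\<And>n::nat. test_function {0<..<1} (\<phi> n)"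
    "\<And>n. integral {0..1} (\<lambda>x. \<bar>deriv (\<phi> n) x\<bar> powr p) \<le> A" "AE x in leb01. (\<lambda>n. \<phi> n x) \<longlonglongrightarrow> u x"
    by (rule W10_approximation[OF u p A]) (rule that)
  obtain \<psi> where \<psi>: "\<And>n::nat. test_function {0<..<1} (\<psi> n)"
    "\<And>n. integral {0..1} (\<lambda>x. \<bar>deriv (\<psi> n) x\<bar> powr q) \<le> B" "AE x in leb01. (\<lambda>n. \<psi> n x) \<longlonglongrightarrow> v x"
    by (rule W10_approximation[OF v q B]) (rule that)
  have c: "continuous_on {0..1} (\<phi> n)" "continuous_on {0..1} (\<psi> n)"
    "continuous_on {0..1} (deriv (\<phi> n))" "continuous_on {0..1} (deriv (\<psi> n))" for n
    using test_functionD[OF \<phi>(1)] test_functionD[OF \<psi>(1)] by blast+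
  define K where "K n x = abs_pow (\<phi> n x) \<alpha> * abs_pow (\<psi> n x) \<beta>" for n x
  define L where "L x = abs_pow (u x) \<alpha> * abs_pow (v x) \<beta>" for x
  have cK: "continuous_on {0..1} (K n)" for n
    unfolding K_def using c \<alpha>_nonneg \<beta>_nonneg by (intro continuous_intros)
  have lim: "AE x in leb01. (\<lambda>n. K n x) \<longlonglongrightarrow> L x"
    using \<phi>(3) \<psi>(3)
  proof eventually_elim
    case (elim x)
    then show ?case
      unfolding K_def L_def by (intro tendsto_mult tendsto_abs_pow \<alpha>_nonneg \<beta>_nonneg)
  qed
  have bound: "AE x in leb01. norm (K n x) \<le> abs_pow (A + 1) \<alpha> * abs_pow (B + 1) \<beta>" for n
  proof (rule AE_I2)
    fix x assume "x \<in> space leb01"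
    then have "\<bar>\<phi> n x\<bar> \<le> A + 1" "\<bar>\<psi> n x\<bar> \<le> B + 1"
      using test_function_bound[OF \<phi>(1,2) p, of x] test_function_bound[OF \<psi>(1,2) q, of x] by auto
    then show "norm (K n x) \<le> abs_pow (A + 1) \<alpha> * abs_pow (B + 1) \<beta>"
      unfolding K_def using \<alpha>_nonneg \<beta>_nonneg by (auto intro!: mult_mono abs_pow_mono)
  qed
  have mL: "L \<in> borel_measurable leb01"
  proof -
    have m: "(\<lambda>x. abs_pow (w x) a) \<in> borel_measurable leb01"
      if "w \<in> borel_measurable leb01" for w a
      unfolding abs_pow_def using that by (cases "a = 0") auto
    show ?thesis
      unfolding L_def[abs_def]
      using m[OF W10_D(1)[OF u p]] m[OF W10_D(1)[OF v q]] by (rule borel_measurable_times)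
  qed
  note dct = integral_dominated_convergence[OF mL measurable_unit_continuous[OF cK]
    integrable_unit_const lim bound]
    integrable_dominated_convergence[OF mL measurable_unit_continuous[OF cK]
      integrable_unit_const lim bound]
  show "integrable leb01 (\<lambda>x. abs_pow (u x) \<alpha> * abs_pow (v x) \<beta>)"
    using dct(2) by (simp add: L_def)
  have "(LINT x|leb01. K n x) \<le> \<Lambda> * A powr (\<alpha> / p) * B powr (\<beta> / q)" for n
  proof -
    have "(LINT x|leb01. K n x) = integral {0..1} (K n)"
      by (rule LINT_unit_continuous[OF cK])
    also have "\<dots> = coupling \<alpha> \<beta> (deriv (\<phi> n)) (deriv (\<psi> n))"
      unfolding coupling_def K_def
      by (intro integral_cong)
        (simp add: test_function_primitive_deriv(2)[OF \<phi>(1)] test_function_primitive_deriv(2)[OF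
          \<psi>(1)])
    also have "\<dots> \<le> \<Lambda> * A powr (\<alpha> / p) * B powr (\<beta> / q)"
      using c A0 B0 \<phi>(2) \<psi>(2) test_function_primitive_deriv(1)[OF \<phi>(1)]
        test_function_primitive_deriv(1)[OF \<psi>(1)]
      by (intro coupling_bound_general \<Lambda>) auto
    finally show ?thesis .
  qed
  then have "(LINT x|leb01. L x) \<le> \<Lambda> * A powr (\<alpha> / p) * B powr (\<beta> / q)"
    using dct(1) by (intro LIMSEQ_le_const2) auto
  then show "(LINT x|leb01. abs_pow (u x) \<alpha> * abs_pow (v x) \<beta>) \<le> \<Lambda> * A powr (\<alpha> / p)
    * B powr (\<beta> / q)"
    by (simp add: L_def)
qed

text \<open>
  True for test functions by partial integration. In the limit, the left side converges since
  \<open>c - primitive f\<close> is bounded and the derivatives converge in mean, the right side by dominated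
  convergence.
\<close>

lemma integral_mult_W10:
  assumes f: "continuous_on {0..1} f" and u: "u \<in> W10 {0<..<1} r" and r: "1 < r"
  shows "(LINT x|leb01. (c - primitive f x) * weak_deriv {0<..<1} u x)
    = (LINT x|leb01. f x * u x)"
proof -
  define D where "D = weak_deriv {0<..<1} u"
  define A where "A = (LINT x|leb01. \<bar>D x\<bar> powr r) + 1"
  have "(LINT x|leb01. \<bar>D x\<bar> powr r) < A" by (simp add: A_def)
  then obtain \<phi> where test: "\<And>n::nat. test_function {0<..<1} (\<phi> n)"
    and bA: "\<And>n. integral {0..1} (\<lambda>x. \<bar>deriv (\<phi> n) x\<bar> powr r) \<le> A"
    and AE: "AE x in leb01. (\<lambda>n. \<phi> n x) \<longlonglongrightarrow> u x"
    and L1: "(\<lambda>n. LINT x|leb01. \<bar>deriv (\<phi> n) x - D x\<bar>) \<longlonglongrightarrow> 0"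
    and i: "\<And>n. integrable leb01 (\<lambda>x. deriv (\<phi> n) x - D x)"
    by (rule W10_approximation[OF u r, folded D_def]) (rule that)
  have c: "continuous_on {0..1} (\<phi> n)" "continuous_on {0..1} (deriv (\<phi> n))" for n
    using test_functionD[OF test] by blast+
  define N where "N x = c - primitive f x" for x
  have cN: "continuous_on {0..1} N"
    unfolding N_def using f by (intro continuous_intros continuous_on_primitive)
  obtain B where B: "\<And>x. x \<in> {0..1} \<Longrightarrow> \<bar>N x\<bar> \<le> B"
    by (rule continuous_on_unit_bounded[OF cN]) (rule that)
  obtain B' where B': "\<And>x. x \<in> {0..1} \<Longrightarrow> \<bar>f x\<bar> \<le> B'"
    by (rule continuous_on_unit_bounded[OF f]) (rule that)
  note mN = measurable_unit_continuous[OF cN]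
  have mD: "D \<in> borel_measurable leb01" using W10_D(3)[OF u r] by (simp add: D_def)
  have iNd: "integrable leb01 (\<lambda>x. N x * (deriv (\<phi> n) x - D x))" for n
  proof (rule Bochner_Integration.integrable_bound)
    show "integrable leb01 (\<lambda>x. B * (deriv (\<phi> n) x - D x))" using i by simp
    show "(\<lambda>x. N x * (deriv (\<phi> n) x - D x)) \<in> borel_measurable leb01"
      using mN borel_measurable_integrable[OF i] by (rule borel_measurable_times)
    show "AE x in leb01. norm (N x * (deriv (\<phi> n) x - D x)) \<le> norm (B * (deriv (\<phi> n) x - D x))"
    proof (rule AE_I2)
      fix x assume "x \<in> space leb01"
      then have "\<bar>N x\<bar> \<le> \<bar>B\<bar>" using B[of x] by simp
      then show "norm (N x * (deriv (\<phi> n) x - D x)) \<le> norm (B * (deriv (\<phi> n) x - D x))"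
        by (simp add: abs_mult mult_right_mono)
    qed
  qed
  have iN: "integrable leb01 (\<lambda>x. N x * deriv (\<phi> n) x)" for n
    using cN c by (intro integrable_unit_continuous continuous_intros)
  have iND: "integrable leb01 (\<lambda>x. N x * D x)"
  proof -
    have "integrable leb01 (\<lambda>x. N x * deriv (\<phi> 0) x - N x * (deriv (\<phi> 0) x - D x))"
      by (intro Bochner_Integration.integrable_diff iN iNd)
    then show ?thesis by (simp add: algebra_simps)
  qed
  have "(\<lambda>n. (LINT x|leb01. N x * deriv (\<phi> n) x) - (LINT x|leb01. N x * D x)) \<longlonglongrightarrow> 0"
  proof (rule Lim_null_comparison)
    show "\<forall>\<^sub>F n in sequentially. norm ((LINT x|leb01. N x * deriv (\<phi> n) x) - (LINT x|leb01. N x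
      * D x))
        \<le> B * (LINT x|leb01. \<bar>deriv (\<phi> n) x - D x\<bar>)"
    proof (intro always_eventually allI)
      fix n
      have "(LINT x|leb01. N x * deriv (\<phi> n) x) - (LINT x|leb01. N x * D x)
          = (LINT x|leb01. N x * (deriv (\<phi> n) x - D x))"
        using iN[of n] iND by (simp add: right_diff_distrib)
      also have "norm \<dots> \<le> (LINT x|leb01. \<bar>N x * (deriv (\<phi> n) x - D x)\<bar>)"
        using integral_abs_bound by simp
      also have "\<dots> \<le> (LINT x|leb01. B * \<bar>deriv (\<phi> n) x - D x\<bar>)"
      proof (rule integral_mono)
        show "integrable leb01 (\<lambda>x. \<bar>N x * (deriv (\<phi> n) x - D x)\<bar>)"
          using iNd by (rule integrable_abs)
        show "\<bar>N x * (deriv (\<phi> n) x - D x)\<bar> \<le> B * \<bar>deriv (\<phi> n) x - D x\<bar>"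
          if "x \<in> space leb01" for x
          unfolding abs_mult using B[of x] that by (intro mult_right_mono) auto
      qed (use i in auto)
      finally show "norm ((LINT x|leb01. N x * deriv (\<phi> n) x) - (LINT x|leb01. N x * D x))
        \<le> B * (LINT x|leb01. \<bar>deriv (\<phi> n) x - D x\<bar>)" by simp
    qed
    show "(\<lambda>n. B * (LINT x|leb01. \<bar>deriv (\<phi> n) x - D x\<bar>)) \<longlonglongrightarrow> 0"
      using tendsto_mult[OF tendsto_const L1, of B] by simp
  qed
  then have lim1: "(\<lambda>n. LINT x|leb01. N x * deriv (\<phi> n) x) \<longlonglongrightarrow> (LINT x|leb01. N x * D x)"
    by (simp add: LIM_zero_iff)
  have lim2: "(\<lambda>n. LINT x|leb01. f x * \<phi> n x) \<longlonglongrightarrow> (LINT x|leb01. f x * u x)"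
  proof (rule integral_dominated_convergence[where w = "\<lambda>_. B' * (A + 1)"])
    show "(\<lambda>x. f x * u x) \<in> borel_measurable leb01"
      using measurable_unit_continuous[OF f] W10_D(1)[OF u r] by (rule borel_measurable_times)
    show "(\<lambda>x. f x * \<phi> n x) \<in> borel_measurable leb01" for n
      using f c by (intro measurable_unit_continuous continuous_intros)
    show "AE x in leb01. (\<lambda>n. f x * \<phi> n x) \<longlonglongrightarrow> f x * u x"
      using AE by eventually_elim (intro tendsto_intros)
    show "AE x in leb01. norm (f x * \<phi> n x) \<le> B' * (A + 1)" for n
    proof (rule AE_I2)
      fix x assume "x \<in> space leb01"
      then have "\<bar>f x\<bar> \<le> B'" "\<bar>\<phi> n x\<bar> \<le> A + 1"
        using B'[of x] test_function_bound[OF test bA r, of x] by auto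
      then show "norm (f x * \<phi> n x) \<le> B' * (A + 1)"
        unfolding real_norm_def abs_mult by (intro mult_mono) auto
    qed
  qed simp
  have "(LINT x|leb01. N x * deriv (\<phi> n) x) = (LINT x|leb01. f x * \<phi> n x)" for n
  proof -
    have "(LINT x|leb01. f x * \<phi> n x) = integral {0..1} (\<lambda>x. f x * \<phi> n x)"
      using f c by (intro LINT_unit_continuous continuous_intros)
    also have "\<dots> = integral {0..1} (\<lambda>x. f x * primitive (deriv (\<phi> n)) x)"
      by (intro integral_cong) (simp add: test_function_primitive_deriv(2)[OF test])
    also have "\<dots> = integral {0..1} (\<lambda>x. N x * deriv (\<phi> n) x)"
      unfolding N_def by (rule integral_mult_primitive[OF f c(2)
        test_function_primitive_deriv(1)[OF test]])
    also have "\<dots> = (LINT x|leb01. N x * deriv (\<phi> n) x)"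
      using cN c by (intro LINT_unit_continuous[symmetric] continuous_intros)
    finally show ?thesis ..
  qed
  then have "(LINT x|leb01. N x * D x) = (LINT x|leb01. f x * u x)"
    using lim1 lim2 LIMSEQ_unique by simp
  then show ?thesis by (simp add: N_def D_def)
qed

section \<open>Primitives of continuous functions as Sobolev functions\<close>

lemma has_weak_deriv_primitive:
  assumes g: "continuous_on {0..1} g"
  shows "has_weak_deriv {0<..<1} (primitive g) g"
proof -
  have cw: "continuous_on {0..1} (primitive g)" by (rule continuous_on_primitive[OF g])
  have li: "locally_integrable {0<..<1} f" if "continuous_on {0..1} f" for f :: "real \<Rightarrow> real"
    unfolding locally_integrable_def
  proof (intro allI impI)
    fix K :: "real set" assume K: "compact K \<and> K \<subseteq> {0<..<1}"
    then have "K \<in> sets lebesgue" by (intro fmeasurableD lmeasurable_compact) simp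
    moreover have "K \<subseteq> {0..1}" using K by auto
    ultimately show "integrable (lebesgue_on K) f"
      using integrable_lebesgue_on_subset[OF continuous_imp_integrable_real[OF that]] by simp
  qed
  have "(LINT x|leb01. primitive g x * deriv \<phi> x) = - (LINT x|leb01. g x * \<phi> x)"
    if \<phi>: "test_function {0<..<1} \<phi>" for \<phi>
  proof -
    have c: "continuous_on {0..1} \<phi>" "continuous_on {0..1} (deriv \<phi>)"
      using test_functionD[OF \<phi>] by blast+
    have "(LINT x|leb01. primitive g x * deriv \<phi> x) = integral {0..1} (\<lambda>x. primitive g x
      * deriv \<phi> x)"
      using cw c by (intro LINT_unit_continuous continuous_intros)
    also have "\<dots> = primitive g 1 * \<phi> 1 - primitive g 0 * \<phi> 0 - integral {0..1} (\<lambda>x. g x * \<phi> x)"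
      using g c by (intro integral_by_parts primitive_has_derivative test_functionD(1)[OF \<phi>]) auto
    also have "\<dots> = - integral {0..1} (\<lambda>x. g x * \<phi> x)"
      using test_functionD(4,5)[OF \<phi>] by simp
    also have "integral {0..1} (\<lambda>x. g x * \<phi> x) = (LINT x|leb01. g x * \<phi> x)"
      using g c by (intro LINT_unit_continuous[symmetric] continuous_intros)
    finally show ?thesis .
  qed
  then show ?thesis using li[OF cw] li[OF g] by (simp add: has_weak_deriv_def)
qed

lemma weak_deriv_primitive:
  assumes "continuous_on {0..1} g"
  shows "AE x in leb01. weak_deriv {0<..<1} (primitive g) x = g x"
  using has_weak_deriv_unique[OF has_weak_deriv_weak_deriv] has_weak_deriv_primitive[OF assms]
    by blast

lemma measurable_weak_deriv_primitive:
  assumes "continuous_on {0..1} g"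
  shows "weak_deriv {0<..<1} (primitive g) \<in> borel_measurable leb01"
  using has_weak_deriv_weak_deriv[OF has_weak_deriv_primitive[OF assms]]
  by (intro locally_integrable_measurable) (simp add: has_weak_deriv_def)

text \<open>
  A polynomial approximating \<open>g\<close> is multiplied by a cut-off, and its mean is removed by
  subtracting a multiple of a fixed bump \<open>\<rho>\<close>. The multiples tend to zero because \<open>g\<close> has mean
  zero.
\<close>

lemma smooth_mean_zero_approximation:
  fixes g :: "real \<Rightarrow> real"
  assumes g: "continuous_on {0..1} g" and g0: "integral {0..1} g = 0"
  obtains \<psi> :: "nat \<Rightarrow> real \<Rightarrow> real" and a :: "nat \<Rightarrow> real"
  where "\<And>n. smooth (\<psi> n)" "\<And>n. 0 < a n" "\<And>n x. x \<notin> {a n..1 - a n} \<Longrightarrow> \<psi> n x = 0"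
    "\<And>n. integral {0..1} (\<psi> n) = 0"
    "\<And>s. 0 < s \<Longrightarrow> (\<lambda>n. LINT x|leb01. \<bar>\<psi> n x - g x\<bar> powr s) \<longlonglongrightarrow> 0"
proof -
  obtain B where B: "\<And>x. x \<in> {0..1} \<Longrightarrow> \<bar>g x\<bar> \<le> B"
    by (rule continuous_on_unit_bounded[OF g]) (rule that)
  have B0: "0 \<le> B" by (rule order.trans[OF abs_ge_zero B[of 0]]) simp
  have "\<exists>P. real_polynomial_function P \<and> (\<forall>x\<in>{0..1}. \<bar>g x - P x\<bar> < 1 / (real n + 1))" for n
  proof -
    have "0 < 1 / (real n + 1)" by simp
    then obtain P where "real_polynomial_function P" "\<And>x. x \<in> {0..1} \<Longrightarrow> \<bar>g x - P x\<bar> < 1 / (real n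
      + 1)"
      by (rule Stone_Weierstrass_real_polynomial_function[OF compact_Icc g]) (rule that)
    then show ?thesis by blast
  qed
  then obtain P where P: "\<And>n. real_polynomial_function (P n)"
    and near: "\<And>n. \<forall>x\<in>{0..1}. \<bar>g x - P n x\<bar> < 1 / (real n + 1)"
    by metis
  define \<kappa> where "\<kappa> n = cutoff (n + 2)" for n
  define \<rho> where "\<rho> = bump 1 (1 / 4) (3 / 4)"
  define J where "J = integral {0..1} \<rho>"
  define Q where "Q n x = \<kappa> n x * P n x" for n x
  define c where "c n = integral {0..1} (Q n) / J" for n
  define \<psi> where "\<psi> n x = Q n x + (- c n) * \<rho> x" for n x
  define a where "a n = min (1 / 4) (1 / real (n + 2))" for n
  have s\<rho>: "smooth \<rho>" unfolding \<rho>_def by (rule smooth_bump)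
  have sQ: "smooth (Q n)" for n
    unfolding Q_def \<kappa>_def cutoff_def by (intro smooth_mult smooth_bump smooth_polynomial P)
  have s\<psi>: "smooth (\<psi> n)" for n
    unfolding \<psi>_def by (intro smooth_add smooth_mult smooth_const s\<rho> sQ)
  note cont = smooth_continuous[OF s\<rho>] smooth_continuous[OF sQ] smooth_continuous[OF s\<psi>]
  have J: "0 < J"
    unfolding J_def using cont bump_bounds bump_pos[of 1 "1 / 2" "1 / 4" "3 / 4"]
    by (intro integral_pos_if_pos_somewhere[of _ "1 / 2"]) (auto simp: \<rho>_def)
  have a: "0 < a n" for n by (simp add: a_def)
  have supp: "\<psi> n x = 0" if "x \<notin> {a n..1 - a n}" for n x
  proof -
    have "a n \<le> 1 / 4" "a n \<le> 1 / real (n + 2)" by (simp_all add: a_def)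
    then have "x \<notin> {1 / 4<..<3 / 4}" "x \<notin> {1 / real (n + 2)<..<1 - 1 / real (n + 2)}"
      using that unfolding atLeastAtMost_iff greaterThanLessThan_iff by linarith+
    then show ?thesis
      by (simp add: \<psi>_def Q_def \<kappa>_def cutoff_def \<rho>_def bump_outside)
  qed
  have int0: "integral {0..1} (\<psi> n) = 0" for n
  proof -
    have "integral {0..1} (\<psi> n) = integral {0..1} (Q n) + integral {0..1} (\<lambda>x. (- c n) * \<rho> x)"
      unfolding \<psi>_def using cont by (intro integral_add integrable_continuous_real
        continuous_intros)
    then show ?thesis using J by (simp add: c_def J_def[symmetric])
  qed
  have \<kappa>_bound: "\<bar>\<kappa> n x\<bar> \<le> 1" for n x
    using bump_bounds by (simp add: \<kappa>_def cutoff_def)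
  have Q_bound: "\<bar>Q n x\<bar> \<le> B + 1" if "x \<in> {0..1}" for n x
  proof -
    have "\<bar>g x - P n x\<bar> < 1 / (real n + 1)" using near that by blast
    also have "\<dots> \<le> 1" by simp
    finally have "\<bar>P n x\<bar> \<le> B + 1" using B[OF that] by linarith
    then have "\<bar>\<kappa> n x\<bar> * \<bar>P n x\<bar> \<le> 1 * (B + 1)" using \<kappa>_bound by (intro mult_mono) auto
    then show ?thesis by (simp add: Q_def abs_mult)
  qed
  have Q_lim: "(\<lambda>n. Q n x) \<longlonglongrightarrow> g x" if x: "x \<in> {0<..<1}" for x
  proof -
    have "(\<lambda>n. P n x - g x) \<longlonglongrightarrow> 0"
    proof (rule Lim_null_comparison)
      show "\<forall>\<^sub>F n in sequentially. norm (P n x - g x) \<le> 1 / (real n + 1)"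
      proof (intro always_eventually allI)
        fix n have "\<bar>g x - P n x\<bar> < 1 / (real n + 1)" using near x by auto
        then show "norm (P n x - g x) \<le> 1 / (real n + 1)" by (simp add: abs_minus_commute)
      qed
      show "(\<lambda>n. 1 / (real n + 1)) \<longlonglongrightarrow> 0" by real_asymp
    qed
    then have "(\<lambda>n. P n x) \<longlonglongrightarrow> g x" by (simp add: LIM_zero_iff)
    moreover have "(\<lambda>n. \<kappa> n x) \<longlonglongrightarrow> 1"
      unfolding \<kappa>_def using LIMSEQ_ignore_initial_segment[OF cutoff_tendsto_1[OF x], of 2] by simp
    ultimately have "(\<lambda>n. \<kappa> n x * P n x) \<longlonglongrightarrow> 1 * g x" by (intro tendsto_mult)
    then show ?thesis by (simp add: Q_def)
  qed
  have "(\<lambda>n. LINT x|leb01. Q n x) \<longlonglongrightarrow> (LINT x|leb01. g x)"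
    by (rule integral_dominated_convergence[where w = "\<lambda>_. B + 1"])
      (use Q_lim Q_bound in \<open>auto intro!: measurable_unit_continuous g cont AE_I2\<close>)
  then have "(\<lambda>n. integral {0..1} (Q n)) \<longlonglongrightarrow> 0"
    using LINT_unit_continuous[OF g] LINT_unit_continuous[OF cont(2)] g0 by simp
  then have "(\<lambda>n. integral {0..1} (Q n) / J) \<longlonglongrightarrow> 0 / J"
    using J by (intro tendsto_divide tendsto_const) auto
  then have c_lim: "c \<longlonglongrightarrow> 0" by (simp add: c_def[abs_def])
  then have "Bseq c" by (intro convergent_imp_Bseq convergentI)
  then obtain C where C: "0 < C" "\<And>n. \<bar>c n\<bar> \<le> C" by (auto elim!: BseqE)
  have lim: "(\<lambda>n. LINT x|leb01. \<bar>\<psi> n x - g x\<bar> powr s) \<longlonglongrightarrow> 0" if s: "0 < s" for s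
  proof -
    have m: "(\<lambda>x. \<bar>\<psi> n x - g x\<bar> powr s) \<in> borel_measurable leb01" for n
      using s cont g by (intro measurable_unit_continuous continuous_on_abs_powr continuous_intros)
    have "(\<lambda>n. LINT x|leb01. \<bar>\<psi> n x - g x\<bar> powr s) \<longlonglongrightarrow> (LINT x|leb01. (0::real))"
    proof (rule integral_dominated_convergence[where w = "\<lambda>_. (B + 1 + C + B) powr s"])
      show "AE x in leb01. (\<lambda>n. \<bar>\<psi> n x - g x\<bar> powr s) \<longlonglongrightarrow> 0"
      proof (rule AE_I2)
        fix x assume "x \<in> space leb01"
        then have x: "x \<in> {0<..<1}" by simp
        have "(\<lambda>n. \<psi> n x - g x) \<longlonglongrightarrow> (g x + (- 0) * \<rho> x) - g x"
          unfolding \<psi>_def by (intro tendsto_intros Q_lim x c_lim)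
        then have "(\<lambda>n. abs_pow (\<psi> n x - g x) s) \<longlonglongrightarrow> abs_pow 0 s"
          using s by (intro tendsto_abs_pow) auto
        then show "(\<lambda>n. \<bar>\<psi> n x - g x\<bar> powr s) \<longlonglongrightarrow> 0" using s by (simp add: abs_pow_def)
      qed
      show "AE x in leb01. norm (\<bar>\<psi> n x - g x\<bar> powr s) \<le> (B + 1 + C + B) powr s" for n
      proof (rule AE_I2)
        fix x assume "x \<in> space leb01"
        then have x: "x \<in> {0..1}" by simp
        have "\<bar>\<rho> x\<bar> \<le> 1" using bump_bounds by (simp add: \<rho>_def)
        then have "\<bar>c n\<bar> * \<bar>\<rho> x\<bar> \<le> C * 1" using C by (intro mult_mono) auto
        then have "\<bar>\<psi> n x - g x\<bar> \<le> B + 1 + C + B"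
          using Q_bound[OF x, of n] B[OF x] abs_mult[of "c n" "\<rho> x"] by (auto simp: \<psi>_def)
        then show "norm (\<bar>\<psi> n x - g x\<bar> powr s) \<le> (B + 1 + C + B) powr s"
          using s by (auto intro!: powr_mono2)
      qed
    qed (use m in auto)
    then show ?thesis by simp
  qed
  show ?thesis
    by (rule that[of \<psi> a]) (use s\<psi> a supp int0 lim in auto)
qed

text \<open>
  The primitives of the approximating slopes are test functions; they converge uniformly because
  the slopes converge in mean.
\<close>

lemma primitive_in_W10:
  assumes g: "continuous_on {0..1} g" and g0: "integral {0..1} g = 0" and r: "1 < r"
  shows "primitive g \<in> W10 {0<..<1} r"
proof -
  let ?w = "primitive g" and ?D = "weak_deriv {0<..<1} (primitive g)"
  have cw: "continuous_on {0..1} ?w" by (rule continuous_on_primitive[OF g])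
  have L: "f \<in> Lspace {0<..<1} r" if "continuous_on {0..1} f" for f :: "real \<Rightarrow> real"
    using that r unfolding Lspace_def
    by (auto intro!: measurable_unit_continuous integrable_unit_continuous continuous_on_abs_powr)
  have W1: "?w \<in> W1 {0<..<1} r"
    unfolding W1_def using L[OF cw] L[OF g] has_weak_deriv_primitive[OF g] by blast
  obtain \<psi> :: "nat \<Rightarrow> real \<Rightarrow> real" and a :: "nat \<Rightarrow> real"
    where \<psi>: "\<And>n. smooth (\<psi> n)" "\<And>n. 0 < a n" "\<And>n x. x \<notin> {a n..1 - a n} \<Longrightarrow> \<psi> n x = 0"
      "\<And>n. integral {0..1} (\<psi> n) = 0"
      and lim: "\<And>s. 0 < s \<Longrightarrow> (\<lambda>n. LINT x|leb01. \<bar>\<psi> n x - g x\<bar> powr s) \<longlonglongrightarrow> 0"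
    by (rule smooth_mean_zero_approximation[OF g g0]) (rule that)
  have c\<psi>: "continuous_on {0..1} (\<psi> n)" for n by (rule smooth_continuous[OF \<psi>(1)])
  have cp: "continuous_on {0..1} (primitive (\<psi> n))" for n by (rule continuous_on_primitive[OF c\<psi>])
  have test: "test_function {0<..<1} (primitive (\<psi> n))" "deriv (primitive (\<psi> n)) = \<psi> n" for n
    using test_function_primitive[OF \<psi>(1,3,2) _ \<psi>(4), of n] \<psi>(2)[of n] by auto
  have "(LINT x|leb01. \<bar>deriv (primitive (\<psi> n)) x - ?D x\<bar> powr r)
      = (LINT x|leb01. \<bar>\<psi> n x - g x\<bar> powr r)" for n
  proof (rule integral_cong_AE)
    show "(\<lambda>x. \<bar>deriv (primitive (\<psi> n)) x - ?D x\<bar> powr r) \<in> borel_measurable leb01"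
      unfolding test(2) using measurable_unit_continuous[OF c\<psi>]
        measurable_weak_deriv_primitive[OF g]
      by measurable
    show "(\<lambda>x. \<bar>\<psi> n x - g x\<bar> powr r) \<in> borel_measurable leb01"
      using measurable_unit_continuous[OF c\<psi>] measurable_unit_continuous[OF g] by measurable
    show "AE x in leb01. \<bar>deriv (primitive (\<psi> n)) x - ?D x\<bar> powr r = \<bar>\<psi> n x - g x\<bar> powr r"
      using weak_deriv_primitive[OF g] by eventually_elim (simp add: test)
  qed
  then have limD: "(\<lambda>n. LINT x|leb01. \<bar>deriv (primitive (\<psi> n)) x - ?D x\<bar> powr r) \<longlonglongrightarrow> 0"
    using lim[of r] r by simp
  define d where "d n = (LINT x|leb01. \<bar>\<psi> n x - g x\<bar>)" for n
  have d: "d \<longlonglongrightarrow> 0" using lim[of 1] by (simp add: d_def[abs_def])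
  have "(\<lambda>n. LINT x|leb01. \<bar>primitive (\<psi> n) x - ?w x\<bar> powr r) \<longlonglongrightarrow> 0"
  proof (rule Lim_null_comparison)
    show "\<forall>\<^sub>F n in sequentially. norm (LINT x|leb01. \<bar>primitive (\<psi> n) x - ?w x\<bar> powr r)
      \<le> \<bar>d n\<bar> powr r"
    proof (intro always_eventually allI)
      fix n
      have b: "\<bar>primitive (\<psi> n) x - ?w x\<bar> \<le> d n" if "x \<in> {0..1}" for x
      proof -
        have c: "continuous_on {0..1} (\<lambda>x. \<psi> n x - g x)" using c\<psi> g by (intro continuous_intros)
        have sub: "continuous_on {0..x} (\<psi> n)" "continuous_on {0..x} g"
          using that by (auto intro: continuous_on_subset[OF c\<psi>] continuous_on_subset[OF g])
        have "primitive (\<psi> n) x - ?w x = primitive (\<lambda>x. \<psi> n x - g x) x"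
          unfolding primitive_def
          using sub by (intro integral_diff[symmetric] integrable_continuous_real)
        moreover have "\<bar>primitive (\<lambda>x. \<psi> n x - g x) x\<bar> \<le> integral {0..1} (\<lambda>x. \<bar>\<psi> n x - g x\<bar>)"
          by (rule abs_primitive_le[OF c that])
        moreover have "integral {0..1} (\<lambda>x. \<bar>\<psi> n x - g x\<bar>) = d n"
          unfolding d_def by (intro LINT_unit_continuous[symmetric] continuous_on_rabs c)
        ultimately show ?thesis by simp
      qed
      have "(LINT x|leb01. \<bar>primitive (\<psi> n) x - ?w x\<bar> powr r) \<le> (LINT x|leb01. \<bar>d n\<bar> powr r)"
      proof (rule integral_mono)
        show "integrable leb01 (\<lambda>x. \<bar>primitive (\<psi> n) x - ?w x\<bar> powr r)"
          using r cp cw by (intro integrable_unit_continuous continuous_on_abs_powr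
            continuous_intros) auto
        show "\<bar>primitive (\<psi> n) x - ?w x\<bar> powr r \<le> \<bar>d n\<bar> powr r" if "x \<in> space leb01" for x
          using b[of x] that r by (intro powr_mono2) auto
      qed simp
      then show "norm (LINT x|leb01. \<bar>primitive (\<psi> n) x - ?w x\<bar> powr r) \<le> \<bar>d n\<bar> powr r"
        by simp
    qed
    show "(\<lambda>n. \<bar>d n\<bar> powr r) \<longlonglongrightarrow> 0"
      using tendsto_abs_pow[OF _ d, of r] r by (simp add: abs_pow_def)
  qed
  then show ?thesis
    unfolding W10_def using W1 test(1) limD
    by (intro CollectI conjI exI[of _ "\<lambda>n. primitive (\<psi> n)"] allI)
qed

lemma LINT_weak_deriv_primitive:
  assumes g: "continuous_on {0..1} g" and r: "1 < r"
  shows "energy r (primitive g) = integral {0..1} (\<lambda>x. \<bar>g x\<bar> powr r)"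
proof -
  have "energy r (primitive g) = (LINT x|leb01. \<bar>g x\<bar> powr r)"
  proof (rule integral_cong_AE)
    show "(\<lambda>x. \<bar>weak_deriv {0<..<1} (primitive g) x\<bar> powr r) \<in> borel_measurable leb01"
      using measurable_weak_deriv_primitive[OF g] by measurable
    show "(\<lambda>x. \<bar>g x\<bar> powr r) \<in> borel_measurable leb01"
      using measurable_unit_continuous[OF g] by measurable
    show "AE x in leb01. \<bar>weak_deriv {0<..<1} (primitive g) x\<bar> powr r = \<bar>g x\<bar> powr r"
      using weak_deriv_primitive[OF g] by eventually_elim simp
  qed
  also have "\<dots> = integral {0..1} (\<lambda>x. \<bar>g x\<bar> powr r)"
    using g r by (intro LINT_unit_continuous continuous_on_abs_powr) auto
  finally show ?thesis .
qed

section \<open>The eigenvalues as reciprocals of best constants\<close>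

text \<open>
  The Euler-Lagrange equation, an equation between continuous functions, in weak form.
\<close>

lemma weak_equation:
  assumes r: "1 < r" and g: "continuous_on {0..1} g" and f: "continuous_on {0..1} f"
    and EL: "\<And>x. x \<in> {0..1} \<Longrightarrow> spow (g x) (r - 1) = (c - primitive f x) / \<Lambda>"
    and \<phi>: "\<phi> \<in> W10 {0<..<1} r"
  shows "(LINT x|leb01. \<bar>weak_deriv {0<..<1} (primitive g) x\<bar> powr (r - 2)
      * weak_deriv {0<..<1} (primitive g) x * weak_deriv {0<..<1} \<phi> x)
    = 1 / \<Lambda> * (LINT x|leb01. f x * \<phi> x)"
proof -
  let ?D = "weak_deriv {0<..<1} (primitive g)" and ?E = "weak_deriv {0<..<1} \<phi>"
  note [measurable] = measurable_weak_deriv_primitive[OF g] W10_D(3)[OF \<phi> r]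
  have F: "primitive f \<in> borel_measurable leb01"
    by (rule measurable_unit_continuous[OF continuous_on_primitive[OF f]])
  have "(LINT x|leb01. \<bar>?D x\<bar> powr (r - 2) * ?D x * ?E x)
      = (LINT x|leb01. 1 / \<Lambda> * ((c - primitive f x) * ?E x))"
  proof (rule integral_cong_AE)
    show "(\<lambda>x. \<bar>?D x\<bar> powr (r - 2) * ?D x * ?E x) \<in> borel_measurable leb01"
      by measurable
    show "(\<lambda>x. 1 / \<Lambda> * ((c - primitive f x) * ?E x)) \<in> borel_measurable leb01"
      using F by measurable
    have "AE x in leb01. x \<in> {0..1}" by (rule AE_I2) auto
    then show "AE x in leb01. \<bar>?D x\<bar> powr (r - 2) * ?D x * ?E x = 1 / \<Lambda> * ((c - primitive f x)
      * ?E x)"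
      using weak_deriv_primitive[OF g]
    proof eventually_elim
      case (elim x)
      then show ?case using EL[of x] by (simp add: spow_eq_powr_mult)
    qed
  qed
  also have "\<dots> = 1 / \<Lambda> * (LINT x|leb01. f x * \<phi> x)"
    by (subst integral_mult_right_zero) (simp add: integral_mult_W10[OF f \<phi> r])
  finally show ?thesis .
qed

lemma nonzero_on_if_coupling_pos:
  assumes g: "continuous_on {0..1} g" and h: "continuous_on {0..1} h" and "1 \<le> \<alpha>" "0 \<le> \<beta>"
    and pos: "0 < coupling \<alpha> \<beta> g h"
  shows "nonzero_on {0<..<1} (primitive g)"
  unfolding nonzero_on_def
proof
  let ?K = "\<lambda>x. abs_pow (primitive g x) \<alpha> * abs_pow (primitive h x) \<beta>"
  assume "AE x in leb01. primitive g x = 0"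
  then have AE: "AE x in leb01. ?K x = 0"
    by eventually_elim (use assms(3) in \<open>simp add: abs_pow_def\<close>)
  have c: "continuous_on {0..1} ?K"
    using assms by (intro continuous_intros continuous_on_primitive) auto
  have "(LINT x|leb01. ?K x) = (LINT x|leb01. 0)"
    using AE by (intro integral_cong_AE measurable_unit_continuous c) auto
  then show False using pos LINT_unit_continuous[OF c] by (simp add: coupling_def)
qed

text \<open>
  The theory of pairs for the exponents \<open>p, p, p, 0\<close>. The last clause is the Poincare inequality
  with the best constant. It forces the energy of the maximiser to be 1, not less, so that its
  Rayleigh quotient is the reciprocal of the constant.
\<close>

lemma first_eigenvalue_eq:
  assumes p: "1 < p"
  shows "\<exists>g. g \<in> unit_ball p \<and> 0 < weighted_power p (\<lambda>_. 1) g \<and>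
    (\<forall>h\<in>unit_ball p. weighted_power p (\<lambda>_. 1) h \<le> weighted_power p (\<lambda>_. 1) g) \<and>
    first_eigenvalue {0<..<1} p = 1 / weighted_power p (\<lambda>_. 1) g \<and>
    (\<forall>u\<in>W10 {0<..<1} p. (LINT x|leb01. \<bar>u x\<bar> powr p)
       \<le> weighted_power p (\<lambda>_. 1) g * energy p u)"
proof -
  interpret exponents p p p 0
    using p by unfold_locales auto
  obtain g h where g: "g \<in> unit_ball p" and h: "h \<in> unit_ball p" and pos: "0 < coupling p 0 g h"
    and max: "\<And>g' h'. \<lbrakk>g' \<in> unit_ball p; h' \<in> unit_ball p\<rbrakk> \<Longrightarrow> coupling p 0 g' h' \<le> coupling p 0 g h"
    using maximising_pair by blast
  have W: "coupling p 0 g' h' = weighted_power p (\<lambda>_. 1) g'" for g' h'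
    by (simp add: coupling_def weighted_power_def)
  define \<Lambda> where "\<Lambda> = weighted_power p (\<lambda>_. 1) g"
  have \<Lambda>: "0 < \<Lambda>" using pos by (simp add: W \<Lambda>_def)
  have bound: "coupling_bound \<Lambda>"
    using max by (simp add: coupling_bound_def W \<Lambda>_def)
  have ineq: "(LINT x|leb01. \<bar>u x\<bar> powr p) \<le> \<Lambda> * energy p u"
    if u: "u \<in> W10 {0<..<1} p" for u
  proof (rule field_le_epsilon)
    fix e :: real assume e: "0 < e"
    define E where "E = energy p u"
    have E: "0 \<le> E" by (simp add: E_def)
    (* The inequality is available for all bounds above the energy E; e absorbs the difference. *)
    have lt: "E < E + e / \<Lambda>" using e \<Lambda> by simp
    have "(LINT x|leb01. abs_pow (u x) p * abs_pow (u x) 0)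
        \<le> \<Lambda> * (E + e / \<Lambda>) powr (p / p) * (E + e / \<Lambda>) powr (0 / p)"
      using lt unfolding E_def by (intro coupling_bound_W10(2)[OF bound u u])
    moreover have "(\<lambda>x. abs_pow (u x) p * abs_pow (u x) 0) = (\<lambda>x. \<bar>u x\<bar> powr p)"
      using p by (auto simp: abs_pow_powr)
    ultimately have "(LINT x|leb01. \<bar>u x\<bar> powr p) \<le> \<Lambda> * (E + e / \<Lambda>)"
      using p E lt by simp
    then show "(LINT x|leb01. \<bar>u x\<bar> powr p) \<le> \<Lambda> * energy p u + e"
      using \<Lambda> by (simp add: E_def distrib_left)
  qed
  note cg = unit_ballD(1)[OF g]
  have "first_eigenvalue {0<..<1} p = 1 / \<Lambda>"
    unfolding first_eigenvalue_def
  proof (rule Least_equality)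
    have w: "primitive g \<in> W10 {0<..<1} p"
      using primitive_in_W10[OF cg unit_ballD(2)[OF g] p] .
    have nz: "nonzero_on {0<..<1} (primitive g)"
      using nonzero_on_if_coupling_pos[OF cg unit_ballD(1)[OF h] _ _ pos] p by simp
    have u: "(LINT x|leb01. \<bar>primitive g x\<bar> powr p) = \<Lambda>"
    proof -
      have "(LINT x|leb01. \<bar>primitive g x\<bar> powr p) = integral {0..1} (\<lambda>x. \<bar>primitive g x\<bar> powr p)"
        using p cg by (intro LINT_unit_continuous continuous_on_abs_powr continuous_on_primitive)
          auto
      also have "\<dots> = \<Lambda>" using p by (simp add: \<Lambda>_def weighted_power_def abs_pow_powr)
      finally show ?thesis .
    qed
    have D: "energy p (primitive g) = 1"
    proof (rule order.antisym)
      show "energy p (primitive g) \<le> 1"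
        using LINT_weak_deriv_primitive[OF cg p] unit_ballD(4)[OF g] by simp
      show "1 \<le> energy p (primitive g)"
        using ineq[OF w] \<Lambda> by (simp add: u)
    qed
    show "1 / \<Lambda> \<in> {energy p u / (LINT x|leb01. \<bar>u x\<bar> powr p)
        | u. u \<in> W10 {0<..<1} p \<and> nonzero_on {0<..<1} u}"
      using w nz u D by (intro CollectI exI[of _ "primitive g"]) simp
    fix \<mu> assume "\<mu> \<in> {energy p u / (LINT x|leb01. \<bar>u x\<bar> powr p)
        | u. u \<in> W10 {0<..<1} p \<and> nonzero_on {0<..<1} u}"
    then obtain u where u: "u \<in> W10 {0<..<1} p" "nonzero_on {0<..<1} u"
      and \<mu>: "\<mu> = energy p u / (LINT x|leb01. \<bar>u x\<bar> powr p)"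
      by blast
    have "(LINT x|leb01. \<bar>u x\<bar> powr p) \<noteq> 0"
    proof
      assume "(LINT x|leb01. \<bar>u x\<bar> powr p) = 0"
      then have "AE x in leb01. \<bar>u x\<bar> powr p = 0"
        using W10_D(2)[OF u(1) p] by (subst integral_nonneg_eq_0_iff_AE[symmetric]) auto
      then show False using u(2) by (simp add: nonzero_on_def)
    qed
    moreover have "0 \<le> (LINT x|leb01. \<bar>u x\<bar> powr p)" by simp
    ultimately have "0 < (LINT x|leb01. \<bar>u x\<bar> powr p)" by linarith
    then show "1 / \<Lambda> \<le> \<mu>"
      using ineq[OF u(1)] \<Lambda> by (simp add: \<mu> field_simps)
  qed
  then show ?thesis
    using g \<Lambda> ineq max h unfolding W \<Lambda>_def by blast
qed

lemma energy_pos: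
  assumes p: "1 < p" and u: "u \<in> W10 {0<..<1} p" "nonzero_on {0<..<1} u"
  shows "0 < energy p u"
proof (rule ccontr)
  assume "\<not> ?thesis"
  moreover have "0 \<le> energy p u" by simp
  ultimately have E: "energy p u = 0" by linarith
  obtain g where "\<forall>u\<in>W10 {0<..<1} p. (LINT x|leb01. \<bar>u x\<bar> powr p)
       \<le> weighted_power p (\<lambda>_. 1) g * energy p u"
    using first_eigenvalue_eq[OF p] by blast
  then have "(LINT x|leb01. \<bar>u x\<bar> powr p) \<le> 0" using u(1) E by fastforce
  moreover have "0 \<le> (LINT x|leb01. \<bar>u x\<bar> powr p)" by simp
  ultimately have "(LINT x|leb01. \<bar>u x\<bar> powr p) = 0" by linarith
  then have "AE x in leb01. \<bar>u x\<bar> powr p = 0"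
    using W10_D(2)[OF u(1) p] by (subst integral_nonneg_eq_0_iff_AE[symmetric]) auto
  then show False using u(2) by (simp add: nonzero_on_def)
qed

text \<open>
  Each component maximises a weighted power with the other component fixed. Both Euler-Lagrange
  equations contain the same constant, the value of the coupling.
\<close>

lemma (in exponents) maximising_pair_weak_solution:
  assumes \<beta>: "1 \<le> \<beta>" and g: "g \<in> unit_ball p" and h: "h \<in> unit_ball q"
    and pos: "0 < coupling \<alpha> \<beta> g h"
    and max: "\<And>g' h'. \<lbrakk>g' \<in> unit_ball p; h' \<in> unit_ball q\<rbrakk> \<Longrightarrow> coupling \<alpha> \<beta> g' h' \<le> coupling \<alpha> \<beta> g h"
  shows "weak_solution {0<..<1} p q \<alpha> \<beta> (1 / coupling \<alpha> \<beta> g h) (primitive g) (primitive h)"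
proof -
  let ?u = "primitive g" and ?v = "primitive h"
  note cg = unit_ballD(1)[OF g] and ch = unit_ballD(1)[OF h]
  interpret u: weighted_element p \<alpha> "\<lambda>x. abs_pow (?v x) \<beta>" g
    using p \<alpha> g pos \<beta>_nonneg ch
    by unfold_locales (auto simp: coupling_weighted_power[symmetric] intro!: continuous_intros
      continuous_on_primitive)
  interpret v: weighted_element q \<beta> "\<lambda>x. abs_pow (?u x) \<alpha>" h
    using q \<beta> h pos \<alpha>_nonneg cg
    by unfold_locales (auto simp: coupling_weighted_power'[symmetric] intro!: continuous_intros
      continuous_on_primitive)
  obtain c where c: "\<And>x. x \<in> {0..1} \<Longrightarrow> spow (g x) (p - 1)
      = (c - primitive (gradient \<alpha> (\<lambda>x. abs_pow (?v x) \<beta>) g) x) / coupling \<alpha> \<beta> g h"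
    using u.Euler_Lagrange max[OF _ h] unfolding coupling_weighted_power[symmetric] by blast
  obtain d where d: "\<And>x. x \<in> {0..1} \<Longrightarrow> spow (h x) (q - 1)
      = (d - primitive (gradient \<beta> (\<lambda>x. abs_pow (?u x) \<alpha>) h) x) / coupling \<alpha> \<beta> g h"
    using v.Euler_Lagrange max[OF g] unfolding coupling_weighted_power'[symmetric] by blast
  have u: "abs_pow (?u x) (\<alpha> - 1) * ?u x = abs_pow (?u x) \<alpha>" if "x \<in> {0..1}" for x
    using abs_pow_pred_mult[of \<alpha> "?u x"] unit_ballD(3)[OF g that] \<alpha> by simp
  have v: "abs_pow (?v x) (\<beta> - 1) * ?v x = abs_pow (?v x) \<beta>" if "x \<in> {0..1}" for x
    using abs_pow_pred_mult[of \<beta> "?v x"] unit_ballD(3)[OF h that] \<beta> by simp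
  have "(LINT x|leb01. gradient \<alpha> (\<lambda>x. abs_pow (?v x) \<beta>) g x * \<phi> x)
      = (LINT x|leb01. abs_pow (?u x) (\<alpha> - 1) * abs_pow (?v x) (\<beta> - 1) * ?v x * \<phi> x)" for \<phi>
    by (intro Bochner_Integration.integral_cong) (auto simp: gradient_def v[symmetric] mult_ac)
  moreover have "(LINT x|leb01. gradient \<beta> (\<lambda>x. abs_pow (?u x) \<alpha>) h x * \<phi> x)
      = (LINT x|leb01. abs_pow (?u x) (\<alpha> - 1) * abs_pow (?v x) (\<beta> - 1) * ?u x * \<phi> x)" for \<phi>
    by (intro Bochner_Integration.integral_cong) (auto simp: gradient_def u[symmetric] mult_ac)
  ultimately show ?thesis
    unfolding weak_solution_def
    using primitive_in_W10[OF cg unit_ballD(2)[OF g] p] primitive_in_W10[OF ch unit_ballD(2)[OF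
      h] q]
      weak_equation[OF p cg u.continuous_gradient c] weak_equation[OF q ch v.continuous_gradient d]
    by simp
qed

text \<open>
  Testing both equations with the solution itself shows that both energies equal \<open>\<mu> * K\<close>. This
  is positive, since \<open>u\<close> is nonzero. Inserting it into the coupling inequality gives
  \<open>K \<le> \<Lambda> * (\<mu> * K)\<close>, because the exponents add up to 1.
\<close>

lemma (in exponents) eigenvalue_ge:
  assumes \<beta>: "1 \<le> \<beta>" and bound: "coupling_bound \<Lambda>" and \<Lambda>: "0 < \<Lambda>" and \<mu>: "0 < \<mu>"
    and sol: "weak_solution {0<..<1} p q \<alpha> \<beta> \<mu> u v"
    and nz: "nonzero_on {0<..<1} u" "nonzero_on {0<..<1} v"
  shows "1 / \<Lambda> \<le> \<mu>"
proof -
  have u: "u \<in> W10 {0<..<1} p" and v: "v \<in> W10 {0<..<1} q"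
    using sol by (auto simp: weak_solution_def)
  define k where "k x = abs_pow (u x) (\<alpha> - 1) * abs_pow (v x) (\<beta> - 1) * v x * u x" for x
  define K where "K = (LINT x|leb01. k x)"
  (* Also valid for t = 0, where all terms vanish. *)
  have sq: "\<bar>t\<bar> powr (r - 2) * t * t = \<bar>t\<bar> powr r" for t r :: real
    using spow_mult_self[of t "r - 1"] by (simp add: spow_eq_powr_mult)
  have Eu: "energy p u = \<mu> * K"
    using sol u unfolding weak_solution_def K_def k_def by (auto dest!: bspec[of _ _ u] simp: sq)
  have k': "k x = abs_pow (u x) (\<alpha> - 1) * abs_pow (v x) (\<beta> - 1) * u x * v x" for x
    by (simp add: k_def)
  have Ev: "energy q v = \<mu> * K"
    using sol v unfolding weak_solution_def K_def k' by (auto dest!: bspec[of _ _ v] simp: sq)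
  have K: "0 < K"
    using energy_pos[OF p u nz(1)] Eu \<mu> by (simp add: zero_less_mult_iff)
  then have ik: "integrable leb01 k"
    unfolding K_def using not_integrable_integral_eq by fastforce
  have "K \<le> \<Lambda> * (\<mu> * K)"
  proof (rule field_le_epsilon)
    fix e :: real assume e: "0 < e"
    define A where "A = \<mu> * K + e / \<Lambda>"
    have A: "\<mu> * K < A" using e \<Lambda> by (simp add: A_def)
    have A0: "0 < A" using A mult_pos_pos[OF \<mu> K] by linarith
    have lt: "energy p u < A"
      "energy q v < A"
      using A by (simp_all add: Eu Ev)
    note C = coupling_bound_W10[OF bound u v lt]
    have "K \<le> (LINT x|leb01. abs_pow (u x) \<alpha> * abs_pow (v x) \<beta>)"
      unfolding K_def
    proof (rule integral_mono[OF ik C(1)])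
      fix x
      have "k x \<le> abs_pow (u x) (\<alpha> - 1) * abs_pow (v x) (\<beta> - 1) * \<bar>v x * u x\<bar>"
        unfolding k_def mult.assoc by (intro mult_left_mono) auto
      also have "\<dots> = (abs_pow (u x) (\<alpha> - 1) * \<bar>u x\<bar>) * (abs_pow (v x) (\<beta> - 1) * \<bar>v x\<bar>)"
        by (simp add: abs_mult)
      also have "\<dots> = abs_pow (u x) \<alpha> * abs_pow (v x) \<beta>"
        using \<alpha> \<beta> by (simp add: abs_pow_pred_mult)
      finally show "k x \<le> abs_pow (u x) \<alpha> * abs_pow (v x) \<beta>" .
    qed
    also have "\<dots> \<le> \<Lambda> * A powr (\<alpha> / p) * A powr (\<beta> / q)" by (rule C(2))
    also have "\<dots> = \<Lambda> * A"
      using A0 homogeneous by (simp add: mult.assoc powr_add[symmetric])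
    also have "\<dots> = \<Lambda> * (\<mu> * K) + e" using \<Lambda> by (simp add: A_def distrib_left)
    finally show "K \<le> \<Lambda> * (\<mu> * K) + e" .
  qed
  then show ?thesis using K \<Lambda> by (simp add: field_simps)
qed

lemma (in exponents) principal_eigenvalue_eq:
  assumes \<beta>: "1 \<le> \<beta>"
  shows "\<exists>\<Lambda>>0. coupling_bound \<Lambda> \<and> principal_eigenvalue {0<..<1} p q \<alpha> \<beta> = 1 / \<Lambda>"
proof -
  obtain g h where g: "g \<in> unit_ball p" and h: "h \<in> unit_ball q" and pos: "0 < coupling \<alpha> \<beta> g h"
    and max: "\<And>g' h'. \<lbrakk>g' \<in> unit_ball p; h' \<in> unit_ball q\<rbrakk> \<Longrightarrow> coupling \<alpha> \<beta> g' h' \<le> coupling \<alpha> \<beta> g h"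
    using maximising_pair by blast
  let ?\<Lambda> = "coupling \<alpha> \<beta> g h"
  have bound: "coupling_bound ?\<Lambda>" using max by (simp add: coupling_bound_def)
  note cg = unit_ballD(1)[OF g] and ch = unit_ballD(1)[OF h]
  have "principal_eigenvalue {0<..<1} p q \<alpha> \<beta> = 1 / ?\<Lambda>"
    unfolding principal_eigenvalue_def
  proof (rule Least_equality)
    show "0 < 1 / ?\<Lambda> \<and> (\<exists>u v. weak_solution {0<..<1} p q \<alpha> \<beta> (1 / ?\<Lambda>) u v \<and>
        nonzero_on {0<..<1} u \<and> nonzero_on {0<..<1} v)"
      using pos maximising_pair_weak_solution[OF \<beta> g h pos max]
        nonzero_on_if_coupling_pos[OF cg ch \<alpha> \<beta>_nonneg pos]
        nonzero_on_if_coupling_pos[OF ch cg \<beta> \<alpha>_nonneg] coupling_commute[of \<alpha> \<beta> g h] by auto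
    show "1 / ?\<Lambda> \<le> \<mu>" if "0 < \<mu> \<and> (\<exists>u v. weak_solution {0<..<1} p q \<alpha> \<beta> \<mu> u v \<and>
        nonzero_on {0<..<1} u \<and> nonzero_on {0<..<1} v)" for \<mu>
      using that eigenvalue_ge[OF \<beta> bound pos] by blast
  qed
  then show ?thesis using pos bound by blast
qed

section \<open>The bound for the principal eigenvalue\<close>

theorem theorem3p5:
  fixes p q \<alpha> \<beta> C :: real and \<Omega> :: "real set"
  assumes "\<Omega> = {0<..<1}"
    and "p > 1" and "q > 1" and "\<alpha> \<ge> 1" and "\<beta> \<ge> 1"
    and "\<alpha> / p + \<beta> / q = 1"
    and "C = (1 + p) powr (\<alpha> / p) * (1 + q) powr (\<beta> / q) * Beta (1 + \<alpha>) (1 + \<beta>)"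
  shows "principal_eigenvalue \<Omega> p q \<alpha> \<beta>
         \<le> 1 / C * (\<alpha> / p * first_eigenvalue \<Omega> p + \<beta> / q * first_eigenvalue \<Omega> q)"
proof -
  interpret exponents p q \<alpha> \<beta>
    using assms by unfold_locales auto
  obtain \<Lambda> where \<Lambda>: "0 < \<Lambda>" "coupling_bound \<Lambda>" "principal_eigenvalue {0<..<1} p q \<alpha> \<beta> = 1 / \<Lambda>"
    using principal_eigenvalue_eq assms by blast
  define l where "l = first_eigenvalue {0<..<1} p"
  define m where "m = first_eigenvalue {0<..<1} q"
  have profile: "0 < first_eigenvalue {0<..<1} r \<and> (\<exists>\<phi>. half_profile \<phi> \<and>
      0 < integral {0..1} (\<lambda>x. primitive \<phi> x powr r) \<and>
      integral {0..1} (\<lambda>x. \<bar>half_profile.mirrored \<phi> x\<bar> powr r)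
        \<le> first_eigenvalue {0<..<1} r * integral {0..1} (\<lambda>x. primitive \<phi> x powr r))"
    if r: "1 < r" for r
  proof -
    obtain g where g: "g \<in> unit_ball r" "0 < weighted_power r (\<lambda>_. 1) g"
      "\<And>h. h \<in> unit_ball r \<Longrightarrow> weighted_power r (\<lambda>_. 1) h \<le> weighted_power r (\<lambda>_. 1) g"
      and l: "first_eigenvalue {0<..<1} r = 1 / weighted_power r (\<lambda>_. 1) g"
      using first_eigenvalue_eq[OF r] by blast
    obtain \<phi> where \<phi>: "half_profile \<phi>" "0 < integral {0..1} (\<lambda>x. primitive \<phi> x powr r)"
      "2 powr r * integral {0..1} (\<lambda>x. \<phi> x powr r)
         \<le> integral {0..1} (\<lambda>x. primitive \<phi> x powr r) / weighted_power r (\<lambda>_. 1) g"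
      using half_profile_of_maximiser[OF r g] by blast
    then show ?thesis
      using half_profile.integral_abs_mirrored[OF \<phi>(1), of r] r l g(2) by (auto intro!: exI[of _ \<phi>])
  qed
  obtain \<phi> where \<phi>: "half_profile \<phi>" and I: "0 < integral {0..1} (\<lambda>x. primitive \<phi> x powr p)"
    and A: "integral {0..1} (\<lambda>x. \<bar>half_profile.mirrored \<phi> x\<bar> powr p) \<le> l
      * integral {0..1} (\<lambda>x. primitive \<phi> x powr p)"
    and l: "0 < l"
    using profile[OF p] unfolding l_def by blast
  obtain \<psi> where \<psi>: "half_profile \<psi>" and J: "0 < integral {0..1} (\<lambda>x. primitive \<psi> x powr q)"
    and B: "integral {0..1} (\<lambda>x. \<bar>half_profile.mirrored \<psi> x\<bar> powr q) \<le> m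
      * integral {0..1} (\<lambda>x. primitive \<psi> x powr q)"
    and m: "0 < m"
    using profile[OF q] unfolding m_def by blast
  define i where "i = integral {0..1} (\<lambda>x. primitive \<phi> x powr p)"
  define j where "j = integral {0..1} (\<lambda>x. primitive \<psi> x powr q)"
  have ij: "0 < i" "0 < j" using I J by (simp_all add: i_def j_def)
  have "C * i powr (\<alpha> / p) * j powr (\<beta> / q) \<le> coupling \<alpha> \<beta> (half_profile.mirrored \<phi>)
    (half_profile.mirrored \<psi>)"
    unfolding assms(7) i_def j_def
    using coupling_mirrored_ge[OF \<phi> \<psi> p q assms(4,5,6) I J] .
  also have "\<dots> \<le> \<Lambda> * (l * i) powr (\<alpha> / p) * (m * j) powr (\<beta> / q)"
    using A B l m ij unfolding i_def[symmetric] j_def[symmetric]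
    by (intro coupling_bound_general \<Lambda> half_profile.continuous_mirrored
      half_profile.integral_mirrored \<phi> \<psi>) auto
  also have "\<dots> = (\<Lambda> * (l powr (\<alpha> / p) * m powr (\<beta> / q))) * (i powr (\<alpha> / p) * j powr (\<beta> / q))"
    using l m ij by (simp add: powr_mult mult_ac)
  finally have "C * (i powr (\<alpha> / p) * j powr (\<beta> / q))
      \<le> (\<Lambda> * (l powr (\<alpha> / p) * m powr (\<beta> / q))) * (i powr (\<alpha> / p) * j powr (\<beta> / q))"
    by (simp add: mult.assoc)
  then have "C \<le> \<Lambda> * (l powr (\<alpha> / p) * m powr (\<beta> / q))"
    using ij by (subst (asm) mult_le_cancel_right_pos) auto
  also have "\<dots> \<le> \<Lambda> * (\<alpha> / p * l + \<beta> / q * m)"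
    using Youngs_inequality_0[of "\<alpha> / p" "\<beta> / q" l m] l m \<Lambda> assms by (intro mult_left_mono) auto
  finally have "C \<le> \<Lambda> * (\<alpha> / p * l + \<beta> / q * m)" .
  moreover have "0 < C"
  proof -
    have "0 < Beta (1 + \<alpha>) (1 + \<beta>)"
      using assms(4,5) by (simp add: Beta_def Gamma_real_pos)
    then show ?thesis using p q by (simp add: assms(7))
  qed
  ultimately have "1 / \<Lambda> \<le> 1 / C * (\<alpha> / p * l + \<beta> / q * m)"
    using \<Lambda>(1) by (simp add: field_simps)
  then show ?thesis
    by (simp add: assms(1) \<Lambda>(3) l_def m_def)
qed

end
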